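(* Let $G$ be a finite group and $k$ a splitting field for $G$ of characteristic $0$. If $V$ is a finitely generated $\mathrm{FI}_G$-module over $k$, generated in degree $m$ and related in degree $r$, then there is a polynomial $$P_V\in k\big[\{X_i^C\mid i\ge1,\ C\text{ a conjugacy class of }G\}\big]$$ of degree $\le m$ such that for all $n\ge r+\min(m,r)$ and all $g\in W_n=G\wr S_n$, $$\chi_{V_n}(g)=P_V(g),$$ where $\chi_{V_n}$ is the character of the $W_n$-representation $V_n$.
   Context: For a group $G$ and sets $R,S$, a $G$-map $R\to S$ is a pair $(a,(g_i)_{i\in R})$ with $a:R\to S$ a function and $g_i\in G$; composition is $(b,(h_j))\circ(a,(g_i))=(b\circ a,(g_ih_{a(i)}))$. $\mathrm{FI}_G$ is the category of finite sets and $G$-maps with $a$ injective; $[n]=\{1,\dots,n\}$ and $W_n=\mathrm{Aut}([n])=G\wr S_n=G^n\rtimes S_n$. An $\mathrm{FI}_G$-module over $k$ is a functor $V$ from $\mathrm{FI}_G$ to $k$-modules, $V_n=V([n])$. For $m\ge0$, $M(m)_n=k[\mathrm{Hom}_{\mathrm{FI}_G}([m],[n])]$. $V$ is finitely generated if it admits a surjection $\bigoplus_{j=1}^NM(m_j)\twoheadrightarrow V$, and generated in degree $\le d$ if one can take $\max_jm_j\le d$. For a $W_m$-representation $U$, $\mathrm{Ind}^{\mathrm{FI}_G}(U)_{m+j}=\mathrm{Ind}_{W_m\times W_j}^{W_{m+j}}(U\boxtimes k)$ with $k$ trivial; a relatively projective module is a direct sum of such modules. $V$ is related in degree $\le r$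 if there is an exact sequence $0\to K\to P\to V\to0$ with $P$ relatively projective and $K$ generated in degree $\le r$. A splitting field for $G$ is a field over which all irreducible complex representations of $G$ are defined. $X_i^C$ is the class function on every $W_n$ whose value at $g$ is the number of $C$-labeled $i$-cycles of $g$: to each $i$-cycle of the underlying permutation of $g$ is attached the conjugacy class in $G$ of the product of the $G$-entries around the cycle, and $X_i^C$ counts the $i$-cycles whose label is $C$. The variable $X_i^C$ has degree $i$. *)

theory Defs
  imports
    Complex_Main
    "HOL-Algebra.Group"
    "HOL-Library.Poly_Mapping"
    "HOL-Combinatorics.Orbits"
begin

section \<open>The category \<open>FI_G\<close>\<close>

text \<open>
  Objects are the finite sets of natural numbers, with \<open>[n] = {1..n}\<close>; every finite set is isomorphic
  to one of them. A \<open>G\<close>-map \<open>(a, (g_i))\<close> with source \<open>R\<close> is stored as a pair of functions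
  that are extensional on \<open>R\<close>, so that equality of pairs is equality of \<open>G\<close>-maps.
\<close>

type_synonym 'g gmap = "(nat \<Rightarrow> nat) \<times> (nat \<Rightarrow> 'g)"

definition fig_Hom :: "('g, 'b) monoid_scheme \<Rightarrow> nat set \<Rightarrow> nat set \<Rightarrow> 'g gmap set" where
  "fig_Hom G R S = {(a, g). a \<in> R \<rightarrow>\<^sub>E S \<and> inj_on a R \<and> g \<in> R \<rightarrow>\<^sub>E carrier G}"

text \<open>\<open>fig_comp G R \<beta> \<alpha>\<close> is \<open>\<beta> \<circ> \<alpha>\<close>, where \<open>R\<close> is the source of \<open>\<alpha>\<close>.\<close>

definition fig_comp :: "('g, 'b) monoid_scheme \<Rightarrow> nat set \<Rightarrow> 'g gmap \<Rightarrow> 'g gmap \<Rightarrow> 'g gmap" where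
  "fig_comp G R \<beta> \<alpha> =
     (compose R (fst \<beta>) (fst \<alpha>), \<lambda>i\<in>R. snd \<alpha> i \<otimes>\<^bsub>G\<^esub> snd \<beta> (fst \<alpha> i))"

definition fig_id :: "('g, 'b) monoid_scheme \<Rightarrow> nat set \<Rightarrow> 'g gmap" where
  "fig_id G R = (\<lambda>i\<in>R. i, \<lambda>i\<in>R. \<one>\<^bsub>G\<^esub>)"

text \<open>\<open>W_n = Aut([n])\<close>: an injective self-map of the finite set \<open>[n]\<close> is bijective.\<close>

definition wreath :: "('g, 'b) monoid_scheme \<Rightarrow> nat \<Rightarrow> 'g gmap monoid" where
  "wreath G n = \<lparr>carrier = fig_Hom G {1..n} {1..n}, monoid.mult = fig_comp G {1..n},
                 one = fig_id G {1..n}\<rparr>"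


section \<open>Linear maps, traces and representations\<close>

text \<open>
  A vector space over the field type \<open>'k\<close> is a subspace \<open>U\<close> of the ambient vector space given by a
  scalar multiplication \<open>s :: 'k \<Rightarrow> 'v \<Rightarrow> 'v\<close>. Maps are only meaningful on the subspace.
\<close>

definition lin_map ::
  "('k \<Rightarrow> 'v \<Rightarrow> 'v) \<Rightarrow> 'v::ab_group_add set \<Rightarrow> ('k \<Rightarrow> 'w \<Rightarrow> 'w) \<Rightarrow> 'w::ab_group_add set \<Rightarrow>
   ('v \<Rightarrow> 'w) \<Rightarrow> bool" where
  "lin_map s U t W f \<longleftrightarrow> f \<in> U \<rightarrow> W \<and>
     (\<forall>x\<in>U. \<forall>y\<in>U. f (x + y) = f x + f y) \<and> (\<forall>c. \<forall>x\<in>U. f (s c x) = t c (f x))"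

definition is_basis :: "('k::field \<Rightarrow> 'v \<Rightarrow> 'v) \<Rightarrow> 'v::ab_group_add set \<Rightarrow> 'v set \<Rightarrow> bool" where
  "is_basis s U B \<longleftrightarrow> \<not> module.dependent s B \<and> module.span s B = U"

text \<open>
  The sum of the diagonal entries of the matrix of \<open>f\<close> with respect to some basis of \<open>U\<close>;
  only meaningful for finite-dimensional \<open>U\<close>.
\<close>

definition trace_on :: "('k::field \<Rightarrow> 'v \<Rightarrow> 'v) \<Rightarrow> 'v::ab_group_add set \<Rightarrow> ('v \<Rightarrow> 'v) \<Rightarrow> 'k" where
  "trace_on s U f =
     (let B = (SOME B. is_basis s U B) in \<Sum>b\<in>B. module.representation s B (f b) b)"

definition group_rep ::
  "('h, 'b) monoid_scheme \<Rightarrow> ('k::field \<Rightarrow> 'v \<Rightarrow> 'v) \<Rightarrow> 'v::ab_group_add set \<Rightarrow>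
   ('h \<Rightarrow> 'v \<Rightarrow> 'v) \<Rightarrow> bool" where
  "group_rep H s U \<rho> \<longleftrightarrow> vector_space s \<and> module.subspace s U \<and>
     (\<forall>h\<in>carrier H. lin_map s U s U (\<rho> h)) \<and>
     (\<forall>x\<in>U. \<rho> \<one>\<^bsub>H\<^esub> x = x) \<and>
     (\<forall>h\<in>carrier H. \<forall>h'\<in>carrier H. \<forall>x\<in>U. \<rho> (h \<otimes>\<^bsub>H\<^esub> h') x = \<rho> h (\<rho> h' x))"

definition irreducible_rep ::
  "('h, 'b) monoid_scheme \<Rightarrow> ('k::field \<Rightarrow> 'v \<Rightarrow> 'v) \<Rightarrow> 'v::ab_group_add set \<Rightarrow>
   ('h \<Rightarrow> 'v \<Rightarrow> 'v) \<Rightarrow> bool" where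
  "irreducible_rep H s U \<rho> \<longleftrightarrow> group_rep H s U \<rho> \<and> U \<noteq> {0} \<and>
     (\<forall>W. module.subspace s W \<and> W \<subseteq> U \<and> (\<forall>h\<in>carrier H. \<rho> h ` W \<subseteq> W) \<longrightarrow> W = {0} \<or> W = U)"

text \<open>Some basis of \<open>U\<close> makes all matrix entries of all \<open>\<rho> h\<close> lie in \<open>F\<close>.\<close>

definition defined_over ::
  "('h, 'b) monoid_scheme \<Rightarrow> ('k::field \<Rightarrow> 'v \<Rightarrow> 'v) \<Rightarrow> 'v::ab_group_add set \<Rightarrow>
   ('h \<Rightarrow> 'v \<Rightarrow> 'v) \<Rightarrow> 'k set \<Rightarrow> bool" where
  "defined_over H s U \<rho> F \<longleftrightarrow> (\<exists>B. is_basis s U B \<and>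
     (\<forall>h\<in>carrier H. \<forall>b\<in>B. \<forall>b'\<in>B. module.representation s B (\<rho> h b) b' \<in> F))"

text \<open>Pointwise scalar multiplication of finitely supported functions.\<close>

definition pm_scale :: "('k \<Rightarrow> 'v \<Rightarrow> 'v) \<Rightarrow> 'k \<Rightarrow> ('i \<Rightarrow>\<^sub>0 'v::zero) \<Rightarrow> ('i \<Rightarrow>\<^sub>0 'v)" where
  "pm_scale s c = Poly_Mapping.map (s c)"

definition subfield_embedding :: "complex set \<Rightarrow> (complex \<Rightarrow> 'k::field) \<Rightarrow> bool" where
  "subfield_embedding F \<iota> \<longleftrightarrow> 0 \<in> F \<and> 1 \<in> F \<and>
     (\<forall>x\<in>F. \<forall>y\<in>F. x + y \<in> F \<and> x * y \<in> F) \<and> (\<forall>x\<in>F. - x \<in> F \<and> inverse x \<in> F) \<and>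
     \<iota> 1 = 1 \<and> (\<forall>x\<in>F. \<forall>y\<in>F. \<iota> (x + y) = \<iota> x + \<iota> y \<and> \<iota> (x * y) = \<iota> x * \<iota> y)"

text \<open>
  All irreducible complex representations of \<open>G\<close> are defined over \<open>'k\<close>. As \<open>'k\<close> need not be a
  subfield of the complex numbers (nor embed into them), this says that they are defined over a
  subfield \<open>F\<close> of the complex numbers which is identified by \<open>\<iota>\<close> with a subfield of \<open>'k\<close>.
  Irreducible representations of a finite group are finite-dimensional, so up to isomorphism each
  of them lives on a subspace of \<open>nat \<Rightarrow>\<^sub>0 complex\<close>.
\<close>

definition splitting_field :: "('g, 'b) monoid_scheme \<Rightarrow> 'k::field itself \<Rightarrow> bool" where
  "splitting_field G k \<longleftrightarrow> (\<exists>F. \<exists>\<iota> :: complex \<Rightarrow> 'k. subfield_embedding F \<iota> \<and>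
     (\<forall>(U :: (nat \<Rightarrow>\<^sub>0 complex) set) \<rho>.
        irreducible_rep G (pm_scale (*)) U \<rho> \<longrightarrow> defined_over G (pm_scale (*)) U \<rho> F))"


section \<open>\<open>FI_G\<close>-modules\<close>

text \<open>
  The spaces \<open>V(S)\<close> all lie in one ambient vector space, which is no loss of generality:
  embed them into their direct sum.
\<close>

record ('g, 'v) fig_functor =
  fobj :: "nat set \<Rightarrow> 'v set"
  fmap :: "nat set \<Rightarrow> nat set \<Rightarrow> 'g gmap \<Rightarrow> 'v \<Rightarrow> 'v"

definition fig_module ::
  "('g, 'b) monoid_scheme \<Rightarrow> ('k::field \<Rightarrow> 'v \<Rightarrow> 'v) \<Rightarrow> ('g, 'v::ab_group_add) fig_functor \<Rightarrow> bool" where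
  "fig_module G s V \<longleftrightarrow> vector_space s \<and>
     (\<forall>S. finite S \<longrightarrow> module.subspace s (fobj V S)) \<and>
     (\<forall>S T f. finite S \<and> finite T \<and> f \<in> fig_Hom G S T \<longrightarrow>
        lin_map s (fobj V S) s (fobj V T) (fmap V S T f)) \<and>
     (\<forall>S. finite S \<longrightarrow> (\<forall>x\<in>fobj V S. fmap V S S (fig_id G S) x = x)) \<and>
     (\<forall>R S T f h. finite R \<and> finite S \<and> finite T \<and> f \<in> fig_Hom G R S \<and> h \<in> fig_Hom G S T \<longrightarrow>
        (\<forall>x\<in>fobj V R. fmap V R T (fig_comp G R h f) x = fmap V S T h (fmap V R S f x)))"

definition fig_module_hom ::
  "('g, 'b) monoid_scheme \<Rightarrow> ('k::field \<Rightarrow> 'v \<Rightarrow> 'v) \<Rightarrow> ('g, 'v::ab_group_add) fig_functor \<Rightarrow>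
   ('k \<Rightarrow> 'w \<Rightarrow> 'w) \<Rightarrow> ('g, 'w::ab_group_add) fig_functor \<Rightarrow> (nat set \<Rightarrow> 'v \<Rightarrow> 'w) \<Rightarrow> bool" where
  "fig_module_hom G s V t W \<eta> \<longleftrightarrow>
     (\<forall>S. finite S \<longrightarrow> lin_map s (fobj V S) t (fobj W S) (\<eta> S)) \<and>
     (\<forall>S T f. finite S \<and> finite T \<and> f \<in> fig_Hom G S T \<longrightarrow>
        (\<forall>x\<in>fobj V S. \<eta> T (fmap V S T f x) = fmap W S T f (\<eta> S x)))"

definition fig_surj ::
  "('g, 'v) fig_functor \<Rightarrow> ('g, 'w) fig_functor \<Rightarrow> (nat set \<Rightarrow> 'v \<Rightarrow> 'w) \<Rightarrow> bool" where
  "fig_surj V W \<eta> \<longleftrightarrow> (\<forall>S. finite S \<longrightarrow> \<eta> S ` fobj V S = fobj W S)"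

definition fig_inj :: "('g, 'v) fig_functor \<Rightarrow> (nat set \<Rightarrow> 'v \<Rightarrow> 'w) \<Rightarrow> bool" where
  "fig_inj V \<eta> \<longleftrightarrow> (\<forall>S. finite S \<longrightarrow> inj_on (\<eta> S) (fobj V S))"

definition fig_isomorphic ::
  "('g, 'b) monoid_scheme \<Rightarrow> ('k::field \<Rightarrow> 'v \<Rightarrow> 'v) \<Rightarrow> ('g, 'v::ab_group_add) fig_functor \<Rightarrow>
   ('k \<Rightarrow> 'w \<Rightarrow> 'w) \<Rightarrow> ('g, 'w::ab_group_add) fig_functor \<Rightarrow> bool" where
  "fig_isomorphic G s V t W \<longleftrightarrow>
     (\<exists>\<eta>. fig_module_hom G s V t W \<eta> \<and> fig_inj V \<eta> \<and> fig_surj V W \<eta>)"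

text \<open>\<open>0 \<rightarrow> K \<rightarrow> P \<rightarrow> V \<rightarrow> 0\<close> with maps \<open>\<iota>\<close> and \<open>\<pi>\<close> is exact.\<close>

definition fig_short_exact ::
  "('g, 'b) monoid_scheme \<Rightarrow> ('k::field \<Rightarrow> 'x \<Rightarrow> 'x) \<Rightarrow> ('g, 'x::ab_group_add) fig_functor \<Rightarrow>
   (nat set \<Rightarrow> 'x \<Rightarrow> 'p) \<Rightarrow> ('k \<Rightarrow> 'p \<Rightarrow> 'p) \<Rightarrow> ('g, 'p::ab_group_add) fig_functor \<Rightarrow>
   (nat set \<Rightarrow> 'p \<Rightarrow> 'v) \<Rightarrow> ('k \<Rightarrow> 'v \<Rightarrow> 'v) \<Rightarrow> ('g, 'v::ab_group_add) fig_functor \<Rightarrow> bool" where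
  "fig_short_exact G u K \<iota> t P \<pi> s V \<longleftrightarrow>
     fig_module_hom G u K t P \<iota> \<and> fig_module_hom G t P s V \<pi> \<and>
     fig_inj K \<iota> \<and> fig_surj P V \<pi> \<and>
     (\<forall>S. finite S \<longrightarrow> \<iota> S ` fobj K S = {x \<in> fobj P S. \<pi> S x = 0})"

text \<open>\<open>\<Oplus>i\<in>I. F i\<close>, with scalar multiplication \<open>pm_scale s\<close>.\<close>

definition fig_dsum :: "'i set \<Rightarrow> ('i \<Rightarrow> ('g, 'v::ab_group_add) fig_functor) \<Rightarrow>
    ('g, 'i \<Rightarrow>\<^sub>0 'v) fig_functor" where
  "fig_dsum I F = \<lparr>
     fobj = \<lambda>S. {x. Poly_Mapping.keys x \<subseteq> I \<and> (\<forall>i\<in>I. Poly_Mapping.lookup x i \<in> fobj (F i) S)},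
     fmap = \<lambda>S T f x. \<Sum>i\<in>Poly_Mapping.keys x.
              Poly_Mapping.single i (fmap (F i) S T f (Poly_Mapping.lookup x i))\<rparr>"

text \<open>Push-forward: the additive extension of \<open>(f, u) \<mapsto> (h f, u)\<close> to formal sums of such pairs.\<close>

definition push :: "('x \<Rightarrow> 'y) \<Rightarrow> ('x \<Rightarrow>\<^sub>0 'v::ab_group_add) \<Rightarrow> ('y \<Rightarrow>\<^sub>0 'v)" where
  "push h x = (\<Sum>f\<in>Poly_Mapping.keys x. Poly_Mapping.single (h f) (Poly_Mapping.lookup x f))"

text \<open>\<open>M(m)(S) = k[Hom([m], S)]\<close>, with scalar multiplication \<open>pm_scale (*)\<close>.\<close>

definition fig_M :: "('g, 'b) monoid_scheme \<Rightarrow> nat \<Rightarrow> ('g, 'g gmap \<Rightarrow>\<^sub>0 'k::field) fig_functor" where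
  "fig_M G m = \<lparr>
     fobj = \<lambda>S. {x. Poly_Mapping.keys x \<subseteq> fig_Hom G {1..m} S},
     fmap = \<lambda>S T h. push (fig_comp G {1..m} h)\<rparr>"

text \<open>
  \<open>Ind(U)(S) = k[Hom([m], S)] \<otimes>\<^bsub>k[W_m]\<^esub> U\<close>, with scalar multiplication \<open>pm_scale s\<close>.
  We use the function model of an induced representation: \<open>Hom([m], [m+j])\<close> is
  \<open>W_{m+j} / W_j\<close>, so the functions on \<open>W_{m+j}\<close> with values in \<open>U \<boxtimes> k\<close> that satisfy
  \<open>\<phi> (x y) = y\<inverse> \<phi> x\<close> for \<open>y\<close> in \<open>W_m \<times> W_j\<close> are the functions on
  \<open>Hom([m], [m+j])\<close> with \<open>\<rho> w (\<phi> (f \<circ> w)) = \<phi> f\<close> for \<open>w\<close> in \<open>W_m\<close>.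
\<close>

definition fig_Ind ::
  "('g, 'b) monoid_scheme \<Rightarrow> nat \<Rightarrow> 'u::ab_group_add set \<Rightarrow> ('g gmap \<Rightarrow> 'u \<Rightarrow> 'u) \<Rightarrow>
   ('g, 'g gmap \<Rightarrow>\<^sub>0 'u) fig_functor" where
  "fig_Ind G m U \<rho> = \<lparr>
     fobj = \<lambda>S. {\<phi>. Poly_Mapping.keys \<phi> \<subseteq> fig_Hom G {1..m} S \<and>
               (\<forall>f\<in>fig_Hom G {1..m} S. Poly_Mapping.lookup \<phi> f \<in> U \<and>
                 (\<forall>w\<in>carrier (wreath G m).
                    \<rho> w (Poly_Mapping.lookup \<phi> (fig_comp G {1..m} f w)) = Poly_Mapping.lookup \<phi> f))},
     fmap = \<lambda>S T h. push (fig_comp G {1..m} h)\<rparr>"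

text \<open>\<open>V\<close> is a quotient of a finite direct sum of modules \<open>M(m_j)\<close> with all \<open>m_j\<close> in \<open>D\<close>.\<close>

definition fin_gen_in ::
  "('g, 'b) monoid_scheme \<Rightarrow> ('k::field \<Rightarrow> 'v \<Rightarrow> 'v) \<Rightarrow> ('g, 'v::ab_group_add) fig_functor \<Rightarrow>
   nat set \<Rightarrow> bool" where
  "fin_gen_in G s V D \<longleftrightarrow> (\<exists>(N::nat) (d :: nat \<Rightarrow> nat) \<eta>. (\<forall>j<N. d j \<in> D) \<and>
     fig_module_hom G (pm_scale (pm_scale (*)))
       (fig_dsum {..<N} (\<lambda>j. fig_M G (d j)) :: ('g, nat \<Rightarrow>\<^sub>0 'g gmap \<Rightarrow>\<^sub>0 'k) fig_functor) s V \<eta> \<and>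
     fig_surj (fig_dsum {..<N} (\<lambda>j. fig_M G (d j)) :: ('g, nat \<Rightarrow>\<^sub>0 'g gmap \<Rightarrow>\<^sub>0 'k) fig_functor) V \<eta>)"

definition finitely_generated where
  "finitely_generated G s V \<longleftrightarrow> fin_gen_in G s V UNIV"

definition generated_in_degree_le where
  "generated_in_degree_le G s V d \<longleftrightarrow> fin_gen_in G s V {..d}"

text \<open>
  The first two arguments fix the types from which the index set of the direct sum and the
  representation spaces are taken. In a theorem with free type variables they do not restrict
  anything.
\<close>

definition relatively_projective ::
  "'i itself \<Rightarrow> 'u::ab_group_add itself \<Rightarrow> ('g, 'b) monoid_scheme \<Rightarrow>
   ('k::field \<Rightarrow> 'p \<Rightarrow> 'p) \<Rightarrow> ('g, 'p::ab_group_add) fig_functor \<Rightarrow> bool" where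
  "relatively_projective _ _ G t P \<longleftrightarrow>
     (\<exists>(s :: 'k \<Rightarrow> 'u \<Rightarrow> 'u) (I :: 'i set) (m :: 'i \<Rightarrow> nat) (U :: 'i \<Rightarrow> 'u set) \<rho>.
        vector_space s \<and> (\<forall>i\<in>I. group_rep (wreath G (m i)) s (U i) (\<rho> i)) \<and>
        fig_isomorphic G t P (pm_scale (pm_scale s)) (fig_dsum I (\<lambda>i. fig_Ind G (m i) (U i) (\<rho> i))))"

text \<open>
  Up to isomorphism a relatively projective module and its submodules live in the type of the
  corresponding direct sum, so the modules \<open>P\<close> and \<open>K\<close> can be taken from there.
\<close>

definition related_in_degree_le ::
  "'i itself \<Rightarrow> 'u::ab_group_add itself \<Rightarrow> ('g, 'b) monoid_scheme \<Rightarrow>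
   ('k::field \<Rightarrow> 'v \<Rightarrow> 'v) \<Rightarrow> ('g, 'v::ab_group_add) fig_functor \<Rightarrow> nat \<Rightarrow> bool" where
  "related_in_degree_le ti tu G s V r \<longleftrightarrow>
     (\<exists>t (P :: ('g, 'i \<Rightarrow>\<^sub>0 'g gmap \<Rightarrow>\<^sub>0 'u) fig_functor)
       u (K :: ('g, 'i \<Rightarrow>\<^sub>0 'g gmap \<Rightarrow>\<^sub>0 'u) fig_functor) \<iota> \<pi>.
        fig_module G t P \<and> fig_module G u K \<and>
        relatively_projective ti tu G t P \<and> generated_in_degree_le G u K r \<and>
        fig_short_exact G u K \<iota> t P \<pi> s V)"

definition fig_character ::
  "('k::field \<Rightarrow> 'v \<Rightarrow> 'v) \<Rightarrow> ('g, 'v::ab_group_add) fig_functor \<Rightarrow> nat \<Rightarrow> 'g gmap \<Rightarrow> 'k" where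
  "fig_character s V n w = trace_on s (fobj V {1..n}) (fmap V {1..n} {1..n} w)"


section \<open>Character polynomials\<close>

definition conjugacy_classes :: "('g, 'b) monoid_scheme \<Rightarrow> 'g set set" where
  "conjugacy_classes G =
     (\<lambda>x. (\<lambda>y. y \<otimes>\<^bsub>G\<^esub> x \<otimes>\<^bsub>G\<^esub> inv\<^bsub>G\<^esub> y) ` carrier G) ` carrier G"

text \<open>
  \<open>g_c g_{a c} \<dots> g_{a^{i-1} c}\<close>. This order of the factors is the one for which the product is
  the \<open>c\<close>-entry of the \<open>i\<close>-th power of \<open>(a, g)\<close> with respect to \<open>fig_comp\<close>.
\<close>

definition cycle_product :: "('g, 'b) monoid_scheme \<Rightarrow> 'g gmap \<Rightarrow> nat \<Rightarrow> nat \<Rightarrow> 'g" where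
  "cycle_product G w i c =
     foldr (\<lambda>j z. snd w ((fst w ^^ j) c) \<otimes>\<^bsub>G\<^esub> z) [0..<i] \<one>\<^bsub>G\<^esub>"

text \<open>Cycles are identified with their supports; changing \<open>c\<close> within a cycle conjugates the product.\<close>

definition labeled_cycles ::
  "('g, 'b) monoid_scheme \<Rightarrow> nat \<Rightarrow> nat \<Rightarrow> 'g set \<Rightarrow> 'g gmap \<Rightarrow> nat" where
  "labeled_cycles G n i C w =
     card {Z. card Z = i \<and> (\<exists>c\<in>{1..n}. Z = orbit (fst w) c \<and> cycle_product G w i c \<in> C)}"

text \<open>
  Polynomials in variables from \<open>'x\<close> are finitely supported functions from monomials
  \<open>'x \<Rightarrow>\<^sub>0 nat\<close> to coefficients. The pair \<open>(i, C)\<close> is the variable \<open>X_i^C\<close>.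
\<close>

type_synonym ('x, 'k) mpolynomial = "('x \<Rightarrow>\<^sub>0 nat) \<Rightarrow>\<^sub>0 'k"

definition mpoly_over :: "'x set \<Rightarrow> ('x, 'k::zero) mpolynomial \<Rightarrow> bool" where
  "mpoly_over X P \<longleftrightarrow> (\<forall>mon\<in>Poly_Mapping.keys P. Poly_Mapping.keys mon \<subseteq> X)"

definition mpoly_eval :: "('x \<Rightarrow> 'k) \<Rightarrow> ('x, 'k::comm_semiring_1) mpolynomial \<Rightarrow> 'k" where
  "mpoly_eval v P = (\<Sum>mon\<in>Poly_Mapping.keys P. Poly_Mapping.lookup P mon *
     (\<Prod>x\<in>Poly_Mapping.keys mon. v x ^ Poly_Mapping.lookup mon x))"

definition mpoly_degree_le :: "('x \<Rightarrow> nat) \<Rightarrow> ('x, 'k::zero) mpolynomial \<Rightarrow> nat \<Rightarrow> bool" where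
  "mpoly_degree_le wt P d \<longleftrightarrow> (\<forall>mon\<in>Poly_Mapping.keys P.
     (\<Sum>x\<in>Poly_Mapping.keys mon. wt x * Poly_Mapping.lookup mon x) \<le> d)"

definition char_poly_eval ::
  "('g, 'b) monoid_scheme \<Rightarrow> nat \<Rightarrow> 'g gmap \<Rightarrow> (nat \<times> 'g set, 'k::comm_semiring_1) mpolynomial \<Rightarrow> 'k" where
  "char_poly_eval G n w = mpoly_eval (\<lambda>(i, C). of_nat (labeled_cycles G n i C w))"

end

theory Submission
  imports Defs
begin

text \<open>
  For an automorphism \<open>h\<close> of a set of \<open>a\<close> points let \<open>u_h(g)\<close> be the number of \<open>G\<close>-maps \<open>\<phi>\<close> into \<open>[n]\<close>
  with \<open>g \<phi> = \<phi> h\<close>. Removing the cycles of \<open>h\<close> one at a time shows that \<open>u_h\<close> is a character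
  polynomial of degree \<open>\<le> a\<close>, so it is enough to write characters as combinations of the \<open>u_h\<close> whose
  coefficients do not depend on \<open>n\<close>.

  If \<open>X\<close> is generated in degree \<open>\<le> e\<close>, then for each \<open>n\<close> the character of \<open>X_n\<close> lies in the span of
  the \<open>u_h\<close> with \<open>a \<le> e\<close>, and there it is determined by its averages over the cosets of the
  stabilizers of \<open>[a]\<close>, that is, by traces on the coinvariants of \<open>X_n\<close> under these
  stabilizers. The inclusion \<open>[n] \<subseteq> [n+1]\<close> induces maps between the coinvariants, which are onto for
  \<open>n \<ge> a + e\<close>. They are always injective for relatively projective modules and their submodules, and
  for \<open>n \<ge> a + r\<close> if \<open>X\<close> is related in degree \<open>\<le> r\<close>. Applied to the modules \<open>M(d)\<close>, whose traces twisted
  by right multiplication are the \<open>u_h\<close>, this also makes the averages of the \<open>u_h\<close> stable. Hence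
  the coefficients stabilize.

  For \<open>r > m\<close> this applies to \<open>V\<close> itself. For \<open>r \<le> m\<close> it applies to the relation module \<open>K\<close>, while \<open>P\<close>
  is induced from degrees \<open>\<le> m\<close> and its character is an explicit combination of the \<open>u_h\<close> for
  all \<open>n\<close>.
\<close>


section \<open>\<open>G\<close>-maps\<close>

text \<open>The \<open>u_h\<close> are linearly dependent, since conjugate \<open>h\<close> give the
  same function, so a character does not determine its coefficients. They are therefore chosen once,
  at the threshold, and the difference between the character and this combination is carried
  upwards: it stays in the span of the \<open>u_h\<close>, and its averages stay zero. Up to a
  factor these averages are the pairings of a class function with the \<open>u_h\<close>, so zero
  averages make the difference orthogonal to its own summands. This forces it to vanish because the
  \<open>u_h\<close> take natural values and the coefficients can be tested through rational
  functionals. In characteristic 0 the coinvariants are realized inside the module as the image of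
  an averaging projection. The comparison needs \<open>n \<ge> a + e\<close> for surjectivity and
  \<open>n \<ge> a + c\<close> for injectivity with a delay \<open>c\<close>, for all
  \<open>a \<le> e\<close>, hence \<open>n \<ge> e + max c e\<close>. For \<open>V\<close> and
  \<open>r > m\<close> this is \<open>m + r\<close>, with \<open>e = m\<close> and
  \<open>c = r\<close>; for \<open>K\<close> it is \<open>2 r\<close>, with \<open>e = r\<close> and
  \<open>c = 0\<close>. In both cases it equals \<open>r + min m r\<close>.\<close>

locale finite_group = group G for G :: "('g, 'b) monoid_scheme" (structure) +
  assumes finite_carrier: "finite (carrier G)"
begin

abbreviation Hom where "Hom \<equiv> fig_Hom G"
abbreviation comp where "comp \<equiv> fig_comp G"
abbreviation gid where "gid \<equiv> fig_id G"
abbreviation Wr where "Wr n \<equiv> fig_Hom G {1..n} {1..n}"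

lemma Hom_iff:
  "\<alpha> \<in> Hom R S \<longleftrightarrow> fst \<alpha> \<in> R \<rightarrow>\<^sub>E S \<and> inj_on (fst \<alpha>) R \<and> snd \<alpha> \<in> R \<rightarrow>\<^sub>E carrier G"
  by (auto simp: fig_Hom_def case_prod_beta)

lemma HomI:
  assumes "\<And>i. i \<in> R \<Longrightarrow> a i \<in> S" "inj_on a R" "\<And>i. i \<in> R \<Longrightarrow> g i \<in> carrier G"
  shows "(restrict a R, restrict g R) \<in> Hom R S"
  using assms by (auto simp: Hom_iff inj_on_def)

lemma HomD:
  assumes "\<alpha> \<in> Hom R S"
  shows "i \<in> R \<Longrightarrow> fst \<alpha> i \<in> S" "i \<in> R \<Longrightarrow> snd \<alpha> i \<in> carrier G" "inj_on (fst \<alpha>) R"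
  using assms by (auto simp: Hom_iff)

lemma Hom_eqI:
  assumes "\<alpha> \<in> Hom R S" "\<beta> \<in> Hom R S'"
    and "\<And>i. i \<in> R \<Longrightarrow> fst \<alpha> i = fst \<beta> i" "\<And>i. i \<in> R \<Longrightarrow> snd \<alpha> i = snd \<beta> i"
  shows "\<alpha> = \<beta>"
proof (rule prod_eqI)
  show "fst \<alpha> = fst \<beta>"
    by (rule extensionalityI[of _ R]) (use assms in \<open>simp_all add: Hom_iff PiE_iff\<close>)
  show "snd \<alpha> = snd \<beta>"
    by (rule extensionalityI[of _ R]) (use assms in \<open>simp_all add: Hom_iff PiE_iff\<close>)
qed

lemma Hom_mono: "S \<subseteq> T \<Longrightarrow> Hom R S \<subseteq> Hom R T"
  by (fastforce simp: Hom_iff)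

lemma Hom_restrict_target:
  assumes "\<alpha> \<in> Hom R T" "\<And>i. i \<in> R \<Longrightarrow> fst \<alpha> i \<in> S"
  shows "\<alpha> \<in> Hom R S"
  using assms by (auto simp: Hom_iff)

lemma fst_comp: "i \<in> R \<Longrightarrow> fst (comp R \<beta> \<alpha>) i = fst \<beta> (fst \<alpha> i)"
  and snd_comp: "i \<in> R \<Longrightarrow> snd (comp R \<beta> \<alpha>) i = snd \<alpha> i \<otimes> snd \<beta> (fst \<alpha> i)"
  by (auto simp: fig_comp_def compose_def)

lemma fst_gid: "i \<in> R \<Longrightarrow> fst (gid R) i = i"
  and snd_gid: "i \<in> R \<Longrightarrow> snd (gid R) i = \<one>"
  by (auto simp: fig_id_def)

lemma comp_in_Hom:
  assumes "\<alpha> \<in> Hom R S" "\<beta> \<in> Hom S T"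
  shows "comp R \<beta> \<alpha> \<in> Hom R T"
  using assms unfolding Hom_iff fig_comp_def
  by (auto simp: compose_def inj_on_def Pi_def PiE_def)

lemma gid_in_Hom: "R \<subseteq> S \<Longrightarrow> gid R \<in> Hom R S"
  by (auto simp: Hom_iff fig_id_def inj_on_def)

lemma comp_assoc:
  assumes "\<alpha> \<in> Hom R S" "\<beta> \<in> Hom S T" "\<gamma> \<in> Hom T U"
  shows "comp R (comp S \<gamma> \<beta>) \<alpha> = comp R \<gamma> (comp R \<beta> \<alpha>)"
proof (rule Hom_eqI)
  show "comp R (comp S \<gamma> \<beta>) \<alpha> \<in> Hom R U" "comp R \<gamma> (comp R \<beta> \<alpha>) \<in> Hom R U"
    using assms by (blast intro: comp_in_Hom)+
qed (use assms in \<open>auto simp: fst_comp snd_comp HomD[OF assms(1)] HomD[OF assms(2)] HomD[OF assms(3)] m_assoc\<close>)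

lemma comp_gid_left:
  assumes "\<alpha> \<in> Hom R S"
  shows "comp R (gid S) \<alpha> = \<alpha>"
  by (rule Hom_eqI[OF comp_in_Hom[OF assms gid_in_Hom] assms])
    (auto simp: fst_comp snd_comp fst_gid snd_gid HomD[OF assms])

lemma comp_gid_right:
  assumes "\<alpha> \<in> Hom R S"
  shows "comp R \<alpha> (gid R) = \<alpha>"
  by (rule Hom_eqI[OF comp_in_Hom[OF gid_in_Hom assms] assms])
    (auto simp: fst_comp snd_comp fst_gid snd_gid HomD[OF assms])

lemma fst_res: "i \<in> R \<Longrightarrow> fst (comp R \<alpha> (gid R)) i = fst \<alpha> i"
  by (simp add: fst_comp fst_gid)

lemma snd_res: "i \<in> R \<Longrightarrow> snd \<alpha> i \<in> carrier G \<Longrightarrow> snd (comp R \<alpha> (gid R)) i = snd \<alpha> i"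
  by (simp add: snd_comp fst_gid snd_gid)

lemma finite_Hom:
  assumes "finite R" "finite S"
  shows "finite (Hom R S)"
proof (rule finite_subset)
  show "Hom R S \<subseteq> (R \<rightarrow>\<^sub>E S) \<times> (R \<rightarrow>\<^sub>E carrier G)"
    by (auto simp: Hom_iff)
  show "finite ((R \<rightarrow>\<^sub>E S) \<times> (R \<rightarrow>\<^sub>E carrier G))"
    using assms finite_carrier by (intro finite_cartesian_product finite_PiE) auto
qed

lemma comp_left_cancel:
  assumes "\<beta> \<in> Hom S T" "\<alpha> \<in> Hom R S" "\<alpha>' \<in> Hom R S" "comp R \<beta> \<alpha> = comp R \<beta> \<alpha>'"
  shows "\<alpha> = \<alpha>'"
proof -
  have *: "fst \<alpha> i = fst \<alpha>' i" if "i \<in> R" for i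
  proof -
    have "fst \<beta> (fst \<alpha> i) = fst \<beta> (fst \<alpha>' i)"
      using assms(4) that by (metis fst_comp)
    then show ?thesis
      using HomD(3)[OF assms(1)] HomD(1)[OF assms(2) that] HomD(1)[OF assms(3) that]
      by (meson inj_onD)
  qed
  show ?thesis
  proof (rule Hom_eqI[OF assms(2,3) *])
    fix i assume i: "i \<in> R"
    have "snd \<alpha> i \<otimes> snd \<beta> (fst \<alpha> i) = snd \<alpha>' i \<otimes> snd \<beta> (fst \<alpha> i)"
      using assms(4) i *[OF i] by (metis snd_comp)
    then show "snd \<alpha> i = snd \<alpha>' i"
      using HomD[OF assms(1)] HomD[OF assms(2)] HomD[OF assms(3)] i
      by (metis right_cancel)
  qed
qed

section \<open>Automorphisms, inverses and extension of \<open>G\<close>-maps\<close>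

lemma Hom_surj:
  assumes "finite R" "w \<in> Hom R R"
  shows "fst w ` R = R"
  using assms HomD[OF assms(2)] by (intro endo_inj_surj) auto

text \<open>Every point of the finite set \<open>R\<close> has the form \<open>fst w i\<close>, so
  the composites determine both components there.\<close>

lemma comp_right_cancel:
  assumes "finite R" "w \<in> Hom R R" "\<alpha> \<in> Hom R S" "\<alpha>' \<in> Hom R S" "comp R \<alpha> w = comp R \<alpha>' w"
  shows "\<alpha> = \<alpha>'"
proof (rule Hom_eqI[OF assms(3,4)])
  fix j assume "j \<in> R"
  then obtain i where i: "i \<in> R" "j = fst w i"
    using Hom_surj[OF assms(1,2)] by blast
  show "fst \<alpha> j = fst \<alpha>' j"
    using assms(5) i by (metis fst_comp)
  have "snd w i \<otimes> snd \<alpha> j = snd w i \<otimes> snd \<alpha>' j"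
    using assms(5) i by (metis snd_comp)
  then show "snd \<alpha> j = snd \<alpha>' j"
    using HomD[OF assms(2)] HomD[OF assms(3)] HomD[OF assms(4)] i
    by (metis Units_eq Units_l_cancel)
qed

text \<open>Chosen by its left-inverse property alone. Right cancellation makes it two-sided, so an
  explicit formula occurs only in the existence proof.\<close>

definition ginv :: "nat set \<Rightarrow> 'g gmap \<Rightarrow> 'g gmap" where
  "ginv R w = (SOME v. v \<in> Hom R R \<and> comp R v w = gid R)"

lemma ginv_ex:
  assumes "finite R" "w \<in> Hom R R"
  shows "\<exists>v. v \<in> Hom R R \<and> comp R v w = gid R"
proof -
  have b: "bij_betw (fst w) R R"
    using HomD[OF assms(2)] Hom_surj[OF assms] by (auto simp: bij_betw_def)
  let ?b = "inv_into R (fst w)"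
  \<comment> \<open>The entry of the composite at \<open>i\<close> is \<open>snd w i\<close> times
    the entry of \<open>?v\<close> at \<open>fst w i\<close>, so the latter has to be the inverse of
    \<open>snd w i\<close>.\<close>
  let ?v = "(restrict ?b R, \<lambda>j\<in>R. inv (snd w (?b j)))"
  have bi: "bij_betw ?b R R"
    by (rule bij_betw_inv_into[OF b])
  have v: "?v \<in> Hom R R"
    using bij_betwE[OF bi] bij_betw_imp_inj_on[OF bi] HomD[OF assms(2)] by (intro HomI) simp_all
  moreover have "comp R ?v w = gid R"
  proof (rule Hom_eqI[OF comp_in_Hom[OF assms(2) v] gid_in_Hom[of R R]])
    fix i assume i: "i \<in> R"
    then have "fst w i \<in> R" "?b (fst w i) = i" "snd w i \<in> carrier G"
      using HomD[OF assms(2)] by (auto intro: inv_into_f_f)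
    then show "fst (comp R ?v w) i = fst (gid R) i" "snd (comp R ?v w) i = snd (gid R) i"
      using i by (auto simp: fst_comp snd_comp fst_gid snd_gid)
  qed auto
  ultimately show ?thesis by blast
qed

lemma ginv:
  assumes "finite R" "w \<in> Hom R R"
  shows "ginv R w \<in> Hom R R" "comp R (ginv R w) w = gid R" "comp R w (ginv R w) = gid R"
proof -
  show *: "ginv R w \<in> Hom R R" "comp R (ginv R w) w = gid R"
    using someI_ex[OF ginv_ex[OF assms]] by (auto simp: ginv_def)
  show "comp R w (ginv R w) = gid R"
  proof (rule comp_right_cancel[OF assms(1) assms(2) comp_in_Hom[OF *(1) assms(2)] gid_in_Hom])
    show "comp R (comp R w (ginv R w)) w = comp R (gid R) w"
      using comp_assoc[OF assms(2) *(1) assms(2)] *(2) assms(2)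
      by (simp add: comp_gid_left comp_gid_right)
  qed auto
qed

lemma comp_ginv_cancel:
  assumes "finite S" "w \<in> Hom S S" "\<alpha> \<in> Hom R S"
  shows "comp R (ginv S w) (comp R w \<alpha>) = \<alpha>" "comp R w (comp R (ginv S w) \<alpha>) = \<alpha>"
  using comp_assoc[OF assms(3,2) ginv(1)[OF assms(1,2)]]
    comp_assoc[OF assms(3) ginv(1)[OF assms(1,2)] assms(2)] ginv[OF assms(1,2)]
  by (simp_all add: comp_gid_left[OF assms(3)])

lemma comp_comp_ginv:
  assumes "finite R" "w \<in> Hom R R" "\<alpha> \<in> Hom R S"
  shows "comp R (comp R \<alpha> w) (ginv R w) = \<alpha>" "comp R (comp R \<alpha> (ginv R w)) w = \<alpha>"
  using comp_assoc[OF assms(2) ginv(1)[OF assms(1,2)] assms(3)]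
    comp_assoc[OF ginv(1)[OF assms(1,2)] assms(2,3)] ginv[OF assms(1,2)]
  by (simp_all add: comp_gid_right[OF assms(3)])

lemma bij_comp_left:
  assumes "finite S" "w \<in> Hom S S"
  shows "bij_betw (comp R w) (Hom R S) (Hom R S)"
proof (rule bij_betw_byWitness[where f' = "comp R (ginv S w)"])
qed (use assms comp_ginv_cancel[OF assms] ginv[OF assms] in \<open>auto intro: comp_in_Hom\<close>)

lemma bij_comp_right:
  assumes "finite R" "w \<in> Hom R R"
  shows "bij_betw (\<lambda>\<alpha>. comp R \<alpha> w) (Hom R S) (Hom R S)"
proof (rule bij_betw_byWitness[where f' = "\<lambda>\<alpha>. comp R \<alpha> (ginv R w)"])
qed (use assms comp_comp_ginv[OF assms] ginv[OF assms] in \<open>auto intro: comp_in_Hom\<close>)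

lemma ginv_ginv:
  assumes "finite R" "w \<in> Hom R R"
  shows "ginv R (ginv R w) = w"
  using comp_right_cancel[OF assms(1) ginv(1)[OF assms], of "ginv R (ginv R w)" R w] assms ginv
  by metis

lemma bij_ginv:
  assumes "finite R"
  shows "bij_betw (ginv R) (Hom R R) (Hom R R)"
  by (rule bij_betw_byWitness[where f' = "ginv R"]) (use assms ginv_ginv ginv in auto)

text \<open>The complements of \<open>R\<close> and of its image have the same size, and any
  bijection between them with trivial entries completes \<open>\<alpha>\<close>. So the
  automorphisms of \<open>S\<close> act transitively on \<open>Hom R S\<close>.\<close>

lemma Hom_extend:
  assumes "finite S" "R \<subseteq> S" "\<alpha> \<in> Hom R S"
  obtains w where "w \<in> Hom S S" "comp R w (gid R) = \<alpha>"
proof -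
  have inj: "inj_on (fst \<alpha>) R" and im: "fst \<alpha> ` R \<subseteq> S"
    using HomD[OF assms(3)] by auto
  have fin: "finite R" using assms finite_subset by blast
  have "card (S - R) = card (S - fst \<alpha> ` R)"
    using assms im fin by (simp add: card_Diff_subset card_image[OF inj])
  then obtain b where b: "bij_betw b (S - R) (S - fst \<alpha> ` R)"
    using finite_same_card_bij assms(1) by (metis finite_Diff)
  define a where "a i = (if i \<in> R then fst \<alpha> i else b i)" for i
  define g where "g i = (if i \<in> R then snd \<alpha> i else \<one>)" for i
  have aS: "a i \<in> S" if "i \<in> S" for i
    using that im b by (auto simp: a_def bij_betw_def)
  have inja: "inj_on a S"
  proof -
    have "inj_on a R" "a ` R = fst \<alpha> ` R"
      using inj by (auto simp: a_def inj_on_def)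
    moreover have "inj_on a (S - R)" "a ` (S - R) = S - fst \<alpha> ` R"
      using b by (simp_all add: a_def bij_betw_def inj_on_def)
    ultimately have "inj_on a (R \<union> (S - R))"
      by (subst inj_on_Un) auto
    then show ?thesis
      using assms(2) by (simp add: Un_absorb1)
  qed
  have w: "(restrict a S, restrict g S) \<in> Hom S S"
    using aS inja HomD[OF assms(3)] by (intro HomI) (auto simp: g_def)
  show ?thesis
  proof (rule that[OF w], rule Hom_eqI[OF comp_in_Hom[OF gid_in_Hom[OF assms(2)] w] assms(3)])
    fix i assume "i \<in> R"
    then show "fst (comp R (restrict a S, restrict g S) (gid R)) i = fst \<alpha> i"
      "snd (comp R (restrict a S, restrict g S) (gid R)) i = snd \<alpha> i"
      using assms(2) HomD[OF assms(3)]
      by (auto simp: fst_comp snd_comp fst_gid snd_gid a_def g_def subset_iff)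
  qed
qed

text \<open>A labeled transposition off \<open>D\<close>. The free entry \<open>k\<close> at
  \<open>z\<close> allows a group entry to be corrected together with its target;
  \<open>z = y\<close> is allowed.\<close>

lemma Hom_move:
  assumes "D \<subseteq> S" "z \<in> S - D" "y \<in> S - D" "k \<in> carrier G"
  obtains \<tau> where "\<tau> \<in> Hom S S" "comp D \<tau> (gid D) = gid D" "fst \<tau> z = y" "snd \<tau> z = k"
    "\<And>i. i \<in> S \<Longrightarrow> i \<noteq> z \<Longrightarrow> i \<noteq> y \<Longrightarrow> fst \<tau> i = i" "\<And>i. i \<in> S \<Longrightarrow> i \<noteq> z \<Longrightarrow> snd \<tau> i = \<one>"
    "fst \<tau> y = z"
proof -
  let ?t = "(restrict (Transposition.transpose z y) S, \<lambda>i\<in>S. if i = z then k else \<one>)"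
  have t: "?t \<in> Hom S S"
    using assms by (intro HomI) (auto simp: Transposition.transpose_def inj_on_def split: if_splits)
  have fixD: "comp D ?t (gid D) = gid D"
  proof (rule Hom_eqI[OF comp_in_Hom[OF gid_in_Hom[OF assms(1)] t] gid_in_Hom[OF assms(1)]])
    fix i assume i: "i \<in> D"
    then have "i \<in> S" "i \<noteq> z" "i \<noteq> y" using assms by auto
    with i show "fst (comp D ?t (gid D)) i = fst (gid D) i" "snd (comp D ?t (gid D)) i = snd (gid D) i"
      by (simp_all add: fst_comp snd_comp fst_gid snd_gid)
  qed
  have "z \<in> S" "y \<in> S" using assms by auto
  then show ?thesis
    by (intro that[OF t fixD]) simp_all
qed

end


section \<open>Traces on finite-dimensional subspaces\<close>

lemma lin_map_in: "lin_map s U t W f \<Longrightarrow> x \<in> U \<Longrightarrow> f x \<in> W"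
  and lin_map_add: "lin_map s U t W f \<Longrightarrow> x \<in> U \<Longrightarrow> y \<in> U \<Longrightarrow> f (x + y) = f x + f y"
  and lin_map_scale: "lin_map s U t W f \<Longrightarrow> x \<in> U \<Longrightarrow> f (s c x) = t c (f x)"
  by (auto simp: lin_map_def)

lemma lin_mapI:
  assumes "\<And>x. x \<in> U \<Longrightarrow> f x \<in> W" "\<And>x y. x \<in> U \<Longrightarrow> y \<in> U \<Longrightarrow> f (x + y) = f x + f y"
    "\<And>c x. x \<in> U \<Longrightarrow> f (s c x) = t c (f x)"
  shows "lin_map s U t W f"
  using assms by (auto simp: lin_map_def)

lemma lin_map_cong:
  assumes "lin_map s U t W f" "module s" "module.subspace s U" "\<And>x. x \<in> U \<Longrightarrow> f x = g x"
  shows "lin_map s U t W g"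
proof -
  interpret module s by fact
  show ?thesis
    using assms(1,3,4) by (auto simp: lin_map_def subspace_add subspace_scale Pi_iff)
qed

lemma lin_map_compose:
  assumes "lin_map s U t W f" "lin_map t W u X g"
  shows "lin_map s U u X (\<lambda>x. g (f x))"
  using assms by (auto simp: lin_map_def Pi_iff)

lemma lin_map_zero:
  assumes "lin_map s U t W f" "module s" "module.subspace s U"
  shows "f 0 = 0"
proof -
  interpret module s by fact
  have "f (0 + 0) = f 0 + f 0"
    using assms subspace_0 by (intro lin_map_add) auto
  then show ?thesis by simp
qed

lemma lin_map_sum:
  assumes "lin_map s U t W f" "module s" "module.subspace s U" "\<And>i. i \<in> I \<Longrightarrow> x i \<in> U"
  shows "f (\<Sum>i\<in>I. x i) = (\<Sum>i\<in>I. f (x i))"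
proof -
  interpret module s by fact
  show ?thesis
    using assms(4)
  proof (induction I rule: infinite_finite_induct)
    case (insert i I)
    have "f (x i + sum x I) = f (x i) + f (sum x I)"
      using insert assms by (intro lin_map_add[OF assms(1)]) (auto intro: subspace_sum)
    with insert show ?case by simp
  qed (simp_all add: lin_map_zero[OF assms(1-3)])
qed

lemma lin_map_minus:
  assumes "lin_map s U t W f" "module s" "module.subspace s U" "x \<in> U" "y \<in> U"
  shows "f (x - y) = f x - f y"
proof -
  interpret module s by fact
  have "f ((x - y) + y) = f (x - y) + f y"
    using assms by (intro lin_map_add[OF assms(1)]) (auto intro: subspace_diff)
  then show ?thesis by (simp add: algebra_simps)
qed

lemma lin_map_sum_fun:
  assumes "module t" "module.subspace t W" "\<And>i. i \<in> I \<Longrightarrow> lin_map s U t W (f i)"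
  shows "lin_map s U t W (\<lambda>x. \<Sum>i\<in>I. f i x)"
proof -
  interpret module t by fact
  show ?thesis
    using assms(2,3)
    by (intro lin_mapI) (auto simp: lin_map_def Pi_iff sum.distrib scale_sum_right intro!: subspace_sum sum.cong)
qed

lemma lin_map_scale_fun:
  assumes "module t" "module.subspace t W" "lin_map (s :: 'k::field \<Rightarrow> _) U t W f"
  shows "lin_map s U t W (\<lambda>x. t c (f x))"
proof -
  interpret module t by fact
  show ?thesis
    using assms(2,3)
    by (intro lin_mapI) (auto simp: lin_map_def Pi_iff scale_right_distrib subspace_scale mult.commute)
qed

text \<open>A \<open>frame\<close> is a spanning family together with linear coefficient functionals; unlike a basis
  it can be averaged over a group.\<close>

definition frame :: "('k::field \<Rightarrow> 'v \<Rightarrow> 'v) \<Rightarrow> 'v::ab_group_add set \<Rightarrow> 'i set \<Rightarrow>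
    ('i \<Rightarrow> 'v \<Rightarrow> 'k) \<Rightarrow> ('i \<Rightarrow> 'v) \<Rightarrow> bool" where
  "frame s U I c v \<longleftrightarrow> finite I \<and> (\<forall>i\<in>I. v i \<in> U \<and> lin_map s U (*) UNIV (c i)) \<and>
     (\<forall>x\<in>U. (\<Sum>i\<in>I. s (c i x) (v i)) = x)"

definition fin_dim :: "('k::field \<Rightarrow> 'v \<Rightarrow> 'v) \<Rightarrow> 'v::ab_group_add set \<Rightarrow> bool" where
  "fin_dim s U \<longleftrightarrow> vector_space s \<and> module.subspace s U \<and> (\<exists>B. finite B \<and> module.span s B = U)"

lemma fin_dim_vs: "fin_dim s U \<Longrightarrow> vector_space s"
  and fin_dim_subspace: "fin_dim s U \<Longrightarrow> module.subspace s U"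
  and fin_dim_module: "fin_dim s U \<Longrightarrow> module s"
  by (auto simp: fin_dim_def vector_space_def module_def)

lemma vector_space_module: "vector_space s \<Longrightarrow> module s"
  by (auto simp: vector_space_def module_def)

lemma vector_space_mult: "vector_space ((*) :: 'k::field \<Rightarrow> 'k \<Rightarrow> 'k)"
  by (unfold_locales) (auto simp: algebra_simps)

lemma module_mult: "module ((*) :: 'k::field \<Rightarrow> 'k \<Rightarrow> 'k)"
  by (rule vector_space_module[OF vector_space_mult])

lemma subspace_UNIV_mult: "module.subspace ((*) :: 'k::field \<Rightarrow> 'k \<Rightarrow> 'k) UNIV"
  by (simp add: module.subspace_def[OF module_mult])

lemma frame_of_basis:
  assumes "vector_space s" "is_basis s U B" "finite B"
  shows "frame s U B (\<lambda>b x. module.representation s B x b) (\<lambda>b. b)"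
proof -
  interpret vector_space s by fact
  have B: "independent B" "span B = U"
    using assms by (auto simp: is_basis_def)
  show ?thesis
    unfolding frame_def
  proof (intro conjI ballI)
    fix b assume "b \<in> B"
    then show "b \<in> U" using B span_base by blast
    show "lin_map s U (*) UNIV (\<lambda>x. representation B x b)"
      by (intro lin_mapI) (use B in \<open>auto simp: representation_add representation_scale\<close>)
  next
    fix x assume "x \<in> U"
    then show "(\<Sum>b\<in>B. s (representation B x b) b) = x"
      using B assms(3) by (intro sum_representation_eq) auto
  qed (use assms in auto)
qed

lemma fin_dim_basis_finite:
  assumes "fin_dim s U" "is_basis s U B"
  shows "finite B"
proof -
  interpret vector_space s using fin_dim_vs[OF assms(1)] .
  obtain T where T: "finite T" "span T = U"
    using assms(1) by (auto simp: fin_dim_def)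
  have "B \<subseteq> span T" "independent B"
    using assms(2) T span_superset[of B] by (auto simp: is_basis_def)
  then show ?thesis
    using independent_span_bound[OF T(1)] by blast
qed

lemma basis_ex:
  assumes "vector_space s" "module.subspace s U"
  shows "\<exists>B. is_basis s U B"
proof -
  interpret vector_space s by fact
  obtain B where "B \<subseteq> U" "independent B" "U \<subseteq> span B"
    using maximal_independent_subset by blast
  then have "is_basis s U B"
    using assms(2) span_subspace by (simp add: is_basis_def)
  then show ?thesis by blast
qed

text \<open>Expanding each \<open>u i\<close> in the basis and exchanging the sums gives the value
  for whatever basis \<open>trace_on\<close> has chosen. Later trace computations rest on such sums
  of rank-one maps.\<close>

lemma trace_nuclear:
  assumes U: "fin_dim s U" and I: "finite I"
    and c: "\<And>i. i \<in> I \<Longrightarrow> lin_map s U (*) UNIV (c i)" and u: "\<And>i. i \<in> I \<Longrightarrow> u i \<in> U"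
    and f: "\<And>x. x \<in> U \<Longrightarrow> f x = (\<Sum>i\<in>I. s (c i x) (u i))"
  shows "trace_on s U f = (\<Sum>i\<in>I. c i (u i))"
proof -
  interpret vector_space s using fin_dim_vs[OF U] .
  have sub: "subspace U" using fin_dim_subspace[OF U] .
  define B where "B = (SOME B. is_basis s U B)"
  have B: "is_basis s U B"
    unfolding B_def using basis_ex[OF fin_dim_vs[OF U] sub] by (rule someI_ex)
  have finB: "finite B" by (rule fin_dim_basis_finite[OF U B])
  have fr: "frame s U B (\<lambda>b x. representation B x b) (\<lambda>b. b)"
    by (rule frame_of_basis[OF fin_dim_vs[OF U] B finB])
  let ?r = "representation B"
  have r: "lin_map s U (*) UNIV (\<lambda>x. ?r x b)" "b \<in> U" if "b \<in> B" for b
    using fr that by (auto simp: frame_def)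
  have "trace_on s U f = (\<Sum>b\<in>B. ?r (f b) b)"
    by (simp add: trace_on_def B_def Let_def)
  also have "\<dots> = (\<Sum>b\<in>B. \<Sum>i\<in>I. c i b * ?r (u i) b)"
  proof (rule sum.cong[OF refl])
    fix b assume b: "b \<in> B"
    have "?r (f b) b = ?r (\<Sum>i\<in>I. s (c i b) (u i)) b"
      using f[OF r(2)[OF b]] by simp
    also have "\<dots> = (\<Sum>i\<in>I. ?r (s (c i b) (u i)) b)"
      by (rule lin_map_sum[OF r(1)[OF b] module_axioms sub]) (use u sub subspace_scale in auto)
    also have "\<dots> = (\<Sum>i\<in>I. c i b * ?r (u i) b)"
      by (rule sum.cong[OF refl]) (rule lin_map_scale[OF r(1)[OF b] u])
    finally show "?r (f b) b = \<dots>" .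
  qed
  also have "\<dots> = (\<Sum>i\<in>I. \<Sum>b\<in>B. ?r (u i) b * c i b)"
    by (subst sum.swap) (simp add: mult.commute)
  also have "\<dots> = (\<Sum>i\<in>I. c i (u i))"
  proof (rule sum.cong[OF refl])
    fix i assume i: "i \<in> I"
    have "c i (u i) = c i (\<Sum>b\<in>B. s (?r (u i) b) b)"
      using fr u[OF i] by (simp add: frame_def)
    also have "\<dots> = (\<Sum>b\<in>B. c i (s (?r (u i) b) b))"
      by (rule lin_map_sum[OF c[OF i] module_axioms sub]) (use r sub subspace_scale in auto)
    also have "\<dots> = (\<Sum>b\<in>B. ?r (u i) b * c i b)"
      by (rule sum.cong[OF refl]) (rule lin_map_scale[OF c[OF i] r(2)])
    finally show "(\<Sum>b\<in>B. ?r (u i) b * c i b) = c i (u i)" by simp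
  qed
  finally show ?thesis .
qed

lemma frame_fin_dim:
  assumes "vector_space s" "module.subspace s U" "frame s U I c v"
  shows "fin_dim s U"
proof -
  interpret vector_space s by fact
  have "U \<subseteq> span (v ` I)"
  proof
    fix x assume "x \<in> U"
    then have "x = (\<Sum>i\<in>I. s (c i x) (v i))" using assms(3) by (simp add: frame_def)
    then show "x \<in> span (v ` I)"
      using span_sum[of I "\<lambda>i. s (c i x) (v i)" "v ` I"] span_scale span_base by auto
  qed
  moreover have "span (v ` I) \<subseteq> U"
    using assms by (intro span_minimal) (auto simp: frame_def)
  ultimately show ?thesis
    using assms by (auto simp: fin_dim_def frame_def intro!: exI[of _ "v ` I"])
qed

lemma trace_frame:
  assumes "vector_space s" "module.subspace s U" "frame s U I c v" "lin_map s U s U f"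
  shows "trace_on s U f = (\<Sum>i\<in>I. c i (f (v i)))"
proof (rule trace_nuclear[OF frame_fin_dim[OF assms(1-3)]])
  fix x assume x: "x \<in> U"
  interpret vector_space s by fact
  have v: "v i \<in> U" if "i \<in> I" for i using assms(3) that by (simp add: frame_def)
  have "f x = f (\<Sum>i\<in>I. s (c i x) (v i))" using assms(3) x by (simp add: frame_def)
  also have "\<dots> = (\<Sum>i\<in>I. f (s (c i x) (v i)))"
    by (rule lin_map_sum[OF assms(4) module_axioms assms(2)]) (use v subspace_scale assms(2) in auto)
  also have "\<dots> = (\<Sum>i\<in>I. s (c i x) (f (v i)))"
    by (rule sum.cong[OF refl]) (rule lin_map_scale[OF assms(4) v])
  finally show "f x = (\<Sum>i\<in>I. s (c i x) (f (v i)))" .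
qed (use assms in \<open>auto simp: frame_def lin_map_def\<close>)

lemma frame_ex:
  assumes "fin_dim s U"
  shows "\<exists>B c. frame s U B c (\<lambda>b. b)"
proof -
  obtain B where B: "is_basis s U B"
    using basis_ex[OF fin_dim_vs[OF assms] fin_dim_subspace[OF assms]] by blast
  show ?thesis
    using frame_of_basis[OF fin_dim_vs[OF assms] B fin_dim_basis_finite[OF assms B]] by blast
qed

text \<open>Coefficients are chosen freely on a basis and extended linearly through the basis
  coordinates, so that redundant spanning families also get linear coefficient functionals.\<close>

lemma frame_of_spanning:
  assumes "vector_space s" "finite I" "module.span s (v ` I) = U"
  shows "\<exists>c. frame s U I c v"
proof -
  interpret vector_space s by fact
  have fd: "fin_dim s U"
    using assms by (auto simp: fin_dim_def)
  have sub: "subspace U" by (rule fin_dim_subspace[OF fd])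
  obtain B d where B: "frame s U B d (\<lambda>b. b)" using frame_ex[OF fd] by blast
  have vU: "v i \<in> U" if "i \<in> I" for i using assms(3) that span_base by blast
  have "\<exists>k. b = (\<Sum>i\<in>I. s (k i) (v i))" if "b \<in> U" for b
  proof -
    have "b \<in> span (v ` I)" using that assms by simp
    then show ?thesis
    proof (induction rule: span_induct_alt)
      case base
      then show ?case by (intro exI[of _ "\<lambda>_. 0"]) simp
    next
      case (step a x y)
      then obtain k j where kj: "y = (\<Sum>i\<in>I. s (k i) (v i))" "j \<in> I" "x = v j" by blast
      show ?case
        using kj assms(2)
        by (intro exI[of _ "\<lambda>i. (if i = j then a else 0) + k i"])
          (simp add: scale_left_distrib sum.distrib if_distrib[of "\<lambda>q. s q _"] sum.delta' cong: if_cong)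
    qed
  qed
  then obtain k where k: "\<And>b. b \<in> U \<Longrightarrow> b = (\<Sum>i\<in>I. s (k b i) (v i))" by metis
  define c where "c i x = (\<Sum>b\<in>B. d b x * k b i)" for i x
  have "frame s U I c v"
    unfolding frame_def
  proof (intro conjI ballI)
    fix i assume "i \<in> I"
    show "v i \<in> U" using \<open>i \<in> I\<close> vU by blast
    show "lin_map s U (*) UNIV (c i)"
      unfolding c_def using B
      by (intro lin_mapI) (auto simp: frame_def lin_map_def sum.distrib sum_distrib_left algebra_simps)
  next
    fix x assume x: "x \<in> U"
    have "(\<Sum>i\<in>I. s (c i x) (v i)) = (\<Sum>b\<in>B. s (d b x) (\<Sum>i\<in>I. s (k b i) (v i)))"
      unfolding c_def scale_sum_left scale_sum_right scale_scale by (rule sum.swap)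
    also have "\<dots> = (\<Sum>b\<in>B. s (d b x) b)"
      using B k by (intro sum.cong refl arg_cong[where f = "s _"]) (metis frame_def)
    also have "\<dots> = x" using B x by (simp add: frame_def)
    finally show "(\<Sum>i\<in>I. s (c i x) (v i)) = x" .
  qed (use assms in auto)
  then show ?thesis by blast
qed

text \<open>With a frame \<open>c, b\<close> of \<open>W\<close>, the map \<open>g f\<close> is a
  sum of rank-one maps with functionals \<open>c b (f x)\<close> and vectors \<open>g b\<close>; its
  trace is that of \<open>f g\<close>. The two spaces may have different dimensions, which the
  comparison of consecutive degrees exploits.\<close>

lemma trace_commute:
  assumes U: "fin_dim s U" and W: "fin_dim t W"
    and f: "lin_map s U t W f" and g: "lin_map t W s U g"
  shows "trace_on s U (\<lambda>x. g (f x)) = trace_on t W (\<lambda>y. f (g y))"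
proof -
  interpret S: vector_space s using fin_dim_vs[OF U] .
  interpret T: vector_space t using fin_dim_vs[OF W] .
  obtain B c where B: "frame t W B c (\<lambda>b. b)" using frame_ex[OF W] by blast
  have b: "b \<in> W" "lin_map t W (*) UNIV (c b)" if "b \<in> B" for b
    using B that by (auto simp: frame_def)
  have "trace_on s U (\<lambda>x. g (f x)) = (\<Sum>b\<in>B. c b (f (g b)))"
  proof (rule trace_nuclear[OF U, where c = "\<lambda>b x. c b (f x)"])
    fix x assume x: "x \<in> U"
    have "g (f x) = g (\<Sum>b\<in>B. t (c b (f x)) b)"
      using B lin_map_in[OF f x] by (simp add: frame_def)
    also have "\<dots> = (\<Sum>b\<in>B. g (t (c b (f x)) b))"
      by (rule lin_map_sum[OF g T.module_axioms fin_dim_subspace[OF W]])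
        (use b T.subspace_scale fin_dim_subspace[OF W] in auto)
    also have "\<dots> = (\<Sum>b\<in>B. s (c b (f x)) (g b))"
      by (rule sum.cong[OF refl]) (rule lin_map_scale[OF g b(1)])
    finally show "g (f x) = (\<Sum>b\<in>B. s (c b (f x)) (g b))" .
  next
    show "lin_map s U (*) UNIV (\<lambda>x. c b (f x))" if "b \<in> B" for b
      by (rule lin_map_compose[OF f b(2)[OF that]])
  qed (use B b lin_map_in[OF g] in \<open>auto simp: frame_def\<close>)
  also have "\<dots> = trace_on t W (\<lambda>y. f (g y))"
    by (rule trace_frame[OF fin_dim_vs[OF W] fin_dim_subspace[OF W] B lin_map_compose[OF g f], symmetric])
  finally show ?thesis .
qed

lemma trace_cong:
  assumes "fin_dim s U" "lin_map s U s U f" "\<And>x. x \<in> U \<Longrightarrow> f x = g x"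
  shows "trace_on s U f = trace_on s U g"
proof -
  obtain B c where B: "frame s U B c (\<lambda>b. b)" using frame_ex[OF assms(1)] by blast
  have "lin_map s U s U g"
    by (rule lin_map_cong[OF assms(2) fin_dim_module[OF assms(1)] fin_dim_subspace[OF assms(1)] assms(3)])
  then show ?thesis
    using trace_frame[OF fin_dim_vs[OF assms(1)] fin_dim_subspace[OF assms(1)] B] assms(2,3) B
    by (auto simp: frame_def intro!: sum.cong)
qed

lemma trace_sum:
  assumes "fin_dim s U" "\<And>i. i \<in> I \<Longrightarrow> lin_map s U s U (f i)"
  shows "trace_on s U (\<lambda>x. \<Sum>i\<in>I. f i x) = (\<Sum>i\<in>I. trace_on s U (f i))"
proof -
  obtain B c where B: "frame s U B c (\<lambda>b. b)" using frame_ex[OF assms(1)] by blast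
  note vs = fin_dim_vs[OF assms(1)] fin_dim_subspace[OF assms(1)]
  have b: "b \<in> U" "lin_map s U (*) UNIV (c b)" if "b \<in> B" for b
    using B that by (auto simp: frame_def)
  have "trace_on s U (\<lambda>x. \<Sum>i\<in>I. f i x) = (\<Sum>b\<in>B. c b (\<Sum>i\<in>I. f i b))"
    by (rule trace_frame[OF vs B]) (rule lin_map_sum_fun[OF vector_space_module[OF vs(1)] vs(2) assms(2)])
  also have "\<dots> = (\<Sum>b\<in>B. \<Sum>i\<in>I. c b (f i b))"
    by (intro sum.cong refl lin_map_sum[OF b(2) vector_space_module[OF vs(1)] vs(2)])
      (use assms(2) b in \<open>auto intro: lin_map_in\<close>)
  also have "\<dots> = (\<Sum>i\<in>I. \<Sum>b\<in>B. c b (f i b))" by (rule sum.swap)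
  also have "\<dots> = (\<Sum>i\<in>I. trace_on s U (f i))"
    by (intro sum.cong refl trace_frame[OF vs B, symmetric] assms(2))
  finally show ?thesis .
qed

lemma trace_scale:
  assumes "fin_dim s U" "lin_map s U s U f"
  shows "trace_on s U (\<lambda>x. s a (f x)) = a * trace_on s U f"
proof -
  obtain B c where B: "frame s U B c (\<lambda>b. b)" using frame_ex[OF assms(1)] by blast
  note vs = fin_dim_vs[OF assms(1)] fin_dim_subspace[OF assms(1)]
  have "trace_on s U (\<lambda>x. s a (f x)) = (\<Sum>b\<in>B. c b (s a (f b)))"
    by (rule trace_frame[OF vs B]) (rule lin_map_scale_fun[OF vector_space_module[OF vs(1)] vs(2) assms(2)])
  also have "\<dots> = (\<Sum>b\<in>B. a * c b (f b))"
    by (rule sum.cong[OF refl], rule lin_map_scale) (use B assms(2) in \<open>auto simp: frame_def intro: lin_map_in\<close>)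
  finally show ?thesis
    by (simp add: trace_frame[OF vs B assms(2)] sum_distrib_left)
qed

lemma fin_dim_image:
  assumes U: "fin_dim s U" and t: "vector_space t" and f: "lin_map s U t W f"
  shows "fin_dim t (f ` U)"
proof -
  interpret S: vector_space s using fin_dim_vs[OF U] .
  interpret T: vector_space t by fact
  have sub: "S.subspace U" by (rule fin_dim_subspace[OF U])
  obtain B c where B: "frame s U B c (\<lambda>b. b)" using frame_ex[OF U] by blast
  have "T.subspace (f ` U)"
    unfolding T.subspace_def
  proof (intro conjI ballI allI)
    show "0 \<in> f ` U"
      using lin_map_zero[OF f S.module_axioms sub] S.subspace_0[OF sub] by force
  next
    fix x y assume "x \<in> f ` U" "y \<in> f ` U"
    then show "x + y \<in> f ` U"
      using lin_map_add[OF f] S.subspace_add[OF sub] by (auto simp: image_iff) metis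
  next
    fix c x assume "x \<in> f ` U"
    then show "t c x \<in> f ` U"
      using lin_map_scale[OF f] S.subspace_scale[OF sub] by (auto simp: image_iff) metis
  qed
  moreover have "T.span (f ` B) = f ` U"
  proof (rule T.span_subspace)
    show "f ` B \<subseteq> f ` U" using B by (auto simp: frame_def)
    show "f ` U \<subseteq> T.span (f ` B)"
    proof
      fix y assume "y \<in> f ` U"
      then obtain x where x: "x \<in> U" "y = f x" by blast
      have "f x = f (\<Sum>b\<in>B. s (c b x) b)" using B x by (simp add: frame_def)
      also have "\<dots> = (\<Sum>b\<in>B. f (s (c b x) b))"
        by (rule lin_map_sum[OF f S.module_axioms sub]) (use B S.subspace_scale[OF sub] in \<open>auto simp: frame_def\<close>)
      also have "\<dots> = (\<Sum>b\<in>B. t (c b x) (f b))"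
        by (rule sum.cong[OF refl], rule lin_map_scale[OF f]) (use B in \<open>auto simp: frame_def\<close>)
      finally show "y \<in> T.span (f ` B)"
        unfolding x(2) by (simp add: T.span_sum T.span_scale T.span_base)
    qed
    show "T.subspace (f ` U)" by fact
  qed
  ultimately show ?thesis
    using B t by (auto simp: fin_dim_def frame_def intro!: exI[of _ "f ` B"])
qed

lemma linear_section:
  assumes W: "fin_dim t W" and s: "vector_space s" "module.subspace s U"
    and f: "lin_map s U t W f" "f ` U = W"
  shows "\<exists>g. lin_map t W s U g \<and> (\<forall>y\<in>W. f (g y) = y)"
proof -
  interpret S: vector_space s by fact
  interpret T: vector_space t using fin_dim_vs[OF W] .
  obtain B c where B: "frame t W B c (\<lambda>b. b)" using frame_ex[OF W] by blast
  have "\<forall>b\<in>B. \<exists>x. x \<in> U \<and> f x = b"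
    using B f(2) by (auto simp: frame_def)
  then obtain l where l: "\<And>b. b \<in> B \<Longrightarrow> l b \<in> U \<and> f (l b) = b" by metis
  define g where "g y = (\<Sum>b\<in>B. s (c b y) (l b))" for y
  have "lin_map t W s U g"
    unfolding g_def using B l
    by (intro lin_mapI) (auto simp: frame_def lin_map_def sum.distrib S.scale_left_distrib
        S.scale_sum_right intro!: S.subspace_sum[OF s(2)] S.subspace_scale[OF s(2)])
  moreover have "f (g y) = y" if "y \<in> W" for y
  proof -
    have "f (g y) = (\<Sum>b\<in>B. f (s (c b y) (l b)))"
      unfolding g_def
      by (rule lin_map_sum[OF f(1) S.module_axioms s(2)]) (use l S.subspace_scale[OF s(2)] in auto)
    also have "\<dots> = (\<Sum>b\<in>B. t (c b y) b)"
      by (rule sum.cong[OF refl]) (use l lin_map_scale[OF f(1)] in auto)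
    also have "\<dots> = y" using B that by (simp add: frame_def)
    finally show ?thesis .
  qed
  ultimately show ?thesis by blast
qed

text \<open>For a section \<open>g\<close> of \<open>p\<close>, every \<open>x\<close> is
  \<open>g (p x)\<close> plus an element of the image of \<open>K\<close>, so finite spanning sets
  of both images span \<open>P\<close>.\<close>

lemma fin_dim_extension:
  assumes K: "fin_dim u K" and V: "fin_dim s V" and t: "vector_space t" "module.subspace t P"
    and i: "lin_map u K t P i" and p: "lin_map t P s V p" "p ` P = V"
    and ex: "i ` K = {x \<in> P. p x = 0}"
  shows "fin_dim t P"
proof -
  interpret T: vector_space t by fact
  interpret S: vector_space s using fin_dim_vs[OF V] .
  obtain g where g: "lin_map s V t P g" "\<And>y. y \<in> V \<Longrightarrow> p (g y) = y"
    using linear_section[OF V t p] by blast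
  obtain A where A: "finite A" "T.span A = i ` K"
    using fin_dim_image[OF K t(1) i] by (auto simp: fin_dim_def)
  obtain B where B: "finite B" "T.span B = g ` V"
    using fin_dim_image[OF V t(1) g(1)] by (auto simp: fin_dim_def)
  have "T.span (A \<union> B) = P"
  proof (rule T.span_subspace)
    have "A \<subseteq> P" using T.span_superset[of A] A ex by blast
    moreover have "B \<subseteq> P" using T.span_superset[of B] lin_map_in[OF g(1)] unfolding B(2) by auto
    ultimately show "A \<union> B \<subseteq> P" by blast
    show "P \<subseteq> T.span (A \<union> B)"
    proof
      fix x assume x: "x \<in> P"
      have gp: "g (p x) \<in> P" using x by (intro lin_map_in[OF g(1)] lin_map_in[OF p(1)])
      have "p (x - g (p x)) = 0"
        using lin_map_minus[OF p(1) T.module_axioms t(2) x gp] g(2) lin_map_in[OF p(1) x] by simp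
      then have "x - g (p x) \<in> T.span A"
        unfolding A(2) ex using x gp T.subspace_diff[OF t(2)] by blast
      moreover have "g (p x) \<in> T.span B" unfolding B using lin_map_in[OF p(1) x] by blast
      ultimately have "(x - g (p x)) + g (p x) \<in> T.span (A \<union> B)"
        by (meson T.span_add T.span_mono in_mono sup_ge1 sup_ge2)
      then show "x \<in> T.span (A \<union> B)" by simp
    qed
  qed fact
  then show ?thesis
    using A B t by (auto simp: fin_dim_def intro!: exI[of _ "A \<union> B"])
qed

text \<open>A linear section \<open>g\<close> of \<open>p\<close> gives the decomposition
  \<open>x = i (r x) + g (p x)\<close>. The two resulting parts of \<open>b\<close> factor through
  \<open>K\<close> and \<open>V\<close>, and \<open>trace_commute\<close> moves their traces
  there.\<close>

lemma trace_exact: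
  assumes K: "fin_dim u K" and P: "fin_dim t P" and V: "fin_dim s V"
    and i: "lin_map u K t P i" "inj_on i K" and p: "lin_map t P s V p" "p ` P = V"
    and ex: "i ` K = {x \<in> P. p x = 0}"
    and a: "lin_map u K u K a" and b: "lin_map t P t P b" and c: "lin_map s V s V c"
    and ia: "\<And>x. x \<in> K \<Longrightarrow> i (a x) = b (i x)" and pb: "\<And>x. x \<in> P \<Longrightarrow> p (b x) = c (p x)"
  shows "trace_on t P b = trace_on u K a + trace_on s V c"
proof -
  interpret T: vector_space t using fin_dim_vs[OF P] .
  interpret S: vector_space s using fin_dim_vs[OF V] .
  interpret U: vector_space u using fin_dim_vs[OF K] .
  note sP = fin_dim_subspace[OF P] and sK = fin_dim_subspace[OF K]
  obtain g where g: "lin_map s V t P g" "\<And>y. y \<in> V \<Longrightarrow> p (g y) = y"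
    using linear_section[OF V fin_dim_vs[OF P] sP p] by blast
  have gp: "g (p x) \<in> P" if "x \<in> P" for x using that by (intro lin_map_in[OF g(1)] lin_map_in[OF p(1)])
  define r where "r x = inv_into K i (x - g (p x))" for x
  have r: "r x \<in> K" "i (r x) = x - g (p x)" if "x \<in> P" for x
  proof -
    have "p (x - g (p x)) = 0"
      using lin_map_minus[OF p(1) T.module_axioms sP that gp[OF that]] g(2) lin_map_in[OF p(1) that] by simp
    then have *: "x - g (p x) \<in> i ` K"
      unfolding ex using that gp T.subspace_diff[OF sP] by blast
    show "r x \<in> K" "i (r x) = x - g (p x)"
      unfolding r_def using inv_into_into[OF *] f_inv_into_f[OF *] by auto
  qed
  have injD: "x = y" if "x \<in> K" "y \<in> K" "i x = i y" for x y
    using i(2) that by (meson inj_onD)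
  have rl: "lin_map t P u K r"
  proof (rule lin_mapI)
    fix x y assume xy: "x \<in> P" "y \<in> P"
    show "r (x + y) = r x + r y"
    proof (rule injD)
      show "i (r (x + y)) = i (r x + r y)"
        using xy r T.subspace_add[OF sP] lin_map_add[OF i(1)] lin_map_add[OF p(1) xy]
          lin_map_add[OF g(1)] lin_map_in[OF p(1)] by simp
    qed (use xy r T.subspace_add[OF sP] U.subspace_add[OF sK] in auto)
  next
    fix k x assume x: "x \<in> P"
    show "r (t k x) = u k (r x)"
    proof (rule injD)
      show "i (r (t k x)) = i (u k (r x))"
        using x r T.subspace_scale[OF sP] lin_map_scale[OF i(1)] lin_map_scale[OF p(1) x]
          lin_map_scale[OF g(1)] lin_map_in[OF p(1)] by (simp add: T.scale_right_diff_distrib)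
    qed (use x r T.subspace_scale[OF sP] U.subspace_scale[OF sK] in auto)
  qed (use r in auto)
  \<comment> \<open>The truth values index the two summands, which makes \<open>trace_sum\<close>
    applicable.\<close>
  let ?f = "\<lambda>j x. if j then b (i (r x)) else b (g (p x))"
  have fl: "lin_map t P t P (?f j)" for j
    using lin_map_compose[OF lin_map_compose[OF rl i(1)] b]
      lin_map_compose[OF lin_map_compose[OF p(1) g(1)] b] by (cases j) simp_all
  have bx: "b x = (\<Sum>j\<in>UNIV. ?f j x)" if "x \<in> P" for x
  proof -
    have "b (i (r x) + g (p x)) = b (i (r x)) + b (g (p x))"
      by (rule lin_map_add[OF b lin_map_in[OF i(1) r(1)[OF that]] gp[OF that]])
    then show ?thesis using r that by (simp add: UNIV_bool add.commute)
  qed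
  have "trace_on t P b = trace_on t P (\<lambda>x. \<Sum>j\<in>UNIV. ?f j x)"
    by (rule trace_cong[OF P b bx])
  also have "\<dots> = trace_on t P (\<lambda>x. b (i (r x))) + trace_on t P (\<lambda>x. b (g (p x)))"
    by (subst trace_sum[OF P fl]) (simp add: UNIV_bool add.commute)
  also have "trace_on t P (\<lambda>x. b (i (r x))) = trace_on u K (\<lambda>x. r (b (i x)))"
    by (rule trace_commute[OF P K rl lin_map_compose[OF i(1) b]])
  also have "\<dots> = trace_on u K a"
  proof (rule trace_cong[OF K lin_map_compose[OF lin_map_compose[OF i(1) b] rl]])
    fix x assume x: "x \<in> K"
    have ax: "a x \<in> K" by (rule lin_map_in[OF a x])
    have ip: "i y \<in> P" "p (i y) = 0" if "y \<in> K" for y using ex that by blast+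
    have "i (r (b (i x))) = i (a x) - g (p (i (a x)))"
      using r(2)[OF ip(1)[OF ax]] ia[OF x] by simp
    also have "\<dots> = i (a x)"
      using ip[OF ax] lin_map_zero[OF g(1) S.module_axioms fin_dim_subspace[OF V]] by simp
    finally show "r (b (i x)) = a x"
      using r(1)[OF ip(1)[OF ax]] ia[OF x] ax injD by simp
  qed
  also have "trace_on t P (\<lambda>x. b (g (p x))) = trace_on s V (\<lambda>x. p (b (g x)))"
    by (rule trace_commute[OF P V p(1) lin_map_compose[OF g(1) b]])
  also have "\<dots> = trace_on s V c"
    by (rule trace_cong[OF V lin_map_compose[OF lin_map_compose[OF g(1) b] p(1)]])
      (use pb g lin_map_in[OF g(1)] in auto)
  finally show ?thesis .
qed


section \<open>Counting intertwining \<open>G\<close>-maps\<close>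

context finite_group
begin

text \<open>This is \<open>u_h(g)\<close> of the overview, for arbitrary sets \<open>R\<close> and
  \<open>S\<close>.\<close>

definition cnt :: "nat set \<Rightarrow> 'g gmap \<Rightarrow> nat set \<Rightarrow> 'g gmap \<Rightarrow> nat" where
  "cnt R h S g = card {\<phi> \<in> Hom R S. comp R g \<phi> = comp R \<phi> h}"

definition idx :: "nat \<Rightarrow> (nat \<times> 'g gmap) set" where
  "idx e = (SIGMA a:{..e}. Wr a)"

lemma finite_idx: "finite (idx e)"
  by (auto simp: idx_def intro!: finite_Hom)

text \<open>The coefficients may depend on \<open>S\<close> here; making them independent of
  \<open>n\<close> is the subject of the stability argument.\<close>

definition in_cnt_span :: "nat \<Rightarrow> nat set \<Rightarrow> ('g gmap \<Rightarrow> 'k::field_char_0) \<Rightarrow> bool" where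
  "in_cnt_span e S F \<longleftrightarrow>
     (\<exists>q. \<forall>g\<in>Hom S S. F g = (\<Sum>(a, h)\<in>idx e. q (a, h) * of_nat (cnt {1..a} h S g)))"

lemma in_cnt_span_add:
  assumes "in_cnt_span e S F" "in_cnt_span e S F'"
  shows "in_cnt_span e S (\<lambda>g. F g + F' g)"
proof -
  obtain q q' where "\<forall>g\<in>Hom S S. F g = (\<Sum>(a, h)\<in>idx e. q (a, h) * of_nat (cnt {1..a} h S g))"
    "\<forall>g\<in>Hom S S. F' g = (\<Sum>(a, h)\<in>idx e. q' (a, h) * of_nat (cnt {1..a} h S g))"
    using assms by (auto simp: in_cnt_span_def)
  then show ?thesis
    unfolding in_cnt_span_def
    by (intro exI[of _ "\<lambda>p. q p + q' p"]) (simp add: sum.distrib[symmetric] case_prod_beta algebra_simps)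
qed

lemma in_cnt_span_scale:
  assumes "in_cnt_span e S F"
  shows "in_cnt_span e S (\<lambda>g. c * F g)"
proof -
  obtain q where "\<forall>g\<in>Hom S S. F g = (\<Sum>(a, h)\<in>idx e. q (a, h) * of_nat (cnt {1..a} h S g))"
    using assms by (auto simp: in_cnt_span_def)
  then show ?thesis
    unfolding in_cnt_span_def
    by (intro exI[of _ "\<lambda>p. c * q p"]) (simp add: sum_distrib_left case_prod_beta mult.assoc)
qed

lemma in_cnt_span_zero: "in_cnt_span e S (\<lambda>g. 0)"
  unfolding in_cnt_span_def by (intro exI[of _ "\<lambda>p. 0"]) simp

lemma in_cnt_span_sum:
  assumes "\<And>i. i \<in> I \<Longrightarrow> in_cnt_span e S (F i)"
  shows "in_cnt_span e S (\<lambda>g. \<Sum>i\<in>I. F i g)"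
  using assms
  by (induction I rule: infinite_finite_induct) (auto intro: in_cnt_span_add in_cnt_span_zero)

lemma in_cnt_span_cong:
  assumes "in_cnt_span e S F" "\<And>g. g \<in> Hom S S \<Longrightarrow> F' g = F g"
  shows "in_cnt_span e S F'"
  using assms by (auto simp: in_cnt_span_def)

lemma Hom_iso_standard:
  assumes "finite R"
  obtains \<beta> \<gamma> where "\<beta> \<in> Hom {1..card R} R" "\<gamma> \<in> Hom R {1..card R}"
    "comp R \<beta> \<gamma> = gid R" "comp {1..card R} \<gamma> \<beta> = gid {1..card R}"
proof -
  obtain b where b: "bij_betw b {1..card R} R"
    using assms ex_bij_betw_nat_finite_1 by blast
  let ?b' = "inv_into {1..card R} b"
  let ?\<beta> = "(restrict b {1..card R}, \<lambda>i\<in>{1..card R}. \<one>)" and ?\<gamma> = "(restrict ?b' R, \<lambda>i\<in>R. \<one>)"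
  note b' = bij_betw_inv_into[OF b]
  have \<beta>: "?\<beta> \<in> Hom {1..card R} R"
    using bij_betwE[OF b] bij_betw_imp_inj_on[OF b] by (intro HomI) simp_all
  have \<gamma>: "?\<gamma> \<in> Hom R {1..card R}"
    using bij_betwE[OF b'] bij_betw_imp_inj_on[OF b'] by (intro HomI) (simp_all del: atLeastAtMost_iff)
  have "comp R ?\<beta> ?\<gamma> = gid R"
    by (rule Hom_eqI[OF comp_in_Hom[OF \<gamma> \<beta>] gid_in_Hom[OF subset_refl]])
      (use bij_betwE[OF b'] bij_betw_inv_into_right[OF b] in
        \<open>simp_all add: fst_comp snd_comp fst_gid snd_gid del: atLeastAtMost_iff\<close>)
  moreover have "comp {1..card R} ?\<gamma> ?\<beta> = gid {1..card R}"
    by (rule Hom_eqI[OF comp_in_Hom[OF \<beta> \<gamma>] gid_in_Hom[OF subset_refl]])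
      (use bij_betwE[OF b] bij_betw_inv_into_left[OF b] in
        \<open>simp_all add: fst_comp snd_comp fst_gid snd_gid del: atLeastAtMost_iff\<close>)
  ultimately show ?thesis using \<beta> \<gamma> that by blast
qed

text \<open>Transport along a bijection of \<open>R\<close> with \<open>{1..card R}\<close>. The
  conjugate \<open>h'\<close> is obtained before \<open>S\<close> and \<open>g\<close> are
  chosen.\<close>

lemma cnt_standard:
  assumes "finite R" "h \<in> Hom R R"
  obtains h' where "h' \<in> Wr (card R)" "\<And>S g. g \<in> Hom S S \<Longrightarrow> cnt R h S g = cnt {1..card R} h' S g"
proof -
  obtain \<beta> \<gamma> where \<beta>: "\<beta> \<in> Hom {1..card R} R" and \<gamma>: "\<gamma> \<in> Hom R {1..card R}"
    and \<beta>\<gamma>: "comp R \<beta> \<gamma> = gid R" and \<gamma>\<beta>: "comp {1..card R} \<gamma> \<beta> = gid {1..card R}"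
    by (rule Hom_iso_standard[OF assms(1)])
  let ?A = "{1..card R}"
  let ?h = "comp ?A \<gamma> (comp ?A h \<beta>)"
  have h\<beta>: "comp ?A h \<beta> \<in> Hom ?A R" by (rule comp_in_Hom[OF \<beta> assms(2)])
  have h': "?h \<in> Hom ?A ?A" by (rule comp_in_Hom[OF h\<beta> \<gamma>])
  have \<beta>h: "comp ?A \<beta> ?h = comp ?A h \<beta>"
    using comp_assoc[OF h\<beta> \<gamma> \<beta>] \<beta>\<gamma> comp_gid_left[OF h\<beta>] by simp
  have "cnt R h S g = cnt ?A ?h S g" if g: "g \<in> Hom S S" for S g
    unfolding cnt_def
  proof (rule bij_betw_same_card[where f = "\<lambda>\<phi>. comp ?A \<phi> \<beta>"],
      rule bij_betw_byWitness[where f' = "\<lambda>\<psi>. comp R \<psi> \<gamma>"])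
    have r: "comp R (comp ?A \<phi> \<beta>) \<gamma> = \<phi>" if "\<phi> \<in> Hom R S" for \<phi>
      using comp_assoc[OF \<gamma> \<beta> that] \<beta>\<gamma> comp_gid_right[OF that] by simp
    have l: "comp ?A (comp R \<psi> \<gamma>) \<beta> = \<psi>" if "\<psi> \<in> Hom ?A S" for \<psi>
      using comp_assoc[OF \<beta> \<gamma> that] \<gamma>\<beta> comp_gid_right[OF that] by simp
    show "\<forall>\<phi>\<in>{\<phi> \<in> Hom R S. comp R g \<phi> = comp R \<phi> h}. comp R (comp ?A \<phi> \<beta>) \<gamma> = \<phi>"
      using r by blast
    show "\<forall>\<psi>\<in>{\<psi> \<in> Hom ?A S. comp ?A g \<psi> = comp ?A \<psi> ?h}. comp ?A (comp R \<psi> \<gamma>) \<beta> = \<psi>"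
      using l by blast
    have main: "comp ?A g (comp ?A \<phi> \<beta>) = comp ?A (comp ?A \<phi> \<beta>) ?h"
      if "\<phi> \<in> Hom R S" "comp R g \<phi> = comp R \<phi> h" for \<phi>
    proof -
      have "comp ?A g (comp ?A \<phi> \<beta>) = comp ?A (comp R g \<phi>) \<beta>"
        using comp_assoc[OF \<beta> that(1) g] by simp
      also have "\<dots> = comp ?A \<phi> (comp ?A h \<beta>)"
        unfolding that(2) by (rule comp_assoc[OF \<beta> assms(2) that(1)])
      also have "\<dots> = comp ?A (comp ?A \<phi> \<beta>) ?h"
        using comp_assoc[OF h' \<beta> that(1)] \<beta>h by simp
      finally show ?thesis .
    qed
    show "(\<lambda>\<phi>. comp ?A \<phi> \<beta>) ` {\<phi> \<in> Hom R S. comp R g \<phi> = comp R \<phi> h}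
      \<subseteq> {\<psi> \<in> Hom ?A S. comp ?A g \<psi> = comp ?A \<psi> ?h}"
      using main comp_in_Hom[OF \<beta>] by auto
    show "(\<lambda>\<psi>. comp R \<psi> \<gamma>) ` {\<psi> \<in> Hom ?A S. comp ?A g \<psi> = comp ?A \<psi> ?h}
      \<subseteq> {\<phi> \<in> Hom R S. comp R g \<phi> = comp R \<phi> h}"
    proof (rule image_subsetI, elim CollectE conjE, intro CollectI conjI)
      fix \<psi> assume \<psi>: "\<psi> \<in> Hom ?A S" "comp ?A g \<psi> = comp ?A \<psi> ?h"
      show \<phi>: "comp R \<psi> \<gamma> \<in> Hom R S" by (rule comp_in_Hom[OF \<gamma> \<psi>(1)])
      have "comp R g (comp R \<psi> \<gamma>) = comp R (comp ?A \<psi> ?h) \<gamma>"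
        using comp_assoc[OF \<gamma> \<psi>(1) g] \<psi>(2) by simp
      also have "\<dots> = comp R \<psi> (comp R ?h \<gamma>)" by (rule comp_assoc[OF \<gamma> h' \<psi>(1)])
      also have "comp R ?h \<gamma> = comp R \<gamma> (comp R (comp ?A h \<beta>) \<gamma>)" by (rule comp_assoc[OF \<gamma> h\<beta> \<gamma>])
      also have "comp R (comp ?A h \<beta>) \<gamma> = h"
        using comp_assoc[OF \<gamma> \<beta> assms(2)] \<beta>\<gamma> comp_gid_right[OF assms(2)] by simp
      also have "comp R \<psi> (comp R \<gamma> h) = comp R (comp R \<psi> \<gamma>) h"
        by (rule comp_assoc[OF assms(2) \<gamma> \<psi>(1), symmetric])
      finally show "comp R g (comp R \<psi> \<gamma>) = comp R (comp R \<psi> \<gamma>) h" .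
    qed
  qed
  then show ?thesis using h' that by blast
qed

lemma cnt_in_span:
  assumes "finite R" "h \<in> Hom R R" "card R \<le> e"
  shows "in_cnt_span e S (\<lambda>g. of_nat (cnt R h S g) :: 'k::field_char_0)"
proof -
  obtain h' where h': "h' \<in> Wr (card R)" "\<And>S g. g \<in> Hom S S \<Longrightarrow> cnt R h S g = cnt {1..card R} h' S g"
    using cnt_standard[OF assms(1,2)] by blast
  have "(card R, h') \<in> idx e" using h' assms by (auto simp: idx_def)
  then have "(\<Sum>(a, h)\<in>idx e. (if (a, h) = (card R, h') then 1 else 0) * of_nat (cnt {1..a} h S g))
    = (of_nat (cnt {1..card R} h' S g) :: 'k)" for g
    by (subst sum.remove[OF finite_idx, of "(card R, h')"]) (auto intro!: sum.neutral split: if_splits)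
  then show ?thesis
    using h' unfolding in_cnt_span_def by (intro exI[of _ "\<lambda>p. if p = (card R, h') then 1 else 0"]) simp
qed

section \<open>Stabilizers and conjugates extending a partial map\<close>

definition stab :: "nat set \<Rightarrow> nat set \<Rightarrow> 'g gmap set" where
  "stab D S = {v \<in> Hom S S. comp D v (gid D) = gid D}"

lemma finite_stab: "finite S \<Longrightarrow> finite (stab D S)"
  by (simp add: stab_def finite_Hom)

lemma gid_in_stab: "D \<subseteq> S \<Longrightarrow> gid S \<in> stab D S"
  using comp_gid_left[OF gid_in_Hom] by (simp add: stab_def gid_in_Hom)

lemma card_stab_pos: "finite S \<Longrightarrow> D \<subseteq> S \<Longrightarrow> card (stab D S) > 0"
  using gid_in_stab finite_stab by (metis card_gt_0_iff empty_iff)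

text \<open>Translating by one extension of \<open>\<phi>\<close> identifies all its extensions with the stabilizer of \<open>D\<close>.\<close>

lemma card_extensions:
  assumes "finite S" "D \<subseteq> S" "\<phi> \<in> Hom D S"
  shows "card {v \<in> Hom S S. comp D v (gid D) = \<phi>} = card (stab D S)"
proof -
  obtain v0 where v0: "v0 \<in> Hom S S" "comp D v0 (gid D) = \<phi>"
    using Hom_extend[OF assms] by blast
  note gD = gid_in_Hom[OF assms(2)]
  have "bij_betw (comp S v0) (stab D S) {v \<in> Hom S S. comp D v (gid D) = \<phi>}"
  proof (rule bij_betw_byWitness[where f' = "comp S (ginv S v0)"])
    show "\<forall>a\<in>stab D S. comp S (ginv S v0) (comp S v0 a) = a"
      "\<forall>a\<in>{v \<in> Hom S S. comp D v (gid D) = \<phi>}. comp S v0 (comp S (ginv S v0) a) = a"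
      using comp_ginv_cancel[OF assms(1) v0(1)] by (auto simp: stab_def)
    show "comp S v0 ` stab D S \<subseteq> {v \<in> Hom S S. comp D v (gid D) = \<phi>}"
      using v0 comp_in_Hom[OF _ v0(1)] comp_assoc[OF gD _ v0(1)] by (auto simp: stab_def)
    have "comp D (ginv S v0) (comp D v0 (gid D)) = gid D"
      by (rule comp_ginv_cancel(1)[OF assms(1) v0(1) gD])
    then show "comp S (ginv S v0) ` {v \<in> Hom S S. comp D v (gid D) = \<phi>} \<subseteq> stab D S"
      using v0 comp_in_Hom[OF _ ginv(1)[OF assms(1) v0(1)]]
        comp_assoc[OF gD _ ginv(1)[OF assms(1) v0(1)]] by (auto simp: stab_def)
  qed
  then show ?thesis by (simp add: bij_betw_same_card)
qed

text \<open>\<open>nct D \<sigma> S g\<close> counts the \<open>v\<close> for which \<open>v\<inverse> g v\<close> extends the partial map \<open>\<sigma>\<close>.\<close>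

definition nct :: "nat set \<Rightarrow> 'g gmap \<Rightarrow> nat set \<Rightarrow> 'g gmap \<Rightarrow> nat" where
  "nct D \<sigma> S g = card {v \<in> Hom S S. comp D g (comp D v (gid D)) = comp D v \<sigma>}"

text \<open>Whether \<open>v\<close> is counted depends only on its restriction to \<open>D\<close>,
  which must be one of the \<open>\<phi>\<close> counted by \<open>cnt\<close>; each
  \<open>\<phi>\<close> has \<open>card (stab D S)\<close> extensions.\<close>

lemma nct_endo:
  assumes "finite S" "D \<subseteq> S" "\<sigma> \<in> Hom D D" "g \<in> Hom S S"
  shows "nct D \<sigma> S g = card (stab D S) * cnt D \<sigma> S g"
proof -
  note gD = gid_in_Hom[OF assms(2)]
  have finD: "finite D" using assms finite_subset by blast
  let ?\<Phi> = "{\<phi> \<in> Hom D S. comp D g \<phi> = comp D \<phi> \<sigma>}"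
  have *: "comp D v \<sigma> = comp D (comp D v (gid D)) \<sigma>" if "v \<in> Hom S S" for v
    using comp_assoc[OF assms(3) gD that] comp_gid_left[OF assms(3)] by simp
  have "{v \<in> Hom S S. comp D g (comp D v (gid D)) = comp D v \<sigma>} =
      (\<Union>\<phi>\<in>?\<Phi>. {v \<in> Hom S S. comp D v (gid D) = \<phi>})"
    using comp_in_Hom[OF gD] * by auto
  then have "nct D \<sigma> S g = card (\<Union>\<phi>\<in>?\<Phi>. {v \<in> Hom S S. comp D v (gid D) = \<phi>})"
    by (simp add: nct_def)
  also have "\<dots> = (\<Sum>\<phi>\<in>?\<Phi>. card {v \<in> Hom S S. comp D v (gid D) = \<phi>})"
    using finite_Hom[OF finD assms(1)] finite_Hom[OF assms(1,1)] by (intro card_UN_disjoint) auto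
  also have "\<dots> = (\<Sum>\<phi>\<in>?\<Phi>. card (stab D S))"
    using card_extensions[OF assms(1,2)] by (intro sum.cong) auto
  finally show ?thesis by (simp add: cnt_def)
qed

text \<open>Replace \<open>v\<close> by \<open>v \<tau>\<close>: the restriction to \<open>D\<close>
  is unchanged since \<open>\<tau>\<close> fixes \<open>D\<close>, and composing \<open>v\<close>
  with \<open>\<tau> \<sigma>\<close> is composing \<open>v \<tau>\<close> with
  \<open>\<sigma>\<close>.\<close>

lemma nct_translate:
  assumes "finite S" "D \<subseteq> S" "\<sigma> \<in> Hom D S" "\<tau> \<in> stab D S"
  shows "nct D (comp D \<tau> \<sigma>) S g = nct D \<sigma> S g"
  unfolding nct_def
proof (rule bij_betw_same_card, rule bij_betw_byWitness[where f = "\<lambda>v. comp S v \<tau>" and f' = "\<lambda>v. comp S v (ginv S \<tau>)"])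
  note gD = gid_in_Hom[OF assms(2)]
  have \<tau>: "\<tau> \<in> Hom S S" "comp D \<tau> (gid D) = gid D" using assms by (auto simp: stab_def)
  have \<tau>': "ginv S \<tau> \<in> Hom S S" "comp D (ginv S \<tau>) (gid D) = gid D"
    using ginv(1)[OF assms(1) \<tau>(1)] comp_ginv_cancel(1)[OF assms(1) \<tau>(1) gD] \<tau>(2) by auto
  show "\<forall>a\<in>{v \<in> Hom S S. comp D g (comp D v (gid D)) = comp D v (comp D \<tau> \<sigma>)}.
       comp S (comp S a \<tau>) (ginv S \<tau>) = a"
    "\<forall>a\<in>{v \<in> Hom S S. comp D g (comp D v (gid D)) = comp D v \<sigma>}.
       comp S (comp S a (ginv S \<tau>)) \<tau> = a"
    using comp_comp_ginv[OF assms(1) \<tau>(1)] by auto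
  show "(\<lambda>v. comp S v \<tau>) ` {v \<in> Hom S S. comp D g (comp D v (gid D)) = comp D v (comp D \<tau> \<sigma>)}
    \<subseteq> {v \<in> Hom S S. comp D g (comp D v (gid D)) = comp D v \<sigma>}"
    using \<tau> comp_assoc[OF gD \<tau>(1)] comp_assoc[OF assms(3) \<tau>(1)] comp_in_Hom[OF \<tau>(1)] by auto
  show "(\<lambda>v. comp S v (ginv S \<tau>)) ` {v \<in> Hom S S. comp D g (comp D v (gid D)) = comp D v \<sigma>}
    \<subseteq> {v \<in> Hom S S. comp D g (comp D v (gid D)) = comp D v (comp D \<tau> \<sigma>)}"
    using \<tau>' comp_assoc[OF gD \<tau>'(1)] comp_assoc[OF comp_in_Hom[OF assms(3) \<tau>(1)] \<tau>'(1)]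
      comp_in_Hom[OF \<tau>'(1)] comp_ginv_cancel(1)[OF assms(1) \<tau>(1) assms(3)] by auto
qed

text \<open>For each \<open>v\<close> exactly one \<open>\<sigma>\<close> on \<open>D\<close> is
  extended by \<open>v\<inverse> g v\<close>, namely its restriction, so the conditions on
  \<open>D\<close> partition the condition on \<open>D'\<close>.\<close>

lemma nct_split:
  assumes "finite S" "D \<subseteq> S" "D' \<subseteq> D" "\<sigma>' \<in> Hom D' S" "g \<in> Hom S S"
  shows "nct D' \<sigma>' S g = (\<Sum>\<sigma> | \<sigma> \<in> Hom D S \<and> comp D' \<sigma> (gid D') = \<sigma>'. nct D \<sigma> S g)"
proof -
  note gD = gid_in_Hom[OF assms(2)] and gD' = gid_in_Hom[OF assms(3)]
  have finD: "finite D" using assms finite_subset by blast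
  let ?E = "{\<sigma> \<in> Hom D S. comp D' \<sigma> (gid D') = \<sigma>'}"
  have gDD: "comp D' (gid D) (gid D') = gid D'" by (rule comp_gid_left[OF gD'])
  have "{v \<in> Hom S S. comp D' g (comp D' v (gid D')) = comp D' v \<sigma>'} =
      (\<Union>\<sigma>\<in>?E. {v \<in> Hom S S. comp D g (comp D v (gid D)) = comp D v \<sigma>})" (is "?L = ?R")
  proof (intro equalityI subsetI)
    fix v assume v: "v \<in> ?L"
    then have vS: "v \<in> Hom S S" by simp
    let ?x = "comp D g (comp D v (gid D))"
    have x: "?x \<in> Hom D S" by (intro comp_in_Hom[OF _ assms(5)] comp_in_Hom[OF gD vS])
    let ?\<sigma> = "comp D (ginv S v) ?x"
    have "comp D' ?\<sigma> (gid D') = comp D' (ginv S v) (comp D' ?x (gid D'))"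
      by (rule comp_assoc[OF gD' x ginv(1)[OF assms(1) vS]])
    also have "comp D' ?x (gid D') = comp D' g (comp D' v (gid D'))"
      using comp_assoc[OF gD' comp_in_Hom[OF gD vS] assms(5)] comp_assoc[OF gD' gD vS] gDD by simp
    also have "\<dots> = comp D' v \<sigma>'" using v by simp
    also have "comp D' (ginv S v) \<dots> = \<sigma>'" by (rule comp_ginv_cancel(1)[OF assms(1) vS assms(4)])
    finally have sE: "?\<sigma> \<in> ?E" using comp_in_Hom[OF x ginv(1)[OF assms(1) vS]] by simp
    have "v \<in> {v \<in> Hom S S. comp D g (comp D v (gid D)) = comp D v ?\<sigma>}"
      using vS comp_ginv_cancel(2)[OF assms(1) vS x] by simp
    with sE show "v \<in> ?R" by (rule UN_I)
  next
    fix v assume "v \<in> ?R"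
    then obtain \<sigma> where vS: "v \<in> Hom S S" and s: "\<sigma> \<in> Hom D S" "comp D' \<sigma> (gid D') = \<sigma>'"
      "comp D g (comp D v (gid D)) = comp D v \<sigma>" by auto
    have "comp D' g (comp D' v (gid D')) = comp D' (comp D g (comp D v (gid D))) (gid D')"
      using comp_assoc[OF gD' comp_in_Hom[OF gD vS] assms(5)] comp_assoc[OF gD' gD vS] gDD by simp
    also have "\<dots> = comp D' v \<sigma>'"
      unfolding s(3) using comp_assoc[OF gD' s(1) vS] s(2) by simp
    finally show "v \<in> ?L" using vS by simp
  qed
  then have "nct D' \<sigma>' S g = card (\<Union>\<sigma>\<in>?E. {v \<in> Hom S S. comp D g (comp D v (gid D)) = comp D v \<sigma>})"
    by (simp add: nct_def)
  also have "\<dots> = (\<Sum>\<sigma>\<in>?E. card {v \<in> Hom S S. comp D g (comp D v (gid D)) = comp D v \<sigma>})"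
  proof (intro card_UN_disjoint ballI impI)
    show "finite ?E" using finite_Hom[OF finD assms(1)] by simp
    fix \<sigma>1 \<sigma>2 assume "\<sigma>1 \<in> ?E" "\<sigma>2 \<in> ?E" "\<sigma>1 \<noteq> \<sigma>2"
    then show "{v \<in> Hom S S. comp D g (comp D v (gid D)) = comp D v \<sigma>1} \<inter>
      {v \<in> Hom S S. comp D g (comp D v (gid D)) = comp D v \<sigma>2} = {}"
      using comp_left_cancel[of _ S S \<sigma>1 D \<sigma>2] by force
  qed (use finite_Hom[OF assms(1,1)] in auto)
  finally show ?thesis by (simp add: nct_def)
qed

text \<open>The two maps differ only in the arrow at \<open>x0\<close>, whose targets both lie off
  \<open>D\<close>. A labeled transposition exchanging these targets fixes \<open>D\<close> and, by
  injectivity, all other values of \<open>\<sigma>\<close>.\<close>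

lemma move_extension:
  assumes S: "D \<subseteq> S" and \<sigma>: "\<sigma> \<in> Hom D S" and \<sigma>2: "\<sigma>2 \<in> Hom D S" and x0: "x0 \<in> D"
    and eq: "comp (D - {x0}) \<sigma>2 (gid (D - {x0})) = comp (D - {x0}) \<sigma> (gid (D - {x0}))"
    and fresh: "fst \<sigma> x0 \<notin> D" "fst \<sigma>2 x0 \<notin> D"
  shows "\<exists>\<tau>\<in>stab D S. comp D \<tau> \<sigma> = \<sigma>2"
proof -
  have car: "snd \<sigma> i \<in> carrier G" "snd \<sigma>2 i \<in> carrier G" "fst \<sigma> i \<in> S" "fst \<sigma>2 i \<in> S" if "i \<in> D" for i
    using HomD[OF \<sigma>] HomD[OF \<sigma>2] that by auto
  have same: "fst \<sigma>2 i = fst \<sigma> i" "snd \<sigma>2 i = snd \<sigma> i" if "i \<in> D" "i \<noteq> x0" for i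
    using that car eq fst_res[of i "D - {x0}"] snd_res[of i "D - {x0}"] by (metis DiffI singletonD)+
  \<comment> \<open>Solves \<open>snd \<sigma> x0 \<otimes> k = snd \<sigma>2 x0\<close>.\<close>
  let ?k = "inv (snd \<sigma> x0) \<otimes> snd \<sigma>2 x0"
  obtain \<tau> where t: "\<tau> \<in> Hom S S" "comp D \<tau> (gid D) = gid D" "fst \<tau> (fst \<sigma> x0) = fst \<sigma>2 x0"
    "snd \<tau> (fst \<sigma> x0) = ?k"
    "\<And>i. i \<in> S \<Longrightarrow> i \<noteq> fst \<sigma> x0 \<Longrightarrow> i \<noteq> fst \<sigma>2 x0 \<Longrightarrow> fst \<tau> i = i"
    "\<And>i. i \<in> S \<Longrightarrow> i \<noteq> fst \<sigma> x0 \<Longrightarrow> snd \<tau> i = \<one>"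
    by (rule Hom_move[of D S "fst \<sigma> x0" "fst \<sigma>2 x0" ?k]) (use S x0 car fresh in auto)
  have "comp D \<tau> \<sigma> = \<sigma>2"
  proof (rule Hom_eqI[OF comp_in_Hom[OF \<sigma> t(1)] \<sigma>2])
    fix i assume i: "i \<in> D"
    have ne: "fst \<sigma> i \<noteq> fst \<sigma> x0" "fst \<sigma> i \<noteq> fst \<sigma>2 x0" if "i \<noteq> x0"
      using HomD(3)[OF \<sigma>] HomD(3)[OF \<sigma>2] i x0 that same[OF i that] by (metis inj_onD)+
    show "fst (comp D \<tau> \<sigma>) i = fst \<sigma>2 i"
      using i t same ne car by (cases "i = x0") (simp_all add: fst_comp)
    show "snd (comp D \<tau> \<sigma>) i = snd \<sigma>2 i"
    proof (cases "i = x0")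
      case True
      then show ?thesis using i t(4) car by (simp add: snd_comp m_assoc[symmetric])
    next
      case False
      then show ?thesis using i t same ne car by (simp add: snd_comp)
    qed
  qed
  then show ?thesis using t(1,2) by (intro bexI[of _ \<tau>]) (simp_all add: stab_def)
qed

text \<open>Counting the conjugates that extend a partial map reduces to closed partial maps: release an
  arrow \<open>x0 \<mapsto> y0\<close> leaving the domain. Fresh targets all give the same count, any other target
  and the map with the arrow removed involve fewer points.\<close>

lemma nct_in_span:
  assumes S: "finite S" and "D \<subseteq> S" "\<sigma> \<in> Hom D S" "card D \<le> e"
  shows "in_cnt_span e S (\<lambda>g. of_nat (nct D \<sigma> S g) :: 'k::field_char_0)"
  using assms(2-)
proof (induction "card (D \<union> fst \<sigma> ` D)" arbitrary: D \<sigma> rule: less_induct)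
  case less
  note D = \<open>D \<subseteq> S\<close> and \<sigma> = \<open>\<sigma> \<in> Hom D S\<close>
  have finD: "finite D" using D S finite_subset by blast
  show ?case
  proof (cases "fst \<sigma> ` D \<subseteq> D")
    case True
    then have \<sigma>D: "\<sigma> \<in> Hom D D" using Hom_restrict_target[OF \<sigma>] by blast
    show ?thesis
      by (rule in_cnt_span_cong[OF in_cnt_span_scale[OF cnt_in_span[OF finD \<sigma>D less.prems(3)],
              of _ "of_nat (card (stab D S))"]])
        (simp add: nct_endo[OF S D \<sigma>D])
  next
    case False
    then obtain x0 where x0: "x0 \<in> D" "fst \<sigma> x0 \<notin> D" by blast
    define D' where "D' = D - {x0}"
    define \<sigma>' where "\<sigma>' = comp D' \<sigma> (gid D')"
    have D': "D' \<subseteq> D" "D' \<subseteq> S" "card D' \<le> e"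
      using D card_mono[OF finD, of D'] less.prems(3) by (auto simp: D'_def)
    have \<sigma>': "\<sigma>' \<in> Hom D' S" unfolding \<sigma>'_def by (rule comp_in_Hom[OF gid_in_Hom[OF D'(1)] \<sigma>])
    define E where "E = {\<sigma>2 \<in> Hom D S. comp D' \<sigma>2 (gid D') = \<sigma>'}"
    define E1 where "E1 = {\<sigma>2 \<in> E. fst \<sigma>2 x0 \<notin> D}"
    have finE: "finite E" unfolding E_def using finite_Hom[OF finD S] by simp
    have same: "fst \<sigma>2 i = fst \<sigma> i" if "\<sigma>2 \<in> E" "i \<in> D'" for \<sigma>2 i
      using that fst_res[of i D'] unfolding E_def \<sigma>'_def by (metis (mono_tags, lifting) mem_Collect_eq)
    have \<sigma>'i: "fst \<sigma>' i = fst \<sigma> i" if "i \<in> D'" for i unfolding \<sigma>'_def using that by (rule fst_res)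
    have ne: "fst \<sigma> i \<noteq> fst \<sigma> x0" if "i \<in> D'" for i
      using HomD(3)[OF \<sigma>] x0(1) that by (auto simp: D'_def inj_on_def)
    have smaller: "card X < card (D \<union> fst \<sigma> ` D)" if "X \<subseteq> D \<union> fst \<sigma> ` D - {fst \<sigma> x0}" for X
      using that x0(1) finD by (intro psubset_card_mono) auto
    have "card (D' \<union> fst \<sigma>' ` D') < card (D \<union> fst \<sigma> ` D)"
    proof (rule smaller)
      show "D' \<union> fst \<sigma>' ` D' \<subseteq> D \<union> fst \<sigma> ` D - {fst \<sigma> x0}"
        using \<sigma>'i ne D'(1) x0 by auto
    qed
    then have 1: "in_cnt_span e S (\<lambda>g. of_nat (nct D' \<sigma>' S g) :: 'k)"
      using less.hyps D' \<sigma>' by blast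
    have 2: "in_cnt_span e S (\<lambda>g. of_nat (nct D \<sigma>2 S g) :: 'k)" if "\<sigma>2 \<in> E - E1" for \<sigma>2
    proof (rule less.hyps[OF smaller D _ less.prems(3)])
      have im: "fst \<sigma>2 x0 \<in> D" using that by (auto simp: E1_def)
      have "fst \<sigma>2 i \<in> D \<union> fst \<sigma> ` D - {fst \<sigma> x0}" if "i \<in> D" for i
      proof (cases "i = x0")
        case True
        then show ?thesis using im x0 by auto
      next
        case False
        then have "i \<in> D'" using \<open>i \<in> D\<close> by (simp add: D'_def)
        then show ?thesis using same ne \<open>\<sigma>2 \<in> E - E1\<close> \<open>i \<in> D\<close> by auto
      qed
      then show "D \<union> fst \<sigma>2 ` D \<subseteq> D \<union> fst \<sigma> ` D - {fst \<sigma> x0}" using x0 by auto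
    qed (use that in \<open>auto simp: E_def\<close>)
    have 3: "nct D \<sigma>2 S g = nct D \<sigma> S g" if "\<sigma>2 \<in> E1" for \<sigma>2 g
      using move_extension[OF D \<sigma> _ x0(1) _ x0(2), of \<sigma>2] nct_translate[OF S D \<sigma>] that
      unfolding E1_def E_def \<sigma>'_def D'_def by (smt (verit) mem_Collect_eq)
    have "\<sigma> \<in> E1" using \<sigma> x0 by (auto simp: E1_def E_def \<sigma>'_def)
    then have cE1: "card E1 \<noteq> 0"
      using finite_subset[OF _ finE, of E1] card_0_eq[of E1] unfolding E1_def by blast
    \<comment> \<open>\<open>nct_split\<close> for the released arrow, solved for the common count
      of the \<open>card E1\<close> extensions with a fresh target.\<close>
    have main: "of_nat (nct D \<sigma> S g) = inverse (of_nat (card E1)) *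
        (of_nat (nct D' \<sigma>' S g) + (- 1) * (\<Sum>\<sigma>2\<in>E - E1. of_nat (nct D \<sigma>2 S g)) :: 'k)"
      if "g \<in> Hom S S" for g
    proof -
      have "nct D' \<sigma>' S g = (\<Sum>\<sigma>2\<in>E. nct D \<sigma>2 S g)"
        unfolding E_def by (rule nct_split[OF S D D'(1) \<sigma>' that])
      also have "\<dots> = (\<Sum>\<sigma>2\<in>E - E1. nct D \<sigma>2 S g) + (\<Sum>\<sigma>2\<in>E1. nct D \<sigma>2 S g)"
        by (rule sum.subset_diff) (use finE in \<open>auto simp: E1_def\<close>)
      also have "(\<Sum>\<sigma>2\<in>E1. nct D \<sigma>2 S g) = card E1 * nct D \<sigma> S g"
        using 3 by simp
      finally have "(of_nat (nct D' \<sigma>' S g) :: 'k) =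
          (\<Sum>\<sigma>2\<in>E - E1. of_nat (nct D \<sigma>2 S g)) + of_nat (card E1) * of_nat (nct D \<sigma> S g)"
        by simp
      then show ?thesis using cE1 by simp
    qed
    show ?thesis
      by (rule in_cnt_span_cong[OF in_cnt_span_scale[OF in_cnt_span_add[OF 1 in_cnt_span_scale[OF in_cnt_span_sum[OF 2]]]] main])
  qed
qed

end


section \<open>Polynomial functions\<close>

definition mon_eval :: "('x \<Rightarrow> 'k::comm_semiring_1) \<Rightarrow> ('x \<Rightarrow>\<^sub>0 nat) \<Rightarrow> 'k" where
  "mon_eval v m = (\<Prod>x\<in>Poly_Mapping.keys m. v x ^ Poly_Mapping.lookup m x)"

definition mon_deg :: "('x \<Rightarrow> nat) \<Rightarrow> ('x \<Rightarrow>\<^sub>0 nat) \<Rightarrow> nat" where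
  "mon_deg wt m = (\<Sum>x\<in>Poly_Mapping.keys m. wt x * Poly_Mapping.lookup m x)"

lemma mon_eval_superset:
  assumes "finite A" "Poly_Mapping.keys m \<subseteq> A"
  shows "mon_eval v m = (\<Prod>x\<in>A. v x ^ Poly_Mapping.lookup m x)"
  unfolding mon_eval_def using assms
  by (intro prod.mono_neutral_left) (auto simp: in_keys_iff)

lemma mon_deg_superset:
  assumes "finite A" "Poly_Mapping.keys m \<subseteq> A"
  shows "mon_deg wt m = (\<Sum>x\<in>A. wt x * Poly_Mapping.lookup m x)"
  unfolding mon_deg_def using assms
  by (intro sum.mono_neutral_left) (auto simp: in_keys_iff)

lemma mon_eval_add: "mon_eval v (m + m') = mon_eval v m * mon_eval v m'"
proof -
  let ?A = "Poly_Mapping.keys m \<union> Poly_Mapping.keys m'"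
  have "Poly_Mapping.keys (m + m') \<subseteq> ?A" by (rule Poly_Mapping.keys_add)
  then show ?thesis
    by (simp add: mon_eval_superset[of ?A] lookup_add power_add prod.distrib)
qed

lemma mon_eval_var: "mon_eval v (Poly_Mapping.single x (Suc 0)) = v x"
  by (simp add: mon_eval_superset[of "{x}"])

lemma mon_deg_var: "mon_deg wt (Poly_Mapping.single x (Suc 0)) = wt x"
  by (simp add: mon_deg_superset[of "{x}"])

lemma mon_deg_add: "mon_deg wt (m + m') = mon_deg wt m + mon_deg wt m'"
proof -
  let ?A = "Poly_Mapping.keys m \<union> Poly_Mapping.keys m'"
  have "Poly_Mapping.keys (m + m') \<subseteq> ?A" by (rule Poly_Mapping.keys_add)
  then show ?thesis
    by (simp add: mon_deg_superset[of ?A] lookup_add distrib_left sum.distrib)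
qed

lemma mpoly_eval_superset:
  assumes "finite A" "Poly_Mapping.keys P \<subseteq> A"
  shows "mpoly_eval v P = (\<Sum>m\<in>A. Poly_Mapping.lookup P m * mon_eval v m)"
  unfolding mpoly_eval_def mon_eval_def using assms
  by (intro sum.mono_neutral_left) (auto simp: in_keys_iff)

lemma mpoly_eval_add: "mpoly_eval v (P + Q) = mpoly_eval v P + mpoly_eval v Q"
proof -
  let ?A = "Poly_Mapping.keys P \<union> Poly_Mapping.keys Q"
  have "Poly_Mapping.keys (P + Q) \<subseteq> ?A" by (rule Poly_Mapping.keys_add)
  then show ?thesis
    by (simp add: mpoly_eval_superset[of ?A] lookup_add distrib_right sum.distrib)
qed

lemma mpoly_eval_single: "mpoly_eval v (Poly_Mapping.single m c) = c * mon_eval v m"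
  by (simp add: mpoly_eval_superset[of "{m}"])

text \<open>Closure properties are proved for the represented functions, so only sums, scalar
  multiples and multiplication by a variable have to be realized by polynomials.\<close>

definition polyfun :: "'x set \<Rightarrow> ('x \<Rightarrow> nat) \<Rightarrow> nat \<Rightarrow> (('x \<Rightarrow> 'k::comm_ring_1) \<Rightarrow> 'k) \<Rightarrow> bool" where
  "polyfun X wt d F \<longleftrightarrow>
     (\<exists>P. mpoly_over X P \<and> mpoly_degree_le wt P d \<and> (\<forall>v. F v = mpoly_eval v P))"

lemma polyfun_monomial:
  assumes "Poly_Mapping.keys m \<subseteq> X" "mon_deg wt m \<le> d"
  shows "polyfun X wt d (\<lambda>v. c * mon_eval v m)"
  using assms unfolding polyfun_def
  by (intro exI[of _ "Poly_Mapping.single m c"])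
    (auto simp: mpoly_over_def mpoly_degree_le_def mpoly_eval_single mon_deg_def split: if_splits)

lemma polyfun_add:
  assumes "polyfun X wt d F" "polyfun X wt d F'"
  shows "polyfun X wt d (\<lambda>v. F v + F' v)"
proof -
  obtain P Q where P: "mpoly_over X P" "mpoly_degree_le wt P d" "\<And>v. F v = mpoly_eval v P"
    and Q: "mpoly_over X Q" "mpoly_degree_le wt Q d" "\<And>v. F' v = mpoly_eval v Q"
    using assms by (auto simp: polyfun_def)
  show ?thesis
    unfolding polyfun_def
  proof (intro exI[of _ "P + Q"] conjI allI)
    show "mpoly_over X (P + Q)" "mpoly_degree_le wt (P + Q) d"
      using P Q Poly_Mapping.keys_add[of P Q] unfolding mpoly_over_def mpoly_degree_le_def by blast+
  qed (simp add: P Q mpoly_eval_add)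
qed

lemma polyfun_zero: "polyfun X wt d (\<lambda>v. 0)"
  unfolding polyfun_def
  by (intro exI[of _ 0]) (auto simp: mpoly_over_def mpoly_degree_le_def mpoly_eval_def)

lemma polyfun_sum:
  assumes "\<And>i. i \<in> I \<Longrightarrow> polyfun X wt d (F i)"
  shows "polyfun X wt d (\<lambda>v. \<Sum>i\<in>I. F i v)"
  using assms
  by (induction I rule: infinite_finite_induct) (auto intro: polyfun_add polyfun_zero)

lemma polyfun_expand:
  assumes "polyfun X wt d F"
  obtains P where "\<And>m. m \<in> Poly_Mapping.keys P \<Longrightarrow> Poly_Mapping.keys m \<subseteq> X \<and> mon_deg wt m \<le> d"
    "\<And>v. F v = (\<Sum>m\<in>Poly_Mapping.keys P. Poly_Mapping.lookup P m * mon_eval v m)"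
proof -
  obtain P where P: "mpoly_over X P" "mpoly_degree_le wt P d" "\<And>v. F v = mpoly_eval v P"
    using assms by (auto simp: polyfun_def)
  then show ?thesis
    by (intro that[of P]) (auto simp: mpoly_over_def mpoly_degree_le_def mon_deg_def mpoly_eval_def mon_eval_def)
qed

lemma polyfun_mono:
  assumes "polyfun X wt d F" "d \<le> d'"
  shows "polyfun X wt d' F"
  using assms unfolding polyfun_def mpoly_degree_le_def by (meson order_trans)

lemma polyfun_scale:
  assumes "polyfun X wt d F"
  shows "polyfun X wt d (\<lambda>v. c * F v)"
proof -
  obtain P where P: "\<And>m. m \<in> Poly_Mapping.keys P \<Longrightarrow> Poly_Mapping.keys m \<subseteq> X \<and> mon_deg wt m \<le> d"
    "\<And>v. F v = (\<Sum>m\<in>Poly_Mapping.keys P. Poly_Mapping.lookup P m * mon_eval v m)"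
    using polyfun_expand[OF assms] by blast
  show ?thesis
    unfolding P(2) sum_distrib_left mult.assoc[symmetric]
    by (intro polyfun_sum polyfun_monomial) (use P(1) in auto)
qed

lemma polyfun_const: "polyfun X wt d (\<lambda>v. c)"
  using polyfun_monomial[of 0 X wt d c] by (simp add: mon_deg_def mon_eval_def)

text \<open>Multiplying every monomial by \<open>x\<close> shifts all degrees by
  \<open>wt x\<close>. Removing a cycle introduces exactly such a factor.\<close>

lemma polyfun_mult_var:
  assumes "polyfun X wt d F" "x \<in> X"
  shows "polyfun X wt (wt x + d) (\<lambda>v. v x * F v)"
proof -
  obtain P where P: "\<And>m. m \<in> Poly_Mapping.keys P \<Longrightarrow> Poly_Mapping.keys m \<subseteq> X \<and> mon_deg wt m \<le> d"
    "\<And>v. F v = (\<Sum>m\<in>Poly_Mapping.keys P. Poly_Mapping.lookup P m * mon_eval v m)"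
    using polyfun_expand[OF assms(1)] by blast
  let ?x = "Poly_Mapping.single x (1::nat)"
  have e: "v x * F v = (\<Sum>m\<in>Poly_Mapping.keys P. Poly_Mapping.lookup P m * mon_eval v (?x + m))" for v
    unfolding P(2) mon_eval_add sum_distrib_left
    by (intro sum.cong) (simp_all add: mon_eval_var mult.left_commute)
  have "polyfun X wt (wt x + d) (\<lambda>v. Poly_Mapping.lookup P m * mon_eval v (?x + m))"
    if "m \<in> Poly_Mapping.keys P" for m
  proof (rule polyfun_monomial)
    show "Poly_Mapping.keys (?x + m) \<subseteq> X"
      using Poly_Mapping.keys_add[of ?x m] P(1)[OF that] assms(2) by auto
    show "mon_deg wt (?x + m) \<le> wt x + d"
      using P(1)[OF that] by (simp add: mon_deg_add mon_deg_var)
  qed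
  then show ?thesis unfolding e by (rule polyfun_sum)
qed


section \<open>Labeled cycles\<close>

context finite_group
begin

abbreviation orb :: "'g gmap \<Rightarrow> nat \<Rightarrow> nat set" where "orb w \<equiv> orbit (fst w)"
abbreviation pw :: "'g gmap \<Rightarrow> nat \<Rightarrow> nat \<Rightarrow> nat" where "pw w j \<equiv> fst w ^^ j"
abbreviation cp :: "'g gmap \<Rightarrow> nat \<Rightarrow> nat \<Rightarrow> 'g" where "cp \<equiv> cycle_product G"

lemma pw_in: "w \<in> Hom S S \<Longrightarrow> c \<in> S \<Longrightarrow> pw w j c \<in> S"
  by (induction j) (auto simp: HomD)

text \<open>\<open>orbit\<close> starts at \<open>fst w c\<close>, so membership of \<open>c\<close>
  itself requires a period. The powers repeat on the finite set \<open>S\<close>, and injectivity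
  cancels the common part.\<close>

lemma orb_self:
  assumes "finite S" "w \<in> Hom S S" "c \<in> S"
  shows "c \<in> orb w c"
proof -
  have "\<not> inj_on (\<lambda>j. pw w j c) UNIV"
    using finite_subset[of "range (\<lambda>j. pw w j c)" S] pw_in[OF assms(2,3)] assms(1)
    by (meson finite_imageD image_subsetI infinite_UNIV_nat)
  then obtain a b where "pw w a c = pw w b c" "a \<noteq> b" by (auto simp: inj_on_def)
  then obtain a b where ab: "pw w a c = pw w b c" "a < b" by (metis linorder_neqE_nat)
  have "\<exists>d>0. pw w d c = c"
    using ab
  proof (induction a arbitrary: b)
    case 0
    then show ?case by auto
  next
    case (Suc a)
    then obtain b' where b: "b = Suc b'" "a < b'" using less_imp_Suc_add by (metis Suc_lessE)
    have "fst w (pw w a c) = fst w (pw w b' c)" using Suc.prems b by simp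
    then have "pw w a c = pw w b' c"
      using HomD(3)[OF assms(2)] pw_in[OF assms(2,3)] by (meson inj_onD)
    then show ?case using Suc.IH b by blast
  qed
  then show ?thesis unfolding orbit_altdef by force
qed

lemma orb_facts:
  assumes "finite S" "w \<in> Hom S S" "c \<in> S"
  shows "orb w c \<subseteq> S" "finite (orb w c)" "card (orb w c) > 0" "pw w (card (orb w c)) c = c"
    "orb w c = (\<lambda>j. pw w j c) ` {..<card (orb w c)}" "inj_on (\<lambda>j. pw w j c) {..<card (orb w c)}"
proof -
  note self = orb_self[OF assms]
  let ?d = "funpow_dist1 (fst w) c c"
  have o: "orb w c = (\<lambda>j. pw w j c) ` {..<?d}" and inj: "inj_on (\<lambda>j. pw w j c) {..<?d}"
    using orbit_conv_funpow_dist1[OF self] inj_on_funpow_dist1[OF self] by (simp_all add: atLeast0LessThan)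
  have card: "card (orb w c) = ?d" using card_image[OF inj] o by simp
  show "orb w c \<subseteq> S" using o pw_in[OF assms(2,3)] by auto
  then show "finite (orb w c)" using assms(1) finite_subset by blast
  show "card (orb w c) > 0" unfolding card by simp
  show "pw w (card (orb w c)) c = c" unfolding card by (rule funpow_dist1_prop[OF self])
  show "orb w c = (\<lambda>j. pw w j c) ` {..<card (orb w c)}" unfolding card by (rule o)
  show "inj_on (\<lambda>j. pw w j c) {..<card (orb w c)}" unfolding card by (rule inj)
qed

lemma orb_eq:
  assumes "finite S" "w \<in> Hom S S" "c \<in> S" "y \<in> orb w c"
  shows "orb w y = orb w c"
proof (intro equalityI subsetI)
  note self = orb_self[OF assms(1-3)]
  fix z
  show "z \<in> orb w y \<Longrightarrow> z \<in> orb w c" using orbit_trans assms(4) by metis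
  show "z \<in> orb w c \<Longrightarrow> z \<in> orb w y" using orbit_trans orbit_swap[OF self assms(4)] by metis
qed

section \<open>Cycle products and their conjugacy classes\<close>

lemma cp_0: "cp w 0 c = \<one>"
  by (simp add: cycle_product_def)

lemma cp_closed:
  assumes "w \<in> Hom S S" "c \<in> S"
  shows "cp w j c \<in> carrier G"
proof -
  have "foldr (\<lambda>j z. snd w (pw w j c) \<otimes> z) xs \<one> \<in> carrier G" for xs
    by (induction xs) (auto simp: HomD(2)[OF assms(1)] pw_in[OF assms])
  then show ?thesis by (simp add: cycle_product_def)
qed

lemma cp_Suc:
  assumes "w \<in> Hom S S" "c \<in> S"
  shows "cp w (Suc j) c = cp w j c \<otimes> snd w (pw w j c)"
proof -
  let ?f = "\<lambda>j z. snd w (pw w j c) \<otimes> z"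
  have car: "snd w (pw w j c) \<in> carrier G" for j
    by (rule HomD(2)[OF assms(1) pw_in[OF assms]])
  have "foldr ?f xs z = foldr ?f xs \<one> \<otimes> z \<and> foldr ?f xs \<one> \<in> carrier G" if "z \<in> carrier G" for xs z
    by (induction xs) (auto simp: car that m_assoc)
  from this[of "snd w (pw w j c)" "[0..<j]"] show ?thesis using car by (simp add: cycle_product_def)
qed

text \<open>Peels off the first factor where \<open>cp_Suc\<close> peels off the last. At a full
  period the two together say that moving the start point conjugates the cycle product.\<close>

lemma cp_step:
  assumes "w \<in> Hom S S" "c \<in> S"
  shows "cp w (Suc j) c = snd w c \<otimes> cp w j (fst w c)"
proof (induction j)
  case 0
  then show ?case using cp_Suc[OF assms, of 0] HomD(2)[OF assms] by (simp add: cp_0)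
next
  case (Suc j)
  have wc: "fst w c \<in> S" by (rule HomD(1)[OF assms])
  have "cp w (Suc (Suc j)) c = (snd w c \<otimes> cp w j (fst w c)) \<otimes> snd w (pw w (Suc j) c)"
    using cp_Suc[OF assms, of "Suc j"] Suc by simp
  also have "\<dots> = snd w c \<otimes> (cp w j (fst w c) \<otimes> snd w (pw w j (fst w c)))"
    using HomD(2)[OF assms] cp_closed[OF assms(1) wc] HomD(2)[OF assms(1) pw_in[OF assms(1) wc]]
    by (simp add: m_assoc funpow_swap1)
  also have "\<dots> = snd w c \<otimes> cp w (Suc j) (fst w c)"
    using cp_Suc[OF assms(1) wc] by simp
  finally show ?case .
qed

lemma conj_class_closed:
  assumes "C \<in> conjugacy_classes G" "z \<in> C" "y \<in> carrier G"
  shows "z \<in> carrier G" "y \<otimes> z \<otimes> inv y \<in> C"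
proof -
  obtain x u where x: "x \<in> carrier G" "C = (\<lambda>y. y \<otimes> x \<otimes> inv y) ` carrier G" "u \<in> carrier G" "z = u \<otimes> x \<otimes> inv u"
    using assms by (auto simp: conjugacy_classes_def)
  show "z \<in> carrier G" using x by simp
  have "y \<otimes> z \<otimes> inv y = (y \<otimes> u) \<otimes> x \<otimes> inv (y \<otimes> u)"
    using x assms(3) by (simp add: inv_mult_group m_assoc)
  then show "y \<otimes> z \<otimes> inv y \<in> C" using x assms(3) by blast
qed

text \<open>Stated with \<open>z \<otimes> a = b \<otimes> z\<close> because intertwining relations
  deliver conjugacy in this form.\<close>

lemma conj_class_intertwine:
  assumes "C \<in> conjugacy_classes G" "a \<in> carrier G" "b \<in> carrier G" "z \<in> carrier G" "z \<otimes> a = b \<otimes> z"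
  shows "a \<in> C \<longleftrightarrow> b \<in> C"
proof -
  have b: "b = z \<otimes> a \<otimes> inv z"
    using assms by (simp add: m_assoc)
  have a: "a = inv z \<otimes> b \<otimes> inv (inv z)"
    using assms(2-4) unfolding b by (simp add: m_assoc) (simp add: m_assoc[symmetric])
  show ?thesis
    using conj_class_closed(2)[OF assms(1) _ assms(4), of a, folded b]
      conj_class_closed(2)[OF assms(1) _ inv_closed[OF assms(4)], of b, folded a] by blast
qed

text \<open>Points rather than cycles are collected, since extending an intertwiner over a cycle
  begins with choosing the image of one point.\<close>

definition cyc_pts :: "nat set \<Rightarrow> 'g gmap \<Rightarrow> nat \<Rightarrow> 'g set \<Rightarrow> nat set" where
  "cyc_pts S w i C = {y \<in> S. card (orb w y) = i \<and> cp w i y \<in> C}"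

lemma cyc_pts_orb:
  assumes "finite S" "w \<in> Hom S S" "C \<in> conjugacy_classes G" "c \<in> cyc_pts S w i C" "y \<in> orb w c"
  shows "y \<in> cyc_pts S w i C"
proof -
  have step: "fst w y \<in> cyc_pts S w i C" if "y \<in> cyc_pts S w i C" for y
  proof -
    have y: "y \<in> S" "card (orb w y) = i" "cp w i y \<in> C" using that by (auto simp: cyc_pts_def)
    have wy: "fst w y \<in> S" by (rule HomD(1)[OF assms(2) y(1)])
    have "pw w i y = y" using orb_facts(4)[OF assms(1,2) y(1)] y(2) by simp
    then have "snd w y \<otimes> cp w i (fst w y) = cp w i y \<otimes> snd w y"
      using cp_step[OF assms(2) y(1), of i] cp_Suc[OF assms(2) y(1), of i] by simp
    then have "cp w i (fst w y) \<in> C"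
      using conj_class_intertwine[OF assms(3) cp_closed[OF assms(2) wy] cp_closed[OF assms(2) y(1)] HomD(2)[OF assms(2) y(1)]] y
      by metis
    moreover have "orb w (fst w y) = orb w y"
      by (rule orb_eq[OF assms(1,2) y(1) orbit.base])
    ultimately show ?thesis using wy y by (simp add: cyc_pts_def)
  qed
  from assms(5) show ?thesis by induction (auto intro: step assms(4))
qed

text \<open>The \<open>C\<close>-labeled \<open>i\<close>-cycles are disjoint and have
  \<open>i\<close> points each, and by \<open>cyc_pts_orb\<close> the label does not depend on the
  start point.\<close>

lemma card_cyc_pts:
  assumes "C \<in> conjugacy_classes G" "w \<in> Wr n"
  shows "card (cyc_pts {1..n} w i C) = i * labeled_cycles G n i C w"
proof -
  let ?S = "{1..n}"
  let ?Z = "{Z. card Z = i \<and> (\<exists>c\<in>?S. Z = orb w c \<and> cp w i c \<in> C)}"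
  have fin: "finite ?S" by simp
  have finZ: "finite ?Z" by (rule finite_subset[of _ "orb w ` ?S"]) auto
  have "cyc_pts ?S w i C = \<Union> ?Z"
  proof (intro equalityI subsetI)
    fix y assume "y \<in> cyc_pts ?S w i C"
    then have "y \<in> ?S" "orb w y \<in> ?Z" by (auto simp: cyc_pts_def)
    then show "y \<in> \<Union> ?Z"
      using orb_self[OF fin assms(2)] by blast
  next
    fix y assume "y \<in> \<Union> ?Z"
    then obtain c where c: "c \<in> ?S" "card (orb w c) = i" "y \<in> orb w c" "cp w i c \<in> C" by auto
    then have "c \<in> cyc_pts ?S w i C" by (simp add: cyc_pts_def)
    then show "y \<in> cyc_pts ?S w i C" by (rule cyc_pts_orb[OF fin assms(2,1) _ c(3)])
  qed
  also have "card (\<Union> ?Z) = sum card ?Z"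
  proof (rule card_Union_disjoint)
    show "pairwise disjnt ?Z"
    proof (rule pairwiseI)
      fix Z Z' assume Z: "Z \<in> ?Z" "Z' \<in> ?Z" "Z \<noteq> Z'"
      then obtain c c' where c: "c \<in> ?S" "Z = orb w c" "c' \<in> ?S" "Z' = orb w c'" by blast
      show "disjnt Z Z'"
      proof (rule ccontr)
        assume "\<not> disjnt Z Z'"
        then obtain y where "y \<in> orb w c" "y \<in> orb w c'" using c by (auto simp: disjnt_def)
        then show False
          using orb_eq[OF fin assms(2) c(1)] orb_eq[OF fin assms(2) c(3)] c Z by metis
      qed
    qed
    show "finite Z" if "Z \<in> ?Z" for Z using that orb_facts(2)[OF fin assms(2)] by auto
  qed
  also have "sum card ?Z = i * labeled_cycles G n i C w"
    by (simp add: labeled_cycles_def)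
  finally show ?thesis .
qed

lemma comp_eq_iff:
  assumes "\<phi> \<in> Hom R S" "h \<in> Hom R R" "g \<in> Hom S S"
  shows "comp R g \<phi> = comp R \<phi> h \<longleftrightarrow>
    (\<forall>x\<in>R. fst g (fst \<phi> x) = fst \<phi> (fst h x) \<and> snd \<phi> x \<otimes> snd g (fst \<phi> x) = snd h x \<otimes> snd \<phi> (fst h x))"
    (is "?L \<longleftrightarrow> ?R")
proof
  assume ?L
  then show ?R using fst_comp[of _ R] snd_comp[of _ R] by metis
next
  assume ?R
  then show ?L
    by (intro Hom_eqI[OF comp_in_Hom[OF assms(1,3)] comp_in_Hom[OF assms(2,1)]])
      (auto simp: fst_comp snd_comp)
qed

text \<open>Iterates the intertwining relation along the cycle: both components of
  \<open>\<phi>\<close> at \<open>c\<close> determine it on the whole orbit. At a full period the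
  second relation makes the two cycle products conjugate.\<close>

lemma intertwine_pow:
  assumes "\<phi> \<in> Hom R S" "h \<in> Hom R R" "g \<in> Hom S S" "comp R g \<phi> = comp R \<phi> h" "c \<in> R"
  shows "fst \<phi> (pw h j c) = pw g j (fst \<phi> c)"
    "cp h j c \<otimes> snd \<phi> (pw h j c) = snd \<phi> c \<otimes> cp g j (fst \<phi> c)"
proof -
  note eq = assms(4)[unfolded comp_eq_iff[OF assms(1-3)]]
  note hR = pw_in[OF assms(2,5)]
  have \<phi>c: "fst \<phi> c \<in> S" "snd \<phi> c \<in> carrier G" using HomD[OF assms(1)] assms(5) by auto
  have 1: "fst \<phi> (pw h j c) = pw g j (fst \<phi> c)" for j
  proof (induction j)
    case (Suc j)
    have "fst \<phi> (fst h (pw h j c)) = fst g (fst \<phi> (pw h j c))" using eq hR[of j] by metis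
    then show ?case by (simp add: Suc)
  qed simp
  then show "fst \<phi> (pw h j c) = pw g j (fst \<phi> c)" .
  show "cp h j c \<otimes> snd \<phi> (pw h j c) = snd \<phi> c \<otimes> cp g j (fst \<phi> c)"
  proof (induction j)
    case 0
    then show ?case using \<phi>c by (simp add: cp_0)
  next
    case (Suc j)
    let ?x = "pw h j c"
    have x: "?x \<in> R" by (rule hR)
    have car: "snd h ?x \<in> carrier G" "snd \<phi> (fst h ?x) \<in> carrier G" "snd \<phi> ?x \<in> carrier G"
      "snd g (fst \<phi> ?x) \<in> carrier G" "cp h j c \<in> carrier G" "cp g j (fst \<phi> c) \<in> carrier G"
      using HomD(1,2)[OF assms(2) x] HomD[OF assms(1)] HomD[OF assms(3)] x
        cp_closed[OF assms(2,5)] cp_closed[OF assms(3) \<phi>c(1)] by auto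
    have "cp h (Suc j) c \<otimes> snd \<phi> (pw h (Suc j) c) = cp h j c \<otimes> (snd h ?x \<otimes> snd \<phi> (fst h ?x))"
      using cp_Suc[OF assms(2,5)] car by (simp add: m_assoc)
    also have "\<dots> = (cp h j c \<otimes> snd \<phi> ?x) \<otimes> snd g (fst \<phi> ?x)"
      using eq x car by (simp add: m_assoc)
    also have "\<dots> = snd \<phi> c \<otimes> (cp g j (fst \<phi> c) \<otimes> snd g (fst \<phi> ?x))"
      using Suc car \<phi>c by (simp add: m_assoc)
    also have "\<dots> = snd \<phi> c \<otimes> cp g (Suc j) (fst \<phi> c)"
      using cp_Suc[OF assms(3) \<phi>c(1)] 1 by simp
    finally show ?case .
  qed
qed

lemma intertwine_orb:
  assumes "\<phi> \<in> Hom R S" "h \<in> Hom R R" "g \<in> Hom S S" "comp R g \<phi> = comp R \<phi> h" "c \<in> R" "finite R"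
  shows "orb g (fst \<phi> c) = fst \<phi> ` orb h c" "card (orb g (fst \<phi> c)) = card (orb h c)"
proof -
  note eq = assms(4)[unfolded comp_eq_iff[OF assms(1-3)]]
  show 1: "orb g (fst \<phi> c) = fst \<phi> ` orb h c"
    by (rule orbit_inverse[symmetric, OF orb_self[OF assms(6,2,5)]])
      (use eq orb_facts(1)[OF assms(6,2,5)] in auto)
  show "card (orb g (fst \<phi> c)) = card (orb h c)"
    unfolding 1 using HomD(3)[OF assms(1)] orb_facts(1)[OF assms(6,2,5)]
    by (intro card_image) (rule inj_on_subset)
qed

text \<open>Intertwiners map cycles bijectively onto cycles and conjugate their products, so they
  preserve length and label.\<close>

lemma intertwine_cyc_pts:
  assumes "\<phi> \<in> Hom R S" "h \<in> Hom R R" "g \<in> Hom S S" "comp R g \<phi> = comp R \<phi> h" "finite R"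
    and C: "C \<in> conjugacy_classes G"
  shows "cyc_pts S g i C \<inter> fst \<phi> ` R = fst \<phi> ` cyc_pts R h i C"
proof -
  have "fst \<phi> x \<in> cyc_pts S g i C \<longleftrightarrow> x \<in> cyc_pts R h i C" if x: "x \<in> R" for x
  proof -
    have "cp g i (fst \<phi> x) \<in> C \<longleftrightarrow> cp h i x \<in> C" if "card (orb h x) = i"
    proof (rule conj_class_intertwine[OF C])
      have "pw h i x = x" using orb_facts(4)[OF assms(5,2) x] that by simp
      then show "snd \<phi> x \<otimes> cp g i (fst \<phi> x) = cp h i x \<otimes> snd \<phi> x"
        using intertwine_pow(2)[OF assms(1-4) x, of i] by simp
    qed (use x HomD[OF assms(1)] cp_closed[OF assms(2)] cp_closed[OF assms(3)] in auto)
    then show ?thesis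
      using intertwine_orb(2)[OF assms(1-4) x assms(5)] x HomD(1)[OF assms(1) x] by (auto simp: cyc_pts_def)
  qed
  then show ?thesis by (auto simp: cyc_pts_def)
qed

end

section \<open>Removal of one cycle of \<open>h\<close>\<close>

context finite_group
begin

context
  fixes R S :: "nat set" and h g :: "'g gmap" and c :: nat
  assumes R: "finite R" and S: "finite S" and h: "h \<in> Hom R R" and g: "g \<in> Hom S S" and c: "c \<in> R"
begin

private definition "Z = orb h c"
private definition "i = card Z"
private definition "R0 = R - Z"
private definition "h0 = comp R0 h (gid R0)"

private lemma Z_facts: "Z \<subseteq> R" "finite Z" "i > 0" "pw h i c = c" "Z = (\<lambda>j. pw h j c) ` {..<i}"
  "inj_on (\<lambda>j. pw h j c) {..<i}" "c \<in> Z"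
  using orb_facts[OF R h c] orb_self[OF R h c] by (simp_all add: Z_def i_def)

private lemma Z_step: "x \<in> R \<Longrightarrow> fst h x \<in> Z \<longleftrightarrow> x \<in> Z"
proof
  assume x: "x \<in> R" and "fst h x \<in> Z"
  then have "orb h (fst h x) = Z" using orb_eq[OF R h c] by (simp add: Z_def)
  moreover have "orb h (fst h x) = orb h x" by (rule orb_eq[OF R h x orbit.base])
  ultimately show "x \<in> Z" using orb_self[OF R h x] by simp
next
  show "x \<in> Z \<Longrightarrow> fst h x \<in> Z" unfolding Z_def by (rule orbit.step)
qed

private lemma R0_facts: "R0 \<subseteq> R" "finite R0" "x \<in> R0 \<Longrightarrow> fst h x \<in> R0"
  using R Z_step[of x] HomD(1)[OF h, of x] by (auto simp: R0_def)

private lemma h0: "h0 \<in> Hom R0 R0"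
proof (rule Hom_restrict_target)
  show "h0 \<in> Hom R0 R" unfolding h0_def by (rule comp_in_Hom[OF gid_in_Hom[OF R0_facts(1)] h])
  show "fst h0 x \<in> R0" if "x \<in> R0" for x
    unfolding h0_def fst_res[OF that] by (rule R0_facts(3)[OF that])
qed

private lemma h0_simps: "x \<in> R0 \<Longrightarrow> fst h0 x = fst h x" "x \<in> R0 \<Longrightarrow> snd h0 x = snd h x"
  using HomD(2)[OF h] R0_facts(1) by (auto simp: h0_def fst_res snd_res)

text \<open>Once \<open>y\<close> and \<open>\<gamma>\<close> are given at \<open>c\<close>, the
  relations of \<open>intertwine_pow\<close> prescribe all values on the cycle; the assumption on
  \<open>\<gamma>\<close> makes them close up after \<open>i\<close> steps.\<close>

private lemma extend_over_cycle:
  assumes \<phi>0: "\<phi>0 \<in> Hom R0 S" "comp R0 g \<phi>0 = comp R0 \<phi>0 h0"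
    and y: "y \<in> S" "y \<notin> fst \<phi>0 ` R0" "card (orb g y) = i"
    and \<gamma>: "\<gamma> \<in> carrier G" "\<gamma> \<otimes> cp g i y = cp h i c \<otimes> \<gamma>"
  shows "\<exists>\<phi>. \<phi> \<in> Hom R S \<and> comp R g \<phi> = comp R \<phi> h \<and> comp R0 \<phi> (gid R0) = \<phi>0 \<and> fst \<phi> c = y \<and> snd \<phi> c = \<gamma>"
proof -
  note eq0 = \<phi>0(2)[unfolded comp_eq_iff[OF \<phi>0(1) h0 g]]
  have gy: "pw g j y \<in> S" for j by (rule pw_in[OF g y(1)])
  have giy: "pw g i y = y" "inj_on (\<lambda>j. pw g j y) {..<i}"
    using orb_facts(4,6)[OF S g y(1)] y(3) by simp_all
  have car: "cp h j c \<in> carrier G" "cp g j y \<in> carrier G" "snd g (pw g j y) \<in> carrier G"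
    "snd h (pw h j c) \<in> carrier G" for j
    using cp_closed[OF h c] cp_closed[OF g y(1)] HomD(2)[OF g gy] HomD(2)[OF h pw_in[OF h c]] by auto
  define J where "J = inv_into {..<i} (\<lambda>j. pw h j c)"
  have J: "J x < i" "pw h (J x) c = x" if "x \<in> Z" for x
    using that inv_into_into[of x "\<lambda>j. pw h j c" "{..<i}"] f_inv_into_f[of x "\<lambda>j. pw h j c" "{..<i}"] Z_facts(5)
    by (auto simp: J_def)
  have J': "J (pw h j c) = j" if "j < i" for j
    unfolding J_def using that Z_facts(6) by (intro inv_into_f_f) auto
  define a where "a x = (if x \<in> R0 then fst \<phi>0 x else pw g (J x) y)" for x
  \<comment> \<open>On the cycle this solves
    \<open>cp h j c \<otimes> b x = \<gamma> \<otimes> cp g j y\<close> at the point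
    \<open>x\<close> reached after \<open>j\<close> steps.\<close>
  define b where "b x = (if x \<in> R0 then snd \<phi>0 x else inv (cp h (J x) c) \<otimes> (\<gamma> \<otimes> cp g (J x) y))" for x
  let ?\<phi> = "(restrict a R, restrict b R)"
  have RZ: "x \<in> Z" if "x \<in> R" "x \<notin> R0" for x using that by (simp add: R0_def)
  have ZR: "x \<in> R" "x \<notin> R0" if "x \<in> Z" for x using that Z_facts(1) by (auto simp: R0_def)
  \<comment> \<open>Otherwise the whole \<open>g\<close>-orbit of this point, and with it
    \<open>y\<close>, would be the image of an orbit inside \<open>R0\<close>.\<close>
  have avoid: "pw g j y \<notin> fst \<phi>0 ` R0" for j
  proof
    assume "pw g j y \<in> fst \<phi>0 ` R0"
    then obtain x where x: "x \<in> R0" "pw g j y = fst \<phi>0 x" by blast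
    have "y \<in> orb g (pw g j y)"
      using orbit_swap[OF orb_self[OF S g y(1)] funpow_in_orbit[OF orb_self[OF S g y(1)]]] .
    also have "orb g (pw g j y) = fst \<phi>0 ` orb h0 x"
      unfolding x(2) by (rule intertwine_orb(1)[OF \<phi>0(1) h0 g \<phi>0(2) x(1) R0_facts(2)])
    finally show False
      using y(2) orb_facts(1)[OF R0_facts(2) h0 x(1)] by blast
  qed
  have \<phi>: "?\<phi> \<in> Hom R S"
  proof (rule HomI)
    fix x assume x: "x \<in> R"
    show "a x \<in> S" using x gy HomD(1)[OF \<phi>0(1)] by (simp add: a_def)
    show "b x \<in> carrier G" using x car \<gamma> HomD(2)[OF \<phi>0(1)] by (simp add: b_def)
  next
    have "inj_on a R0" "a ` R0 = fst \<phi>0 ` R0"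
      using HomD(3)[OF \<phi>0(1)] by (auto simp: a_def inj_on_def)
    moreover have "inj_on a Z"
    proof (rule inj_onI)
      fix x x' assume x: "x \<in> Z" "x' \<in> Z" "a x = a x'"
      then have "pw g (J x) y = pw g (J x') y" using ZR by (simp add: a_def)
      then have "J x = J x'" using giy(2) J x by (auto simp: inj_on_def)
      then show "x = x'" using J x by metis
    qed
    moreover have "a ` Z \<inter> fst \<phi>0 ` R0 = {}"
      using ZR avoid by (auto simp: a_def)
    ultimately have "inj_on a (R0 \<union> Z)"
      by (subst inj_on_Un) blast
    moreover have "R0 \<union> Z = R" using Z_facts(1) by (auto simp: R0_def)
    ultimately show "inj_on a R" by simp
  qed
  \<comment> \<open>The case \<open>j = i\<close> is included because the intertwining relation at
    the last point of the cycle returns to the first.\<close>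
  have pt: "a (pw h j c) = pw g j y" "cp h j c \<otimes> b (pw h j c) = \<gamma> \<otimes> cp g j y" if ji: "j \<le> i" for j
  proof -
    have Zj: "pw h j c \<in> Z" unfolding Z_def by (rule funpow_in_orbit[OF orb_self[OF R h c]])
    have ab: "a (pw h j c) = pw g (J (pw h j c)) y"
      "b (pw h j c) = inv (cp h (J (pw h j c)) c) \<otimes> (\<gamma> \<otimes> cp g (J (pw h j c)) y)"
      using ZR[OF Zj] by (simp_all add: a_def b_def)
    consider "j < i" | "j = i" using ji by linarith
    then have "a (pw h j c) = pw g j y \<and> cp h j c \<otimes> b (pw h j c) = \<gamma> \<otimes> cp g j y"
    proof cases
      case 1
      then show ?thesis using ab J'[OF 1] car \<gamma>(1) by (simp add: m_assoc[symmetric])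
    next
      case 2
      have "J (pw h j c) = 0" using 2 Z_facts(3,4) J'[of 0] by simp
      then show ?thesis using ab 2 giy(1) \<gamma> by (simp add: cp_0)
    qed
    then show "a (pw h j c) = pw g j y" "cp h j c \<otimes> b (pw h j c) = \<gamma> \<otimes> cp g j y" by auto
  qed
  have bcar: "b x \<in> carrier G" if "x \<in> R" for x
    using HomD(2)[OF \<phi> that] that by simp
  have "fst g (fst ?\<phi> x) = fst ?\<phi> (fst h x) \<and> snd ?\<phi> x \<otimes> snd g (fst ?\<phi> x) = snd h x \<otimes> snd ?\<phi> (fst h x)"
    if x: "x \<in> R" for x
  proof (cases "x \<in> R0")
    case True
    have "a x = fst \<phi>0 x" "b x = snd \<phi>0 x" "a (fst h x) = fst \<phi>0 (fst h x)" "b (fst h x) = snd \<phi>0 (fst h x)"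
      using True R0_facts(3)[OF True] by (simp_all add: a_def b_def)
    then show ?thesis
      using eq0 True x HomD(1)[OF h x] h0_simps[OF True] by simp
  next
    case False
    define j where "j = J x"
    have j: "j < i" "x = pw h j c" using J[OF RZ[OF x False]] by (simp_all add: j_def)
    have hx: "fst h x = pw h (Suc j) c" using j by simp
    have hxR: "fst h x \<in> R" by (rule HomD(1)[OF h x])
    have 1: "a x = pw g j y" "a (fst h x) = pw g (Suc j) y" "cp h j c \<otimes> b x = \<gamma> \<otimes> cp g j y"
      "cp h (Suc j) c \<otimes> b (fst h x) = \<gamma> \<otimes> cp g (Suc j) y"
      unfolding hx unfolding j(2) by (rule pt; use j(1) in simp)+
    have "cp h j c \<otimes> (b x \<otimes> snd g (pw g j y)) = \<gamma> \<otimes> cp g (Suc j) y"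
      using 1(3) car \<gamma>(1) bcar[OF x] cp_Suc[OF g y(1), of j] by (simp add: m_assoc[symmetric])
    also have "\<dots> = cp h j c \<otimes> (snd h x \<otimes> b (fst h x))"
      using 1(4) car bcar[OF hxR] cp_Suc[OF h c, of j] j(2) by (simp add: m_assoc)
    finally have "b x \<otimes> snd g (pw g j y) = snd h x \<otimes> b (fst h x)"
      using car bcar[OF x] bcar[OF hxR] HomD(2)[OF h x] by simp
    then show ?thesis using 1 x hxR by simp
  qed
  then have int: "comp R g ?\<phi> = comp R ?\<phi> h"
    unfolding comp_eq_iff[OF \<phi> h g] by blast
  have res: "comp R0 ?\<phi> (gid R0) = \<phi>0"
  proof (rule Hom_eqI[OF comp_in_Hom[OF gid_in_Hom[OF R0_facts(1)] \<phi>] \<phi>0(1)])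
    fix x assume x: "x \<in> R0"
    then have "x \<in> R" using R0_facts(1) by blast
    then show "fst (comp R0 ?\<phi> (gid R0)) x = fst \<phi>0 x" "snd (comp R0 ?\<phi> (gid R0)) x = snd \<phi>0 x"
      using x HomD(2)[OF \<phi>0(1) x] by (simp_all add: fst_res snd_res a_def b_def)
  qed
  have "a c = y" "b c = \<gamma>"
    using pt[of 0] car(1)[of 0] bcar[OF c] \<gamma>(1) by (simp_all add: cp_0)
  then show ?thesis
    using \<phi> int res c by (intro exI[of _ ?\<phi>]) simp
qed

text \<open>The converse of \<open>extend_over_cycle\<close>; with \<open>restrict_inj\<close> the
  fibres of restriction to \<open>R0\<close> are described completely.\<close>

private lemma restrict_off_cycle:
  assumes \<phi>: "\<phi> \<in> Hom R S" "comp R g \<phi> = comp R \<phi> h"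
  shows "comp R0 \<phi> (gid R0) \<in> Hom R0 S" "comp R0 g (comp R0 \<phi> (gid R0)) = comp R0 (comp R0 \<phi> (gid R0)) h0"
    "fst \<phi> c \<in> S - fst (comp R0 \<phi> (gid R0)) ` R0" "snd \<phi> c \<in> carrier G" "card (orb g (fst \<phi> c)) = i"
    "snd \<phi> c \<otimes> cp g i (fst \<phi> c) = cp h i c \<otimes> snd \<phi> c"
proof -
  let ?\<phi>0 = "comp R0 \<phi> (gid R0)"
  show \<phi>0: "?\<phi>0 \<in> Hom R0 S" by (rule comp_in_Hom[OF gid_in_Hom[OF R0_facts(1)] \<phi>(1)])
  note eq = \<phi>(2)[unfolded comp_eq_iff[OF \<phi>(1) h g]]
  have s: "fst ?\<phi>0 x = fst \<phi> x" "snd ?\<phi>0 x = snd \<phi> x" if "x \<in> R0" for x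
    using that R0_facts(1) HomD(2)[OF \<phi>(1)] by (auto simp: fst_res snd_res)
  show "comp R0 g ?\<phi>0 = comp R0 ?\<phi>0 h0"
    unfolding comp_eq_iff[OF \<phi>0 h0 g] using eq s h0_simps R0_facts(1,3) by (simp add: subset_iff)
  show "snd \<phi> c \<in> carrier G" by (rule HomD(2)[OF \<phi>(1) c])
  show "card (orb g (fst \<phi> c)) = i"
    using intertwine_orb(2)[OF \<phi>(1) h g \<phi>(2) c R] by (simp add: i_def Z_def)
  show "snd \<phi> c \<otimes> cp g i (fst \<phi> c) = cp h i c \<otimes> snd \<phi> c"
    using intertwine_pow(2)[OF \<phi>(1) h g \<phi>(2) c, of i] Z_facts(4) by simp
  have "fst \<phi> c \<noteq> fst \<phi> x" if "x \<in> R0" for x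
    using HomD(3)[OF \<phi>(1)] that R0_facts(1) c Z_facts(7) by (auto simp: R0_def inj_on_def)
  then show "fst \<phi> c \<in> S - fst ?\<phi>0 ` R0"
    using s HomD(1)[OF \<phi>(1) c] by auto
qed

text \<open>On the removed cycle \<open>intertwine_pow\<close> recovers all values from those at
  \<open>c\<close>.\<close>

private lemma restrict_inj:
  assumes \<phi>: "\<phi> \<in> Hom R S" "comp R g \<phi> = comp R \<phi> h" and \<psi>: "\<psi> \<in> Hom R S" "comp R g \<psi> = comp R \<psi> h"
    and eq: "comp R0 \<phi> (gid R0) = comp R0 \<psi> (gid R0)" "fst \<phi> c = fst \<psi> c" "snd \<phi> c = snd \<psi> c"
  shows "\<phi> = \<psi>"
proof -
  have "fst \<phi> x = fst \<psi> x \<and> snd \<phi> x = snd \<psi> x" if x: "x \<in> R" for x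
  proof (cases "x \<in> Z")
    case True
    then obtain j where j: "x = pw h j c" using Z_facts(5) by auto
    have "cp h j c \<otimes> snd \<phi> x = cp h j c \<otimes> snd \<psi> x"
      using intertwine_pow(2)[OF \<phi>(1) h g \<phi>(2) c, of j] intertwine_pow(2)[OF \<psi>(1) h g \<psi>(2) c, of j] eq j by simp
    then have "snd \<phi> x = snd \<psi> x"
      using HomD(2)[OF \<phi>(1) x] HomD(2)[OF \<psi>(1) x] cp_closed[OF h c] by simp
    then show ?thesis
      using intertwine_pow(1)[OF \<phi>(1) h g \<phi>(2) c, of j] intertwine_pow(1)[OF \<psi>(1) h g \<psi>(2) c, of j] eq j by simp
  next
    case False
    then have x0: "x \<in> R0" using x by (simp add: R0_def)
    show ?thesis
      using eq(1) fst_res[OF x0] snd_res[OF x0] HomD(2)[OF \<phi>(1) x] HomD(2)[OF \<psi>(1) x] by metis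
  qed
  then show ?thesis by (intro Hom_eqI[OF \<phi>(1) \<psi>(1)]) auto
qed

private definition "C = (\<lambda>y. y \<otimes> cp h i c \<otimes> inv y) ` carrier G"
text \<open>The order of the centralizer of the cycle product.\<close>

private definition "z = card {\<gamma> \<in> carrier G. \<gamma> \<otimes> cp h i c = cp h i c \<otimes> \<gamma>}"

private lemma C_class: "C \<in> conjugacy_classes G"
  unfolding conjugacy_classes_def C_def using cp_closed[OF h c] by blast

text \<open>If \<open>b = u a u\<inverse>\<close> with \<open>a\<close> the cycle product of
  \<open>h\<close>, then \<open>\<gamma> \<mapsto> \<gamma> u\<close> carries the solutions onto the
  centralizer of \<open>a\<close>. A solution exists only if \<open>b\<close> is conjugate to
  \<open>a\<close>.\<close>

private lemma card_intertwiners: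
  assumes b: "b \<in> carrier G"
  shows "card {\<gamma> \<in> carrier G. \<gamma> \<otimes> b = cp h i c \<otimes> \<gamma>} = (if b \<in> C then z else 0)"
proof (cases "b \<in> C")
  case True
  have a: "cp h i c \<in> carrier G" by (rule cp_closed[OF h c])
  obtain u where u: "u \<in> carrier G" "b = u \<otimes> cp h i c \<otimes> inv u" using True by (auto simp: C_def)
  have bu: "b \<otimes> u = u \<otimes> cp h i c" using u a by (simp add: m_assoc)
  have "bij_betw (\<lambda>\<gamma>. \<gamma> \<otimes> u) {\<gamma> \<in> carrier G. \<gamma> \<otimes> b = cp h i c \<otimes> \<gamma>}
      {\<gamma> \<in> carrier G. \<gamma> \<otimes> cp h i c = cp h i c \<otimes> \<gamma>}"
  proof (rule bij_betw_byWitness[where f' = "\<lambda>\<gamma>. \<gamma> \<otimes> inv u"])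
    show "(\<lambda>\<gamma>. \<gamma> \<otimes> u) ` {\<gamma> \<in> carrier G. \<gamma> \<otimes> b = cp h i c \<otimes> \<gamma>}
      \<subseteq> {\<gamma> \<in> carrier G. \<gamma> \<otimes> cp h i c = cp h i c \<otimes> \<gamma>}"
    proof (rule image_subsetI, elim CollectE conjE, intro CollectI conjI)
      fix \<gamma> assume \<gamma>: "\<gamma> \<in> carrier G" "\<gamma> \<otimes> b = cp h i c \<otimes> \<gamma>"
      have "\<gamma> \<otimes> u \<otimes> cp h i c = \<gamma> \<otimes> b \<otimes> u" using \<gamma>(1) u(1) a b bu by (simp add: m_assoc)
      then show "\<gamma> \<otimes> u \<otimes> cp h i c = cp h i c \<otimes> (\<gamma> \<otimes> u)" using \<gamma> u(1) a b by (simp add: m_assoc)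
    qed (use u in auto)
    show "(\<lambda>\<gamma>. \<gamma> \<otimes> inv u) ` {\<gamma> \<in> carrier G. \<gamma> \<otimes> cp h i c = cp h i c \<otimes> \<gamma>}
      \<subseteq> {\<gamma> \<in> carrier G. \<gamma> \<otimes> b = cp h i c \<otimes> \<gamma>}"
    proof (rule image_subsetI, elim CollectE conjE, intro CollectI conjI)
      fix \<gamma> assume \<gamma>: "\<gamma> \<in> carrier G" "\<gamma> \<otimes> cp h i c = cp h i c \<otimes> \<gamma>"
      have "\<gamma> \<otimes> inv u \<otimes> b = \<gamma> \<otimes> cp h i c \<otimes> inv u"
        using \<gamma>(1) u(1) a unfolding u(2) by (simp add: m_assoc[symmetric]) (simp add: m_assoc)
      then show "\<gamma> \<otimes> inv u \<otimes> b = cp h i c \<otimes> (\<gamma> \<otimes> inv u)" using \<gamma> u(1) a by (simp add: m_assoc)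
    qed (use u in auto)
  qed (use u in \<open>auto simp: m_assoc\<close>)
  then show ?thesis using True by (simp add: z_def bij_betw_same_card)
next
  case False
  have "cp h i c \<in> C"
    using cp_closed[OF h c] by (auto simp: C_def intro!: image_eqI[of _ _ "\<one>"])
  then have "{\<gamma> \<in> carrier G. \<gamma> \<otimes> b = cp h i c \<otimes> \<gamma>} = {}"
    using conj_class_intertwine[OF C_class b cp_closed[OF h c]] False by blast
  then show ?thesis using False by (simp only: card.empty if_False)
qed

text \<open>Intertwiners on \<open>R\<close> fibre over those on \<open>R0\<close>. A point of the
  fibre is a target \<open>y\<close> off the image, on an \<open>i\<close>-cycle of
  \<open>g\<close>, with a compatible entry at \<open>c\<close>: there are \<open>z\<close> such
  entries if the label is \<open>C\<close> and none otherwise. The points of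
  \<open>cyc_pts S g i C\<close> inside the image are the images of
  \<open>cyc_pts R0 h0 i C\<close>, so their number is the same for every intertwiner. Their
  contribution stands on the left to avoid subtraction of naturals.\<close>

private lemma cnt_remove_cycle:
  "cnt R h S g + z * card (cyc_pts R0 h0 i C) * cnt R0 h0 S g = z * card (cyc_pts S g i C) * cnt R0 h0 S g"
proof -
  let ?A = "{\<phi> \<in> Hom R S. comp R g \<phi> = comp R \<phi> h}"
  let ?B = "{\<phi> \<in> Hom R0 S. comp R0 g \<phi> = comp R0 \<phi> h0}"
  let ?Y = "\<lambda>\<phi>0. SIGMA y:{y \<in> S - fst \<phi>0 ` R0. card (orb g y) = i}. {\<gamma> \<in> carrier G. \<gamma> \<otimes> cp g i y = cp h i c \<otimes> \<gamma>}"
  have finX0: "finite ?B" using finite_Hom[OF R0_facts(2) S] by simp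
  have "bij_betw (\<lambda>\<phi>. (comp R0 \<phi> (gid R0), fst \<phi> c, snd \<phi> c)) ?A (Sigma ?B ?Y)"
  proof (rule bij_betw_imageI)
    show "inj_on (\<lambda>\<phi>. (comp R0 \<phi> (gid R0), fst \<phi> c, snd \<phi> c)) ?A"
    proof (rule inj_onI)
      fix \<phi> \<psi> assume *: "\<phi> \<in> ?A" "\<psi> \<in> ?A"
        "(comp R0 \<phi> (gid R0), fst \<phi> c, snd \<phi> c) = (comp R0 \<psi> (gid R0), fst \<psi> c, snd \<psi> c)"
      show "\<phi> = \<psi>" by (rule restrict_inj) (use * in simp_all)
    qed
    show "(\<lambda>\<phi>. (comp R0 \<phi> (gid R0), fst \<phi> c, snd \<phi> c)) ` ?A = Sigma ?B ?Y"
    proof (intro equalityI subsetI)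
      fix t assume "t \<in> (\<lambda>\<phi>. (comp R0 \<phi> (gid R0), fst \<phi> c, snd \<phi> c)) ` ?A"
      then obtain \<phi> where "\<phi> \<in> Hom R S" "comp R g \<phi> = comp R \<phi> h" "t = (comp R0 \<phi> (gid R0), fst \<phi> c, snd \<phi> c)"
        by blast
      then show "t \<in> Sigma ?B ?Y" using restrict_off_cycle[of \<phi>] by simp
    next
      fix t assume "t \<in> Sigma ?B ?Y"
      then obtain \<phi>0 y \<gamma> where t: "t = (\<phi>0, y, \<gamma>)" "\<phi>0 \<in> Hom R0 S" "comp R0 g \<phi>0 = comp R0 \<phi>0 h0"
        "y \<in> S" "y \<notin> fst \<phi>0 ` R0" "card (orb g y) = i" "\<gamma> \<in> carrier G" "\<gamma> \<otimes> cp g i y = cp h i c \<otimes> \<gamma>"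
        by blast
      obtain \<phi> where "\<phi> \<in> Hom R S" "comp R g \<phi> = comp R \<phi> h" "comp R0 \<phi> (gid R0) = \<phi>0" "fst \<phi> c = y" "snd \<phi> c = \<gamma>"
        using extend_over_cycle[OF t(2-)] by blast
      then show "t \<in> (\<lambda>\<phi>. (comp R0 \<phi> (gid R0), fst \<phi> c, snd \<phi> c)) ` ?A"
        unfolding t(1) by (intro image_eqI[of _ _ \<phi>]) simp_all
    qed
  qed
  then have "cnt R h S g = card (Sigma ?B ?Y)"
    unfolding cnt_def by (rule bij_betw_same_card)
  also have "\<dots> = (\<Sum>\<phi>0\<in>?B. card (?Y \<phi>0))"
    using finX0 S finite_carrier by (intro card_SigmaI) auto
  finally have cnt: "cnt R h S g = (\<Sum>\<phi>0\<in>?B. card (?Y \<phi>0))" .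
  have "card (?Y \<phi>0) + z * card (cyc_pts R0 h0 i C) = z * card (cyc_pts S g i C)" if "\<phi>0 \<in> ?B" for \<phi>0
  proof -
    have \<phi>0: "\<phi>0 \<in> Hom R0 S" "comp R0 g \<phi>0 = comp R0 \<phi>0 h0" using that by auto
    let ?P = "cyc_pts S g i C" and ?I = "fst \<phi>0 ` R0"
    let ?T = "{y \<in> S - ?I. card (orb g y) = i}"
    have finP: "finite ?P" using S by (simp add: cyc_pts_def)
    have "card (?Y \<phi>0) = (\<Sum>y\<in>?T. card {\<gamma> \<in> carrier G. \<gamma> \<otimes> cp g i y = cp h i c \<otimes> \<gamma>})"
      using S finite_carrier by (intro card_SigmaI) auto
    also have "\<dots> = (\<Sum>y\<in>?T. if cp g i y \<in> C then z else 0)"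
      by (intro sum.cong refl card_intertwiners cp_closed[OF g]) simp
    also have "\<dots> = (\<Sum>y\<in>?T \<inter> {y. cp g i y \<in> C}. z)"
      using S by (subst sum.inter_restrict) simp_all
    also have "?T \<inter> {y. cp g i y \<in> C} = ?P - ?I" by (auto simp: cyc_pts_def)
    finally have 1: "card (?Y \<phi>0) = z * card (?P - ?I)" by simp
    have "?P \<inter> ?I = fst \<phi>0 ` cyc_pts R0 h0 i C"
      by (rule intertwine_cyc_pts[OF \<phi>0(1) h0 g \<phi>0(2) R0_facts(2) C_class])
    moreover have "inj_on (fst \<phi>0) (cyc_pts R0 h0 i C)"
      using HomD(3)[OF \<phi>0(1)] by (rule inj_on_subset) (auto simp: cyc_pts_def)
    ultimately have "card (?P \<inter> ?I) = card (cyc_pts R0 h0 i C)" by (simp add: card_image)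
    moreover have "card ?P = card (?P - ?I) + card (?P \<inter> ?I)"
      using finP by (metis add.commute card_Int_Diff)
    ultimately show ?thesis using 1 by (simp add: distrib_left)
  qed
  then have "(\<Sum>\<phi>0\<in>?B. card (?Y \<phi>0) + z * card (cyc_pts R0 h0 i C)) = (\<Sum>\<phi>0\<in>?B. z * card (cyc_pts S g i C))"
    by (rule sum.cong[OF refl])
  then show ?thesis
    unfolding cnt by (simp add: sum.distrib cnt_def mult.commute)
qed

lemmas cnt_cycle_removal = cnt_remove_cycle[unfolded C_def z_def h0_def R0_def i_def Z_def]
lemmas restrict_off_cycle_Hom = h0[unfolded h0_def R0_def Z_def]
lemmas cycle_class = C_class[unfolded C_def i_def Z_def]

end

text \<open>Induction on the number of points: a cycle of length \<open>i\<close> contributes a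
  factor linear in \<open>X_i^C\<close>, of degree \<open>i\<close>, so the degrees add up to
  \<open>card R\<close>. The polynomial is found before \<open>n\<close> is chosen.\<close>

lemma cnt_polyfun:
  assumes "finite R" "h \<in> Hom R R"
  shows "\<exists>F :: (nat \<times> 'g set \<Rightarrow> 'k::field_char_0) \<Rightarrow> 'k.
    polyfun ({1..} \<times> conjugacy_classes G) fst (card R) F \<and>
    (\<forall>n. \<forall>g\<in>Wr n. of_nat (cnt R h {1..n} g) = F (\<lambda>(i, C). of_nat (labeled_cycles G n i C g)))"
  using assms
proof (induction "card R" arbitrary: R h rule: less_induct)
  case less
  show ?case
  proof (cases "R = {}")
    case True
    have "Hom {} S = {(\<lambda>x. undefined, \<lambda>x. undefined)}" for S
      by (auto simp: Hom_iff)
    then have "cnt R h S g = 1" for S g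
      unfolding cnt_def True by (simp add: fig_comp_def compose_def restrict_def)
    then show ?thesis
      by (intro exI[of _ "\<lambda>v. 1"]) (simp add: polyfun_const)
  next
    case False
    then obtain c where c: "c \<in> R" by blast
    note R = \<open>finite R\<close> and h = \<open>h \<in> Hom R R\<close>
    define i where "i = card (orb h c)"
    define R0 where "R0 = R - orb h c"
    define h0 where "h0 = comp R0 h (gid R0)"
    define C where "C = (\<lambda>y. y \<otimes> cp h i c \<otimes> inv y) ` carrier G"
    define z where "z = card {\<gamma> \<in> carrier G. \<gamma> \<otimes> cp h i c = cp h i c \<otimes> \<gamma>}"
    define L where "L = card (cyc_pts R0 h0 i C)"
    have i: "i > 0" using orb_facts(3)[OF R h c] by (simp add: i_def)
    have cardR: "card R = i + card R0"
      using orb_facts(1,2)[OF R h c] R card_mono[of R "orb h c"]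
      by (simp add: i_def R0_def card_Diff_subset)
    \<comment> \<open>The context of this fact also fixes a target with an automorphism; the empty
      set with its identity supplies them.\<close>
    have h0: "h0 \<in> Hom R0 R0" unfolding h0_def R0_def by (rule restrict_off_cycle_Hom[OF R finite.emptyI h gid_in_Hom[OF subset_refl] c])
    have C: "C \<in> conjugacy_classes G" unfolding C_def i_def by (rule cycle_class[OF R finite.emptyI h gid_in_Hom[OF subset_refl] c])
    obtain F :: "(nat \<times> 'g set \<Rightarrow> 'k) \<Rightarrow> 'k" where F: "polyfun ({1..} \<times> conjugacy_classes G) fst (card R0) F"
      "\<And>n g. g \<in> Wr n \<Longrightarrow> of_nat (cnt R0 h0 {1..n} g) = F (\<lambda>(i, C). of_nat (labeled_cycles G n i C g))"
      using less.hyps[of R0 h0] cardR i h0 R by (auto simp: R0_def)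
    \<comment> \<open>\<open>cnt_cycle_removal\<close> solved for \<open>cnt R h\<close>, with the
      points of the cycles of \<open>g\<close> counted as \<open>i\<close> times the
      variable.\<close>
    let ?F = "\<lambda>v. (of_nat z * of_nat i) * (v (i, C) * F v) + (- of_nat (z * L)) * F v"
    have "polyfun ({1..} \<times> conjugacy_classes G) fst (card R) ?F"
      unfolding cardR using polyfun_mult_var[OF F(1), of "(i, C)"] i C
      by (intro polyfun_add polyfun_scale) (use polyfun_mono[OF F(1), of "i + card R0"] in auto)
    moreover have "of_nat (cnt R h {1..n} g) = ?F (\<lambda>(i, C). of_nat (labeled_cycles G n i C g))"
      if g: "g \<in> Wr n" for n g
    proof -
      have "cnt R h {1..n} g + z * L * cnt R0 h0 {1..n} g = z * (i * labeled_cycles G n i C g) * cnt R0 h0 {1..n} g"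
        using cnt_cycle_removal[OF R _ h g c] card_cyc_pts[OF C g, of i]
        unfolding C_def z_def h0_def R0_def i_def L_def by simp
      then have "(of_nat (cnt R h {1..n} g) :: 'k) + of_nat (z * L) * of_nat (cnt R0 h0 {1..n} g)
          = of_nat z * of_nat i * (of_nat (labeled_cycles G n i C g) * of_nat (cnt R0 h0 {1..n} g))"
        by (metis (no_types, lifting) of_nat_add of_nat_mult mult.assoc)
      then show ?thesis
        using F(2)[OF g] by (simp add: algebra_simps eq_diff_eq)
    qed
    ultimately show ?thesis by blast
  qed
qed

end


section \<open>Characters of finitely generated modules\<close>

context finite_group
begin

text \<open>Replacing \<open>f\<close> by its extensions \<open>v\<close>, the invariance of \<open>q\<close> turns \<open>q f (g f)\<close> into a function of
  the restriction of \<open>v\<inverse> g v\<close>.\<close>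

lemma invariant_kernel_in_span:
  fixes q :: "'g gmap \<Rightarrow> 'g gmap \<Rightarrow> 'k::field_char_0"
  assumes S: "finite S" and D: "D \<subseteq> S" and e: "card D \<le> e"
    and q: "\<And>w f f'. w \<in> Hom S S \<Longrightarrow> f \<in> Hom D S \<Longrightarrow> f' \<in> Hom D S \<Longrightarrow> q (comp D w f) (comp D w f') = q f f'"
  shows "in_cnt_span e S (\<lambda>g. \<Sum>f\<in>Hom D S. q f (comp D g f))"
proof (rule in_cnt_span_cong)
  let ?c = "of_nat (card (stab D S)) :: 'k"
  have finD: "finite D" using S D finite_subset by blast
  show "in_cnt_span e S (\<lambda>g. inverse ?c * (\<Sum>\<sigma>\<in>Hom D S. q (gid D) \<sigma> * of_nat (nct D \<sigma> S g)))"
    by (intro in_cnt_span_scale in_cnt_span_sum nct_in_span[OF S D _ e])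
  fix g assume g: "g \<in> Hom S S"
  note gD = gid_in_Hom[OF D]
  let ?W = "Hom S S" and ?H = "Hom D S"
  have finW: "finite ?W" and finH: "finite ?H" using finite_Hom S finD by auto
  have "(\<Sum>\<sigma>\<in>?H. q (gid D) \<sigma> * of_nat (nct D \<sigma> S g)) =
      (\<Sum>\<sigma>\<in>?H. \<Sum>v\<in>?W. if comp D g (comp D v (gid D)) = comp D v \<sigma> then q (gid D) \<sigma> else 0)"
    by (simp add: nct_def sum.If_cases[OF finW] mult.commute Int_def)
  also have "\<dots> = (\<Sum>v\<in>?W. \<Sum>\<sigma>\<in>?H. if comp D g (comp D v (gid D)) = comp D v \<sigma> then q (gid D) \<sigma> else 0)"
    by (rule sum.swap)
  also have "\<dots> = (\<Sum>v\<in>?W. q (comp D v (gid D)) (comp D g (comp D v (gid D))))"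
  proof (rule sum.cong[OF refl])
    fix v assume v: "v \<in> ?W"
    let ?x = "comp D g (comp D v (gid D))"
    \<comment> \<open>The restriction of \<open>v\<inverse> g v\<close> to \<open>D\<close>: the
      only \<open>\<sigma>\<close> that contributes for this \<open>v\<close>.\<close>
    let ?\<sigma> = "comp D (ginv S v) ?x"
    have x: "?x \<in> ?H" by (intro comp_in_Hom[OF _ g] comp_in_Hom[OF gD v])
    have \<sigma>: "?\<sigma> \<in> ?H" by (rule comp_in_Hom[OF x ginv(1)[OF S v]])
    have x\<sigma>: "comp D v ?\<sigma> = ?x" by (rule comp_ginv_cancel(2)[OF S v x])
    have "(?x = comp D v \<sigma>) = (\<sigma> = ?\<sigma>)" if "\<sigma> \<in> ?H" for \<sigma>
      using comp_left_cancel[OF v that \<sigma>] x\<sigma> by auto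
    then have "(\<Sum>\<sigma>\<in>?H. if ?x = comp D v \<sigma> then q (gid D) \<sigma> else 0) = (\<Sum>\<sigma>\<in>?H. if \<sigma> = ?\<sigma> then q (gid D) \<sigma> else 0)"
      by (intro sum.cong) auto
    also have "\<dots> = q (gid D) ?\<sigma>" using \<sigma> finH by simp
    also have "\<dots> = q (comp D v (gid D)) ?x"
      using q[OF v gD \<sigma>] x\<sigma> by simp
    finally show "(\<Sum>\<sigma>\<in>?H. if ?x = comp D v \<sigma> then q (gid D) \<sigma> else 0) = q (comp D v (gid D)) ?x" .
  qed
  also have "\<dots> = (\<Sum>f\<in>?H. \<Sum>v | v \<in> ?W \<and> comp D v (gid D) = f. q (comp D v (gid D)) (comp D g (comp D v (gid D))))"
    using comp_in_Hom[OF gD] by (intro sum.group[OF finW finH, symmetric]) auto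
  also have "\<dots> = (\<Sum>f\<in>?H. ?c * q f (comp D g f))"
  proof (rule sum.cong[OF refl])
    fix f assume f: "f \<in> ?H"
    have "(\<Sum>v | v \<in> ?W \<and> comp D v (gid D) = f. q (comp D v (gid D)) (comp D g (comp D v (gid D)))) =
        (\<Sum>v | v \<in> ?W \<and> comp D v (gid D) = f. q f (comp D g f))"
      by (rule sum.cong) auto
    then show "(\<Sum>v | v \<in> ?W \<and> comp D v (gid D) = f. q (comp D v (gid D)) (comp D g (comp D v (gid D)))) = ?c * q f (comp D g f)"
      using card_extensions[OF S D f] by simp
  qed
  finally show "(\<Sum>f\<in>?H. q f (comp D g f)) = inverse ?c * (\<Sum>\<sigma>\<in>?H. q (gid D) \<sigma> * of_nat (nct D \<sigma> S g))"
    using card_stab_pos[OF S D] by (simp add: sum_distrib_left[symmetric] mult.assoc[symmetric])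
qed

text \<open>For \<open>a \<le> n\<close> and \<open>h\<close> in \<open>Wr a\<close> this is a coset
  of the stabilizer of \<open>[a]\<close>; over all such \<open>h\<close> these cosets make up the
  subgroup \<open>W_a \<times> W_{n-a}\<close>.\<close>

definition cst :: "nat \<Rightarrow> nat \<Rightarrow> 'g gmap \<Rightarrow> 'g gmap set" where
  "cst a n h = {w \<in> Wr n. comp {1..a} w (gid {1..a}) = h}"

lemma cst_gid: "cst a n (gid {1..a}) = stab {1..a} {1..n}"
  by (simp add: cst_def stab_def)

lemma finite_cst: "finite (cst a n h)"
  using finite_Hom[of "{1..n}" "{1..n}"] by (simp add: cst_def)

lemma gid_le: "a \<le> n \<Longrightarrow> gid {1..a} \<in> Hom {1..a} {1..n}"
  by (intro gid_in_Hom) simp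

lemma Wr_le: "a \<le> n \<Longrightarrow> h \<in> Wr a \<Longrightarrow> h \<in> Hom {1..a} {1..n}"
  using Hom_mono[of "{1..a}" "{1..n}" "{1..a}"] by auto

lemma card_cst:
  assumes "a \<le> n" "h \<in> Wr a"
  shows "card (cst a n h) = card (stab {1..a} {1..n})"
  unfolding cst_def using assms Wr_le by (intro card_extensions) auto

lemma cst_comp:
  assumes "a \<le> n" "h \<in> Wr a" "h' \<in> Wr a" "w \<in> cst a n h" "w' \<in> cst a n h'"
  shows "comp {1..n} w w' \<in> cst a n (comp {1..a} h h')"
proof -
  let ?A = "{1..a}" and ?N = "{1..n}"
  have w: "w \<in> Wr n" "comp ?A w (gid ?A) = h" and w': "w' \<in> Wr n" "comp ?A w' (gid ?A) = h'"
    using assms by (auto simp: cst_def)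
  note gA = gid_le[OF assms(1)]
  have "comp ?A (comp ?N w w') (gid ?A) = comp ?A w h'"
    using comp_assoc[OF gA w'(1) w(1)] w'(2) by simp
  also have "h' = comp ?A (gid ?A) h'" using comp_gid_left[OF assms(3)] by simp
  also have "comp ?A w (comp ?A (gid ?A) h') = comp ?A h h'"
    using comp_assoc[OF assms(3) gA w(1)] w(2) by simp
  finally show ?thesis using comp_in_Hom[OF w'(1) w(1)] by (simp add: cst_def)
qed

text \<open>Translation is injective into a coset of equal size, so it is onto.\<close>

lemma bij_cst:
  assumes "a \<le> n" "h \<in> Wr a" "h' \<in> Wr a" "w \<in> cst a n h"
  shows "bij_betw (\<lambda>w'. comp {1..n} w w') (cst a n h') (cst a n (comp {1..a} h h'))"
    and "bij_betw (\<lambda>w'. comp {1..n} w' w) (cst a n h') (cst a n (comp {1..a} h' h))"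
proof -
  have w: "w \<in> Wr n" using assms by (simp add: cst_def)
  have sub: "cst a n h \<subseteq> Wr n" for h by (auto simp: cst_def)
  have hh: "comp {1..a} h h' \<in> Wr a" "comp {1..a} h' h \<in> Wr a"
    using assms comp_in_Hom by blast+
  have 1: "inj_on (\<lambda>w'. comp {1..n} w w') (cst a n h')" "inj_on (\<lambda>w'. comp {1..n} w' w) (cst a n h')"
    using bij_comp_left[OF _ w, of "{1..n}"] bij_comp_right[OF _ w, of "{1..n}"]
    by (auto simp: bij_betw_def intro: inj_on_subset[OF _ sub])
  have 2: "(\<lambda>w'. comp {1..n} w w') ` cst a n h' \<subseteq> cst a n (comp {1..a} h h')"
    "(\<lambda>w'. comp {1..n} w' w) ` cst a n h' \<subseteq> cst a n (comp {1..a} h' h)"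
    using cst_comp[OF assms(1)] assms(2-4) by blast+
  have "(\<lambda>w'. comp {1..n} w w') ` cst a n h' = cst a n (comp {1..a} h h')"
    by (rule card_subset_eq[OF finite_cst 2(1)])
      (simp del: One_nat_def add: card_image[OF 1(1)] card_cst[OF assms(1)] assms(3) hh)
  moreover have "(\<lambda>w'. comp {1..n} w' w) ` cst a n h' = cst a n (comp {1..a} h' h)"
    by (rule card_subset_eq[OF finite_cst 2(2)])
      (simp del: One_nat_def add: card_image[OF 1(2)] card_cst[OF assms(1)] assms(3) hh)
  ultimately show "bij_betw (\<lambda>w'. comp {1..n} w w') (cst a n h') (cst a n (comp {1..a} h h'))"
    "bij_betw (\<lambda>w'. comp {1..n} w' w) (cst a n h') (cst a n (comp {1..a} h' h))"
    using 1 by (auto simp: bij_betw_def)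
qed

end

locale fig_mod = finite_group G for G :: "('g, 'b) monoid_scheme" (structure) +
  fixes s :: "'k::field_char_0 \<Rightarrow> 'v::ab_group_add \<Rightarrow> 'v" and X :: "('g, 'v) fig_functor"
  assumes X: "fig_module G s X"
begin

abbreviation "ob n \<equiv> fobj X {1..n}"
abbreviation "mp m n \<equiv> fmap X {1..m} {1..n}"

sublocale V: vector_space s
  by (rule conjunct1[OF X[unfolded fig_module_def]])

lemma ob_subspace: "V.subspace (ob n)"
  and mp_lin: "f \<in> Hom {1..m} {1..n} \<Longrightarrow> lin_map s (ob m) s (ob n) (mp m n f)"
  and mp_gid: "x \<in> ob n \<Longrightarrow> mp n n (gid {1..n}) x = x"
  and mp_comp: "f \<in> Hom {1..l} {1..m} \<Longrightarrow> h \<in> Hom {1..m} {1..n} \<Longrightarrow> x \<in> ob l \<Longrightarrow>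
    mp l n (comp {1..l} h f) x = mp m n h (mp l m f x)"
proof -
  note X1 = conjunct2[OF X[unfolded fig_module_def]] and fin = finite_atLeastAtMost
  note X2 = conjunct2[OF X1]
  note X3 = conjunct2[OF X2]
  note X4 = conjunct2[OF X3]
  show "V.subspace (ob n)" by (rule conjunct1[OF X1, rule_format, OF fin])
  show "f \<in> Hom {1..m} {1..n} \<Longrightarrow> lin_map s (ob m) s (ob n) (mp m n f)"
    by (rule conjunct1[OF X2, rule_format]) (intro conjI fin)
  show "x \<in> ob n \<Longrightarrow> mp n n (gid {1..n}) x = x"
    by (rule conjunct1[OF X3, rule_format, OF fin])
  show "f \<in> Hom {1..l} {1..m} \<Longrightarrow> h \<in> Hom {1..m} {1..n} \<Longrightarrow> x \<in> ob l \<Longrightarrow>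
    mp l n (comp {1..l} h f) x = mp m n h (mp l m f x)"
    by (rule X4[rule_format]) (intro conjI fin)
qed

lemma mp_in: "f \<in> Hom {1..m} {1..n} \<Longrightarrow> x \<in> ob m \<Longrightarrow> mp m n f x \<in> ob n"
  by (rule lin_map_in[OF mp_lin])

text \<open>By the Yoneda lemma a map from \<open>M(d j)\<close> is an element \<open>v j\<close> in
  degree \<open>d j\<close>; this states generation by such elements, on the sets
  \<open>[n]\<close>.\<close>

definition generated :: "nat \<Rightarrow> 'j set \<Rightarrow> ('j \<Rightarrow> nat) \<Rightarrow> ('j \<Rightarrow> 'v) \<Rightarrow> bool" where
  "generated e J d v \<longleftrightarrow> finite J \<and> (\<forall>j\<in>J. d j \<le> e \<and> v j \<in> ob (d j)) \<and>
     (\<forall>n. V.span ((\<lambda>(j, f). mp (d j) n f (v j)) ` (SIGMA j:J. Hom {1..d j} {1..n})) = ob n)"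

lemma generated_fin_dim:
  assumes "generated e J d v"
  shows "fin_dim s (ob n)"
proof -
  have "finite ((\<lambda>(j, f). mp (d j) n f (v j)) ` (SIGMA j:J. Hom {1..d j} {1..n}))"
    using assms finite_Hom by (auto simp: generated_def)
  then show ?thesis
    unfolding fin_dim_def using assms ob_subspace V.vector_space_axioms by (auto simp: generated_def)
qed

lemma trace_class_fun:
  assumes "fin_dim s (ob n)" "w \<in> Wr n" "g \<in> Wr n"
  shows "trace_on s (ob n) (mp n n (comp {1..n} w (comp {1..n} g (ginv {1..n} w)))) = trace_on s (ob n) (mp n n g)"
proof -
  let ?S = "{1..n}"
  have wi: "ginv ?S w \<in> Wr n" "comp ?S (ginv ?S w) w = gid ?S" using ginv[of ?S w] assms by auto
  have gwi: "comp ?S g (ginv ?S w) \<in> Wr n" using comp_in_Hom assms wi by blast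
  have l: "lin_map s (ob n) s (ob n) (mp n n f)" if "f \<in> Wr n" for f by (rule mp_lin[OF that])
  have "trace_on s (ob n) (mp n n (comp ?S w (comp ?S g (ginv ?S w)))) =
      trace_on s (ob n) (\<lambda>x. mp n n w (mp n n (comp ?S g (ginv ?S w)) x))"
    by (rule trace_cong[OF assms(1) l]) (use comp_in_Hom[OF gwi assms(2)] mp_comp[OF gwi assms(2)] in auto)
  also have "\<dots> = trace_on s (ob n) (\<lambda>x. mp n n (comp ?S g (ginv ?S w)) (mp n n w x))"
    by (rule trace_commute[OF assms(1,1) l[OF gwi] l[OF assms(2)]])
  also have "\<dots> = trace_on s (ob n) (mp n n g)"
  proof (rule trace_cong[OF assms(1) lin_map_compose[OF l[OF assms(2)] l[OF gwi]]])
    fix x assume x: "x \<in> ob n"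
    have "mp n n (comp ?S g (ginv ?S w)) (mp n n w x) = mp n n g (mp n n (ginv ?S w) (mp n n w x))"
      by (rule mp_comp[OF wi(1) assms(3) mp_in[OF assms(2) x]])
    also have "mp n n (ginv ?S w) (mp n n w x) = x"
      using mp_comp[OF assms(2) wi(1) x] wi(2) mp_gid[OF x] by simp
    finally show "mp n n (comp ?S g (ginv ?S w)) (mp n n w x) = mp n n g x" .
  qed
  finally show ?thesis .
qed

text \<open>The translates of the generators form a spanning family that \<open>W_n\<close> permutes
  through its action on the maps \<open>f\<close>. Averaging the coefficient functionals over
  \<open>W_n\<close> makes them equivariant, so the trace is a sum of kernels of the kind treated in
  \<open>invariant_kernel_in_span\<close>.\<close>

lemma character_in_span:
  assumes gen: "generated e J d v"
  shows "in_cnt_span e {1..n} (\<lambda>g. trace_on s (ob n) (mp n n g))"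
proof -
  let ?S = "{1..n}" and ?W = "Wr n"
  let ?I = "SIGMA j:J. Hom {1..d j} ?S"
  have J: "finite J" "\<And>j. j \<in> J \<Longrightarrow> d j \<le> e" "\<And>j. j \<in> J \<Longrightarrow> v j \<in> ob (d j)"
    and sp: "V.span ((\<lambda>(j, f). mp (d j) n f (v j)) ` ?I) = ob n"
    using gen by (auto simp: generated_def)
  have finI: "finite ?I" using J(1) finite_Hom by auto
  have finW: "finite ?W" by (rule finite_Hom) auto
  define k where "k = inverse (of_nat (card ?W) :: 'k)"
  have k: "k * of_nat (card ?W) = 1"
  proof -
    have "card ?W \<noteq> 0" using finW gid_in_Hom[of ?S ?S] card_0_eq[OF finW] by blast
    then show ?thesis unfolding k_def by simp
  qed
  obtain c where fr: "frame s (ob n) ?I c (\<lambda>(j, f). mp (d j) n f (v j))"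
    using frame_of_spanning[OF V.vector_space_axioms finI sp] by blast
  have cl: "lin_map s (ob n) (*) UNIV (c (j, f))" if "j \<in> J" "f \<in> Hom {1..d j} ?S" for j f
    using fr that by (auto simp: frame_def)
  have ex: "x = (\<Sum>j\<in>J. \<Sum>f\<in>Hom {1..d j} ?S. s (c (j, f) x) (mp (d j) n f (v j)))" if "x \<in> ob n" for x
    using fr that J(1) finite_Hom by (simp add: frame_def sum.Sigma case_prod_beta)
  define c' where "c' j f x = k * (\<Sum>w\<in>?W. c (j, comp {1..d j} w f) (mp n n w x))" for j f x
  have c'l: "lin_map s (ob n) (*) UNIV (c' j f)" if "j \<in> J" "f \<in> Hom {1..d j} ?S" for j f
    unfolding c'_def
    by (intro lin_map_scale_fun[OF module_mult subspace_UNIV_mult]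
        lin_map_sum_fun[OF module_mult subspace_UNIV_mult] lin_map_compose[OF mp_lin cl])
      (use that comp_in_Hom in auto)
  have c'inv: "c' j (comp {1..d j} w f) (mp n n w x) = c' j f x"
    if "j \<in> J" "f \<in> Hom {1..d j} ?S" "w \<in> ?W" "x \<in> ob n" for j f w x
  proof -
    have "(\<Sum>w'\<in>?W. c (j, comp {1..d j} w' (comp {1..d j} w f)) (mp n n w' (mp n n w x)))
      = (\<Sum>w'\<in>?W. c (j, comp {1..d j} (comp ?S w' w) f) (mp n n (comp ?S w' w) x))"
      using comp_assoc[OF that(2,3)] mp_comp[OF that(3) _ that(4)] by (intro sum.cong) auto
    also have "\<dots> = (\<Sum>w'\<in>?W. c (j, comp {1..d j} w' f) (mp n n w' x))"
      by (rule sum.reindex_bij_betw[OF bij_comp_right[OF _ that(3)], of "\<lambda>u. c (j, comp {1..d j} u f) (mp n n u x)"]) simp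
    finally show ?thesis by (simp add: c'_def)
  qed
  have ex': "(\<Sum>j\<in>J. \<Sum>f\<in>Hom {1..d j} ?S. s (c' j f x) (mp (d j) n f (v j))) = x" if x: "x \<in> ob n" for x
  proof -
    \<comment> \<open>The expansion of \<open>w x\<close>, transported back by
      \<open>w\<inverse>\<close>, expands \<open>x\<close>; so the averaged coefficients expand it
      too.\<close>
    have inner: "(\<Sum>j\<in>J. \<Sum>f\<in>Hom {1..d j} ?S. s (c (j, comp {1..d j} w f) (mp n n w x)) (mp (d j) n f (v j))) = x"
      if w: "w \<in> ?W" for w
    proof -
      let ?wi = "ginv ?S w"
      have wi: "?wi \<in> ?W" "comp ?S ?wi w = gid ?S" using ginv[of ?S w] w by auto
      have li: "lin_map s (ob n) s (ob n) (mp n n ?wi)" by (rule mp_lin[OF wi(1)])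
      let ?y = "mp n n w x"
      have y: "?y \<in> ob n" by (rule mp_in[OF w x])
      have "x = mp n n ?wi ?y" using mp_comp[OF w wi(1) x] wi(2) mp_gid[OF x] by simp
      also have "\<dots> = mp n n ?wi (\<Sum>j\<in>J. \<Sum>f\<in>Hom {1..d j} ?S. s (c (j, f) ?y) (mp (d j) n f (v j)))"
        using ex[OF y] by simp
      also have "\<dots> = (\<Sum>j\<in>J. mp n n ?wi (\<Sum>f\<in>Hom {1..d j} ?S. s (c (j, f) ?y) (mp (d j) n f (v j))))"
        by (rule lin_map_sum[OF li V.module_axioms ob_subspace])
          (intro V.subspace_sum[OF ob_subspace] V.subspace_scale[OF ob_subspace] mp_in J(3))
      also have "\<dots> = (\<Sum>j\<in>J. \<Sum>f\<in>Hom {1..d j} ?S. s (c (j, f) ?y) (mp (d j) n (comp {1..d j} ?wi f) (v j)))"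
      proof (rule sum.cong[OF refl])
        fix j assume j: "j \<in> J"
        have "mp n n ?wi (\<Sum>f\<in>Hom {1..d j} ?S. s (c (j, f) ?y) (mp (d j) n f (v j))) =
            (\<Sum>f\<in>Hom {1..d j} ?S. mp n n ?wi (s (c (j, f) ?y) (mp (d j) n f (v j))))"
          by (rule lin_map_sum[OF li V.module_axioms ob_subspace])
            (intro V.subspace_scale[OF ob_subspace] mp_in J(3) j)
        also have "\<dots> = (\<Sum>f\<in>Hom {1..d j} ?S. s (c (j, f) ?y) (mp (d j) n (comp {1..d j} ?wi f) (v j)))"
          using lin_map_scale[OF li mp_in[OF _ J(3)[OF j]]] mp_comp[OF _ wi(1) J(3)[OF j]]
          by (intro sum.cong refl) simp
        finally show "mp n n ?wi (\<Sum>f\<in>Hom {1..d j} ?S. s (c (j, f) ?y) (mp (d j) n f (v j))) = \<dots>" .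
      qed
      also have "\<dots> = (\<Sum>j\<in>J. \<Sum>f\<in>Hom {1..d j} ?S.
          s (c (j, comp {1..d j} w f) ?y) (mp (d j) n (comp {1..d j} ?wi (comp {1..d j} w f)) (v j)))"
        by (intro sum.cong[OF refl] sum.reindex_bij_betw[OF bij_comp_left[OF _ w], symmetric]) simp
      also have "\<dots> = (\<Sum>j\<in>J. \<Sum>f\<in>Hom {1..d j} ?S. s (c (j, comp {1..d j} w f) ?y) (mp (d j) n f (v j)))"
        using comp_ginv_cancel(1)[of ?S, OF _ w] by (intro sum.cong refl) simp
      finally show ?thesis by simp
    qed
    have "(\<Sum>j\<in>J. \<Sum>f\<in>Hom {1..d j} ?S. s (c' j f x) (mp (d j) n f (v j))) =
      s k (\<Sum>j\<in>J. \<Sum>f\<in>Hom {1..d j} ?S. \<Sum>w\<in>?W. s (c (j, comp {1..d j} w f) (mp n n w x)) (mp (d j) n f (v j)))"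
      by (simp add: c'_def V.scale_sum_right V.scale_sum_left sum_distrib_left)
    also have "\<dots> = s k (\<Sum>w\<in>?W. \<Sum>j\<in>J. \<Sum>f\<in>Hom {1..d j} ?S. s (c (j, comp {1..d j} w f) (mp n n w x)) (mp (d j) n f (v j)))"
      unfolding sum.swap[of _ _ ?W] ..
    also have "\<dots> = s k (s (of_nat (card ?W)) x)"
      using inner by (simp add: V.sum_constant_scale)
    also have "\<dots> = x" unfolding V.scale_scale k by simp
    finally show ?thesis .
  qed
  have fr': "frame s (ob n) ?I (\<lambda>(j, f). c' j f) (\<lambda>(j, f). mp (d j) n f (v j))"
    unfolding frame_def
  proof (intro conjI ballI finI)
    fix p assume "p \<in> ?I"
    then obtain j f where p: "p = (j, f)" "j \<in> J" "f \<in> Hom {1..d j} ?S" by blast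
    show "(case p of (j, f) \<Rightarrow> mp (d j) n f (v j)) \<in> ob n"
      unfolding p(1) prod.case by (rule mp_in[OF p(3) J(3)[OF p(2)]])
    show "lin_map s (ob n) (*) UNIV ((\<lambda>(j, f). c' j f) p)"
      unfolding p(1) prod.case by (rule c'l[OF p(2,3)])
  next
    fix x assume "x \<in> ob n"
    then show "(\<Sum>p\<in>?I. s ((\<lambda>(j, f). c' j f) p x) (case p of (j, f) \<Rightarrow> mp (d j) n f (v j))) = x"
      using ex'[of x] J(1) finite_Hom by (simp add: sum.Sigma case_prod_beta)
  qed
  show ?thesis
  proof (rule in_cnt_span_cong)
    show "in_cnt_span e ?S (\<lambda>g. \<Sum>j\<in>J. \<Sum>f\<in>Hom {1..d j} ?S. c' j f (mp (d j) n (comp {1..d j} g f) (v j)))"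
    proof (rule in_cnt_span_sum)
      fix j assume j: "j \<in> J"
      show "in_cnt_span e ?S (\<lambda>g. \<Sum>f\<in>Hom {1..d j} ?S. c' j f (mp (d j) n (comp {1..d j} g f) (v j)))"
      proof (cases "d j \<le> n")
        case True
        show ?thesis
        proof (rule invariant_kernel_in_span)
          fix w f f' assume w: "w \<in> ?W" "f \<in> Hom {1..d j} ?S" "f' \<in> Hom {1..d j} ?S"
          show "c' j (comp {1..d j} w f) (mp (d j) n (comp {1..d j} w f') (v j)) = c' j f (mp (d j) n f' (v j))"
            using c'inv[OF j w(2,1) mp_in[OF w(3) J(3)[OF j]]] mp_comp[OF w(3,1) J(3)[OF j]] by simp
        qed (use True J(2)[OF j] in auto)
      next
        case False
        \<comment> \<open>For \<open>d j > n\<close> there is no injection, and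
          \<open>invariant_kernel_in_span\<close> does not apply since \<open>[d j]\<close> is not a
          subset of \<open>[n]\<close>.\<close>
        have "Hom {1..d j} ?S = {}"
        proof (rule equals0I)
          fix f assume f: "f \<in> Hom {1..d j} ?S"
          have "card {1..d j} \<le> card ?S"
            by (rule card_inj_on_le[OF HomD(3)[OF f]]) (use HomD(1)[OF f] in auto)
          then show False using False by simp
        qed
        then show ?thesis by (simp only: sum.empty in_cnt_span_zero)
      qed
    qed
    fix g assume g: "g \<in> ?W"
    have "trace_on s (ob n) (mp n n g) = (\<Sum>(j, f)\<in>?I. c' j f (mp n n g (mp (d j) n f (v j))))"
      using trace_frame[OF V.vector_space_axioms ob_subspace fr' mp_lin[OF g]] by (simp add: case_prod_beta)
    also have "\<dots> = (\<Sum>j\<in>J. \<Sum>f\<in>Hom {1..d j} ?S. c' j f (mp n n g (mp (d j) n f (v j))))"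
      using J(1) finite_Hom by (subst sum.Sigma) auto
    also have "\<dots> = (\<Sum>j\<in>J. \<Sum>f\<in>Hom {1..d j} ?S. c' j f (mp (d j) n (comp {1..d j} g f) (v j)))"
      using mp_comp[OF _ g J(3)] by (intro sum.cong refl) simp
    finally show "trace_on s (ob n) (mp n n g) = \<dots>" .
  qed
qed

end


section \<open>Averaged characters\<close>

context finite_group
begin

definition mean :: "nat \<Rightarrow> nat \<Rightarrow> ('g gmap \<Rightarrow> 'k::field_char_0) \<Rightarrow> 'g gmap \<Rightarrow> 'k" where
  "mean a n F h = inverse (of_nat (card (stab {1..a} {1..n}))) * (\<Sum>w\<in>cst a n h. F w)"

lemma stab_card_inverse:
  assumes "a \<le> n"
  shows "inverse (of_nat (card (stab {1..a} {1..n}))) * of_nat (card (stab {1..a} {1..n})) = (1 :: 'k::field_char_0)"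
  using card_stab_pos[of "{1..n}" "{1..a}"] assms by simp

end

section \<open>Averaging operators and the maps between invariants\<close>

context fig_mod
begin

text \<open>For \<open>a \<le> n\<close> and \<open>h\<close> the identity of \<open>[a]\<close>
  this is the projection onto the invariants of the stabilizer of \<open>[a]\<close>; for other
  \<open>h\<close> in \<open>W_a\<close> it is that projection followed by the action of
  \<open>h\<close>.\<close>

definition avg :: "nat \<Rightarrow> nat \<Rightarrow> 'g gmap \<Rightarrow> 'v \<Rightarrow> 'v" where
  "avg a n h x = s (inverse (of_nat (card (stab {1..a} {1..n})))) (\<Sum>w\<in>cst a n h. mp n n w x)"

text \<open>Under the identification of invariants with coinvariants of the stabilizer of \<open>[a]\<close>,
  this is the map induced by the inclusion of \<open>[n]\<close> into \<open>[n+1]\<close>.\<close>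

definition up :: "nat \<Rightarrow> nat \<Rightarrow> 'v \<Rightarrow> 'v" where
  "up a n x = avg a (Suc n) (gid {1..a}) (mp n (Suc n) (gid {1..n}) x)"

lemma cst_Wr: "w \<in> cst a n h \<Longrightarrow> w \<in> Wr n"
  by (simp add: cst_def)

lemma sum_mp_in: "x \<in> ob n \<Longrightarrow> (\<Sum>w\<in>cst a n h. mp n n w x) \<in> ob n"
  by (intro V.subspace_sum[OF ob_subspace] mp_in cst_Wr)

lemma avg_lin: "lin_map s (ob n) s (ob n) (avg a n h)"
  unfolding avg_def
  by (intro lin_map_scale_fun lin_map_sum_fun V.module_axioms ob_subspace mp_lin cst_Wr)

lemma avg_in: "x \<in> ob n \<Longrightarrow> avg a n h x \<in> ob n"
  by (rule lin_map_in[OF avg_lin])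

lemma avg_natural:
  assumes f: "lin_map s (ob n) s (ob n') f" and x: "x \<in> ob n"
  shows "f (avg a n h x) = s (inverse (of_nat (card (stab {1..a} {1..n})))) (\<Sum>w\<in>cst a n h. f (mp n n w x))"
  unfolding avg_def lin_map_scale[OF f sum_mp_in[OF x]]
  by (subst lin_map_sum[OF f V.module_axioms ob_subspace]) (intro mp_in cst_Wr x, assumption, rule refl)

lemma avg_const:
  assumes a: "a \<le> n" "h \<in> Wr a" and f: "lin_map s (ob n) s (ob n') f" and x: "x \<in> ob n"
    and eq: "\<And>w. w \<in> cst a n h \<Longrightarrow> f (mp n n w x) = y"
  shows "f (avg a n h x) = y"
proof -
  have "f (avg a n h x) = s (inverse (of_nat (card (stab {1..a} {1..n})))) (\<Sum>w\<in>cst a n h. y)"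
    unfolding avg_natural[OF f x] using eq by simp
  also have "\<dots> = s (inverse (of_nat (card (stab {1..a} {1..n}))) * of_nat (card (stab {1..a} {1..n}))) y"
    by (simp add: V.sum_constant_scale card_cst[OF a, simplified])
  finally show ?thesis unfolding stab_card_inverse[OF a(1)] by simp
qed

text \<open>Multiplication by \<open>w\<close> permutes the cosets, by \<open>bij_cst\<close>.
  Averaging over the coset of \<open>h'\<close> then yields \<open>avg_avg\<close>, which makes
  \<open>avg\<close> a representation of \<open>W_a\<close> on the invariants.\<close>

lemma avg_pre:
  assumes "a \<le> n" "h \<in> Wr a" "h' \<in> Wr a" "w \<in> cst a n h'" "x \<in> ob n"
  shows "avg a n h (mp n n w x) = avg a n (comp {1..a} h h') x"
proof -
  have "(\<Sum>w'\<in>cst a n h. mp n n w' (mp n n w x)) = (\<Sum>w'\<in>cst a n h. mp n n (comp {1..n} w' w) x)"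
    by (intro sum.cong refl mp_comp[OF cst_Wr[OF assms(4)] cst_Wr assms(5), symmetric])
  also have "\<dots> = (\<Sum>w'\<in>cst a n (comp {1..a} h h'). mp n n w' x)"
    by (rule sum.reindex_bij_betw[OF bij_cst(2)[OF assms(1,3,2,4)]])
  finally show ?thesis by (simp add: avg_def)
qed

lemma avg_post:
  assumes "a \<le> n" "h \<in> Wr a" "h' \<in> Wr a" "w \<in> cst a n h'" "x \<in> ob n"
  shows "mp n n w (avg a n h x) = avg a n (comp {1..a} h' h) x"
proof -
  have "(\<Sum>w'\<in>cst a n h. mp n n w (mp n n w' x)) = (\<Sum>w'\<in>cst a n h. mp n n (comp {1..n} w w') x)"
    by (intro sum.cong refl mp_comp[OF cst_Wr cst_Wr[OF assms(4)] assms(5), symmetric])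
  also have "\<dots> = (\<Sum>w'\<in>cst a n (comp {1..a} h' h). mp n n w' x)"
    by (rule sum.reindex_bij_betw[OF bij_cst(1)[OF assms(1,3,2,4)]])
  finally show ?thesis
    unfolding avg_natural[OF mp_lin[OF cst_Wr[OF assms(4)]] assms(5)] by (simp add: avg_def)
qed

lemma avg_avg:
  assumes "a \<le> n" "h \<in> Wr a" "h' \<in> Wr a" "x \<in> ob n"
  shows "avg a n h (avg a n h' x) = avg a n (comp {1..a} h h') x"
  by (rule avg_const[OF assms(1,3) avg_lin assms(4) avg_pre[OF assms(1-3) _ assms(4)]])

lemma gid_Wr: "gid {1..a} \<in> Wr a"
  by (rule gid_in_Hom) simp

lemma avg_unit:
  assumes "a \<le> n" "h \<in> Wr a" "x \<in> ob n"
  shows "avg a n h (avg a n (gid {1..a}) x) = avg a n h x" "avg a n (gid {1..a}) (avg a n h x) = avg a n h x"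
  using avg_avg[OF assms(1,2) gid_Wr assms(3)] avg_avg[OF assms(1) gid_Wr assms(2,3)]
    comp_gid_left[OF assms(2)] comp_gid_right[OF assms(2)] by simp_all

lemma incl_Hom: "gid {1..n} \<in> Hom {1..n} {1..Suc n}"
  by (rule gid_in_Hom) simp

lemma up_lin: "lin_map s (ob n) s (ob (Suc n)) (up a n)"
  unfolding up_def by (rule lin_map_compose[OF mp_lin[OF incl_Hom] avg_lin])

lemma up_in: "x \<in> ob n \<Longrightarrow> up a n x \<in> ob (Suc n)"
  by (rule lin_map_in[OF up_lin])

text \<open>An automorphism of \<open>[n]\<close> is the restriction of one of \<open>[n+1]\<close>,
  which has the same values on \<open>[a]\<close>; this makes \<open>up\<close> compatible with the
  averages on both levels.\<close>

lemma extend_Suc: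
  assumes "a \<le> n" "h \<in> Wr a" "w \<in> cst a n h"
  shows "\<exists>w'\<in>cst a (Suc n) h. comp {1..n} w' (gid {1..n}) = comp {1..n} (gid {1..n}) w"
proof -
  have w: "w \<in> Wr n" "comp {1..a} w (gid {1..a}) = h" using assms by (auto simp: cst_def)
  have wS: "w \<in> Hom {1..n} {1..Suc n}" by (rule Wr_le[OF _ w(1)]) simp
  obtain w' where w': "w' \<in> Wr (Suc n)" "comp {1..n} w' (gid {1..n}) = w"
    by (rule Hom_extend[OF _ _ wS]) auto
  have an: "gid {1..a} \<in> Hom {1..a} {1..n}" by (rule gid_le[OF assms(1)])
  have "comp {1..a} w' (gid {1..a}) = comp {1..a} w' (comp {1..a} (gid {1..n}) (gid {1..a}))"
    by (simp only: comp_gid_left[OF an])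
  also have "\<dots> = comp {1..a} w (gid {1..a})"
    unfolding comp_assoc[OF an incl_Hom w'(1), symmetric] w'(2) ..
  finally have "w' \<in> cst a (Suc n) h" using w w' by (simp add: cst_def)
  then show ?thesis using w'(2) comp_gid_left[OF w(1)] by (intro bexI[of _ w']) simp_all
qed

text \<open>After inclusion into \<open>[n+1]\<close> each \<open>w\<close> of the coset is replaced
  by an extension \<open>w'\<close>, which the average on the next level absorbs.\<close>

lemma up_avg:
  assumes "a \<le> n" "h \<in> Wr a" "x \<in> ob n"
  shows "up a n (avg a n h x) = avg a (Suc n) h (up a n x)"
proof -
  let ?x = "mp n (Suc n) (gid {1..n}) x"
  have x: "?x \<in> ob (Suc n)" by (rule mp_in[OF incl_Hom assms(3)])
  have aS: "a \<le> Suc n" using assms(1) by simp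
  have "up a n (avg a n h x) = avg a (Suc n) h ?x"
  proof (rule avg_const[OF assms(1,2) up_lin assms(3)])
    fix w assume w: "w \<in> cst a n h"
    obtain w' where w': "w' \<in> cst a (Suc n) h" "comp {1..n} w' (gid {1..n}) = comp {1..n} (gid {1..n}) w"
      using extend_Suc[OF assms(1,2) w] by blast
    have "up a n (mp n n w x) = avg a (Suc n) (gid {1..a}) (mp (Suc n) (Suc n) w' ?x)"
      using mp_comp[OF incl_Hom cst_Wr[OF w'(1)] assms(3)] mp_comp[OF cst_Wr[OF w] incl_Hom assms(3)]
      by (simp only: up_def w'(2))
    also have "\<dots> = avg a (Suc n) h ?x"
      unfolding avg_pre[OF aS gid_Wr assms(2) w'(1) x] comp_gid_left[OF assms(2)] ..
    finally show "up a n (mp n n w x) = avg a (Suc n) h ?x" .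
  qed
  also have "\<dots> = avg a (Suc n) h (up a n x)"
    unfolding up_def by (rule avg_unit(1)[OF aS assms(2) x, symmetric])
  finally show ?thesis .
qed

text \<open>The averaged trace is the trace of \<open>h\<close>, composed with \<open>R\<close>, on
  the invariants of the stabilizer. By \<open>inj\<close> and \<open>surj\<close> the map
  \<open>up\<close> is an isomorphism between the invariants at \<open>n\<close> and at
  \<open>n+1\<close>, and it commutes with both, so the traces agree. The natural family
  \<open>R\<close> is the identity for characters and right multiplication on \<open>M(d)\<close>
  for the counts \<open>cnt\<close>.\<close>

lemma mean_trace_Suc:
  assumes fd: "fin_dim s (ob n)" "fin_dim s (ob (Suc n))" and a: "a \<le> n" and h: "h \<in> Wr a"
    and Rl: "\<And>n. lin_map s (ob n) s (ob n) (R n)"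
    and Rn: "\<And>m n f x. f \<in> Hom {1..m} {1..n} \<Longrightarrow> x \<in> ob m \<Longrightarrow> R n (mp m n f x) = mp m n f (R m x)"
    and inj: "\<And>x. x \<in> ob n \<Longrightarrow> avg a n (gid {1..a}) x = x \<Longrightarrow> up a n x = 0 \<Longrightarrow> x = 0"
    and surj: "\<And>y. y \<in> ob (Suc n) \<Longrightarrow> \<exists>x\<in>ob n. up a n x = avg a (Suc n) (gid {1..a}) y"
  shows "mean a n (\<lambda>w. trace_on s (ob n) (\<lambda>x. mp n n w (R n x))) h =
    mean a (Suc n) (\<lambda>w. trace_on s (ob (Suc n)) (\<lambda>x. mp (Suc n) (Suc n) w (R (Suc n) x))) h"
proof -
  have aS: "a \<le> Suc n" using a by simp
  let ?e = "avg a n (gid {1..a})" and ?e' = "avg a (Suc n) (gid {1..a})"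
  have Rin: "R n x \<in> ob n" if "x \<in> ob n" for n x by (rule lin_map_in[OF Rl that])
  have mean: "mean a n (\<lambda>w. trace_on s (ob n) (\<lambda>x. mp n n w (R n x))) h = trace_on s (ob n) (\<lambda>x. avg a n h (R n x))"
    if fd: "fin_dim s (ob n)" for n
  proof -
    have l: "lin_map s (ob n) s (ob n) (\<lambda>x. mp n n w (R n x))" if "w \<in> cst a n h" for w
      by (rule lin_map_compose[OF Rl mp_lin[OF cst_Wr[OF that]]])
    have 1: "trace_on s (ob n) (\<lambda>x. avg a n h (R n x)) = inverse (of_nat (card (stab {1..a} {1..n}))) *
        trace_on s (ob n) (\<lambda>x. \<Sum>w\<in>cst a n h. mp n n w (R n x))"
      unfolding avg_def
      by (rule trace_scale[OF fd lin_map_sum_fun[OF V.module_axioms ob_subspace l]])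
    have 2: "trace_on s (ob n) (\<lambda>x. \<Sum>w\<in>cst a n h. mp n n w (R n x)) =
        (\<Sum>w\<in>cst a n h. trace_on s (ob n) (\<lambda>x. mp n n w (R n x)))"
      by (rule trace_sum[OF fd l])
    show ?thesis unfolding mean_def 1 2 ..
  qed
  have Ravg: "R n (avg a n h x) = avg a n h (R n x)" if "x \<in> ob n" for n h x
    unfolding avg_natural[OF Rl that] unfolding avg_def
    by (intro arg_cong[where f = "s _"] sum.cong refl Rn cst_Wr that)
  have Rup: "R (Suc n) (up a n x) = up a n (R n x)" if "x \<in> ob n" for x
    unfolding up_def Ravg[OF mp_in[OF incl_Hom that]] Rn[OF incl_Hom that] ..
  have ex: "\<exists>x. x \<in> ob n \<and> ?e x = x \<and> up a n x = ?e' y" if y: "y \<in> ob (Suc n)" for y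
  proof -
    obtain x where x: "x \<in> ob n" "up a n x = ?e' y" using surj[OF y] by blast
    have "up a n (?e x) = ?e' y"
      unfolding up_avg[OF a gid_Wr x(1)] x(2) by (rule avg_unit(1)[OF aS gid_Wr y])
    then show ?thesis
      using avg_in[OF x(1)] avg_unit(1)[OF a gid_Wr x(1)] by blast
  qed
  \<comment> \<open>The inverse of \<open>up\<close> on invariants, applied to the projection of
    \<open>y\<close>.\<close>
  define r where "r y = (SOME x. x \<in> ob n \<and> ?e x = x \<and> up a n x = ?e' y)" for y
  have r: "r y \<in> ob n" "?e (r y) = r y" "up a n (r y) = ?e' y" if "y \<in> ob (Suc n)" for y
    using someI_ex[OF ex[OF that]] by (auto simp: r_def)
  have uniq: "x = x'" if "x \<in> ob n" "?e x = x" "x' \<in> ob n" "?e x' = x'" "up a n x = up a n x'" for x x'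
  proof -
    have "x - x' = 0"
    proof (rule inj)
      show "x - x' \<in> ob n" by (rule V.subspace_diff[OF ob_subspace that(1,3)])
      show "?e (x - x') = x - x'"
        using lin_map_minus[OF avg_lin V.module_axioms ob_subspace that(1,3)] that by simp
      show "up a n (x - x') = 0"
        using lin_map_minus[OF up_lin V.module_axioms ob_subspace that(1,3)] that by simp
    qed
    then show ?thesis by simp
  qed
  have rl: "lin_map s (ob (Suc n)) s (ob n) r"
  proof (rule lin_mapI)
    fix x y assume xy: "x \<in> ob (Suc n)" "y \<in> ob (Suc n)"
    note sum = V.subspace_add[OF ob_subspace xy]
    show "r (x + y) = r x + r y"
    proof (rule uniq)
      show "?e (r x + r y) = r x + r y"
        using lin_map_add[OF avg_lin r(1)[OF xy(1)] r(1)[OF xy(2)]] r(2) xy by simp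
      show "up a n (r (x + y)) = up a n (r x + r y)"
        using lin_map_add[OF up_lin r(1)[OF xy(1)] r(1)[OF xy(2)]] r(3) xy sum lin_map_add[OF avg_lin xy] by simp
    qed (use r xy sum V.subspace_add[OF ob_subspace] in auto)
  next
    fix c x assume x: "x \<in> ob (Suc n)"
    note sc = V.subspace_scale[OF ob_subspace x]
    show "r (s c x) = s c (r x)"
    proof (rule uniq)
      show "?e (s c (r x)) = s c (r x)"
        using lin_map_scale[OF avg_lin r(1)[OF x]] r(2) x by simp
      show "up a n (r (s c x)) = up a n (s c (r x))"
        using lin_map_scale[OF up_lin r(1)[OF x]] r(3) x sc lin_map_scale[OF avg_lin x] by simp
    qed (use r x sc V.subspace_scale[OF ob_subspace] in auto)
  qed (rule r)
  have rup: "r (up a n x) = ?e x" if x: "x \<in> ob n" for x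
  proof (rule uniq)
    note ux = up_in[OF x, of a]
    show "r (up a n x) \<in> ob n" "?e (r (up a n x)) = r (up a n x)" using r ux by auto
    show "?e x \<in> ob n" "?e (?e x) = ?e x" using avg_in[OF x] avg_unit(1)[OF a gid_Wr x] by auto
    show "up a n (r (up a n x)) = up a n (?e x)" using r(3)[OF ux] up_avg[OF a gid_Wr x] by simp
  qed
  \<comment> \<open>\<open>?f\<close> after \<open>up\<close> and \<open>up\<close> after
    \<open>?f\<close> are the two averaged endomorphisms, so \<open>trace_commute\<close> compares
    their traces without bases of the invariants.\<close>
  let ?f = "\<lambda>y. avg a n h (R n (r y))"
  have fl: "lin_map s (ob (Suc n)) s (ob n) ?f"
    by (rule lin_map_compose[OF lin_map_compose[OF rl Rl] avg_lin])
  have "trace_on s (ob n) (\<lambda>x. avg a n h (R n x)) = trace_on s (ob n) (\<lambda>x. ?f (up a n x))"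
  proof (rule trace_cong[OF fd(1) lin_map_compose[OF Rl avg_lin]])
    fix x assume x: "x \<in> ob n"
    have "?f (up a n x) = avg a n h (?e (R n x))" unfolding rup[OF x] Ravg[OF x] ..
    also have "\<dots> = avg a n h (R n x)" by (rule avg_unit(1)[OF a h Rin[OF x]])
    finally show "avg a n h (R n x) = ?f (up a n x)" by simp
  qed
  also have "\<dots> = trace_on s (ob (Suc n)) (\<lambda>y. up a n (?f y))"
    by (rule trace_commute[OF fd up_lin fl])
  also have "\<dots> = trace_on s (ob (Suc n)) (\<lambda>y. avg a (Suc n) h (R (Suc n) y))"
  proof (rule trace_cong[OF fd(2) lin_map_compose[OF fl up_lin]])
    fix y assume y: "y \<in> ob (Suc n)"
    have "up a n (?f y) = avg a (Suc n) h (R (Suc n) (up a n (r y)))"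
      unfolding up_avg[OF a h Rin[OF r(1)[OF y]]] Rup[OF r(1)[OF y]] ..
    also have "\<dots> = avg a (Suc n) h (?e' (R (Suc n) y))"
      unfolding r(3)[OF y] Ravg[OF y] ..
    also have "\<dots> = avg a (Suc n) h (R (Suc n) y)" by (rule avg_unit(1)[OF aS h Rin[OF y]])
    finally show "up a n (?f y) = avg a (Suc n) h (R (Suc n) y)" .
  qed
  finally show ?thesis unfolding mean[OF fd(1)] mean[OF fd(2)] .
qed

text \<open>A map from a set of at most \<open>e\<close> points can be moved off the new point by an element
  fixing \<open>[a]\<close> as soon as \<open>n \<ge> a + e\<close>.\<close>

lemma up_surj:
  assumes gen: "generated e J d v" and n: "a + e \<le> n" and y: "y \<in> ob (Suc n)"
  shows "\<exists>x\<in>ob n. up a n x = avg a (Suc n) (gid {1..a}) y"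
proof -
  let ?S = "{1..Suc n}" and ?e = "avg a (Suc n) (gid {1..a})"
  have an: "a \<le> n" and aS: "a \<le> Suc n" using n by auto
  have sp: "V.span ((\<lambda>(j, f). mp (d j) (Suc n) f (v j)) ` (SIGMA j:J. Hom {1..d j} ?S)) = ob (Suc n)"
    and J: "\<And>j. j \<in> J \<Longrightarrow> d j \<le> e" "\<And>j. j \<in> J \<Longrightarrow> v j \<in> ob (d j)"
    using gen by (auto simp: generated_def)
  have base: "\<exists>x\<in>ob n. up a n x = ?e (mp (d j) (Suc n) f (v j))" if j: "j \<in> J" and f: "f \<in> Hom {1..d j} ?S" for j f
  proof -
    have "\<exists>w\<in>stab {1..a} ?S. comp {1..d j} w f \<in> Hom {1..d j} {1..n}"
    proof (cases "Suc n \<in> fst f ` {1..d j}")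
      case False
      have "f \<in> Hom {1..d j} {1..n}"
        by (rule Hom_restrict_target[OF f]) (use HomD(1)[OF f] False in force)
      then show ?thesis
        using gid_in_stab[of "{1..a}" ?S] aS comp_gid_left[OF f] by (intro bexI[of _ "gid ?S"]) simp_all
    next
      case True
      \<comment> \<open>Here \<open>Suc n\<close> is itself a value of \<open>f\<close>, so at most
        \<open>e - 1\<close> values lie in \<open>[n]\<close>; together with \<open>[a]\<close> they
        leave a point of \<open>[n]\<close> free.\<close>
      have "card ({1..a} \<union> (fst f ` {1..d j} - {Suc n})) < card {1..n}"
      proof -
        have "card (fst f ` {1..d j} - {Suc n}) < card (fst f ` {1..d j})"
          by (rule card_Diff1_less[OF _ True]) simp
        also have "\<dots> \<le> e" using card_image_le[of "{1..d j}" "fst f"] J(1)[OF j] by simp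
        finally have "card {1..a} + card (fst f ` {1..d j} - {Suc n}) < n" using n by simp
        then show ?thesis using card_Un_le[of "{1..a}" "fst f ` {1..d j} - {Suc n}"] by simp
      qed
      then have "\<not> {1..n} \<subseteq> {1..a} \<union> (fst f ` {1..d j} - {Suc n})"
        by (meson card_mono finite_Diff finite_Un finite_atLeastAtMost finite_imageI leD)
      then obtain y0 where y0': "y0 \<in> {1..n}" "y0 \<notin> {1..a}" "y0 \<notin> fst f ` {1..d j} - {Suc n}" by blast
      then have y0: "y0 \<in> {1..n}" "y0 \<notin> {1..a}" "y0 \<notin> fst f ` {1..d j}" by auto
      have mv: "{1..a} \<subseteq> ?S" "Suc n \<in> ?S - {1..a}" "y0 \<in> ?S - {1..a}" using an y0 by auto
      obtain \<tau> where \<tau>: "\<tau> \<in> Hom ?S ?S" "comp {1..a} \<tau> (gid {1..a}) = gid {1..a}" "fst \<tau> (Suc n) = y0"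
        "\<And>i. i \<in> ?S \<Longrightarrow> i \<noteq> Suc n \<Longrightarrow> i \<noteq> y0 \<Longrightarrow> fst \<tau> i = i"
        by (rule Hom_move[OF mv one_closed]) (rule that)
      have "comp {1..d j} \<tau> f \<in> Hom {1..d j} {1..n}"
      proof (rule Hom_restrict_target[OF comp_in_Hom[OF f \<tau>(1)]])
        fix i assume i: "i \<in> {1..d j}"
        have fi: "fst f i \<in> ?S" "fst f i \<noteq> y0" using HomD(1)[OF f i] y0(3) i by auto
        show "fst (comp {1..d j} \<tau> f) i \<in> {1..n}"
        proof (cases "fst f i = Suc n")
          case True
          then show ?thesis using \<tau>(3) y0(1) fst_comp[OF i, of \<tau> f] by simp
        next
          case False
          then show ?thesis using \<tau>(4)[OF fi(1) False fi(2)] fi(1) fst_comp[OF i, of \<tau> f] by auto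
        qed
      qed
      then show ?thesis using \<tau>(1,2) by (intro bexI[of _ \<tau>]) (simp_all add: stab_def)
    qed
    then obtain w where w: "w \<in> stab {1..a} ?S" "comp {1..d j} w f \<in> Hom {1..d j} {1..n}" by blast
    let ?f = "comp {1..d j} w f"
    have wc: "w \<in> cst a (Suc n) (gid {1..a})" using w(1) unfolding cst_gid .
    have fv: "mp (d j) (Suc n) f (v j) \<in> ob (Suc n)" by (rule mp_in[OF f J(2)[OF j]])
    have "up a n (mp (d j) n ?f (v j)) = ?e (mp (d j) (Suc n) ?f (v j))"
      unfolding up_def mp_comp[OF w(2) incl_Hom J(2)[OF j], symmetric] comp_gid_left[OF w(2)] ..
    also have "\<dots> = ?e (mp (Suc n) (Suc n) w (mp (d j) (Suc n) f (v j)))"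
      unfolding mp_comp[OF f cst_Wr[OF wc] J(2)[OF j]] ..
    also have "\<dots> = ?e (mp (d j) (Suc n) f (v j))"
      unfolding avg_pre[OF aS gid_Wr gid_Wr wc fv] comp_gid_left[OF gid_Wr] ..
    finally show ?thesis using mp_in[OF w(2) J(2)[OF j]] by blast
  qed
  have "y \<in> V.span ((\<lambda>(j, f). mp (d j) (Suc n) f (v j)) ` (SIGMA j:J. Hom {1..d j} ?S))"
    using y sp by simp
  then have "y \<in> ob (Suc n) \<and> (\<exists>x\<in>ob n. up a n x = ?e y)"
  proof (induction rule: V.span_induct_alt)
    case base
    have z: "0 \<in> ob n" "0 \<in> ob (Suc n)" using V.subspace_0[OF ob_subspace] by auto
    have "up a n 0 = ?e 0"
      using lin_map_zero[OF up_lin V.module_axioms ob_subspace] lin_map_zero[OF avg_lin V.module_axioms ob_subspace] by simp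
    with z show ?case by blast
  next
    case (step c p q)
    obtain j f where p: "p = mp (d j) (Suc n) f (v j)" "j \<in> J" "f \<in> Hom {1..d j} ?S"
      using step(1) by (elim imageE SigmaE) simp
    have pS: "p \<in> ob (Suc n)" unfolding p(1) by (rule mp_in[OF p(3) J(2)[OF p(2)]])
    obtain x where x: "x \<in> ob n" "up a n x = ?e p" using base[OF p(2,3)] p(1) by blast
    obtain x' where x': "x' \<in> ob n" "up a n x' = ?e q" and qS: "q \<in> ob (Suc n)" using step(2) by blast
    note cx = V.subspace_scale[OF ob_subspace x(1), of c] and cp = V.subspace_scale[OF ob_subspace pS, of c]
    have "up a n (s c x + x') = ?e (s c p + q)"
      unfolding lin_map_add[OF up_lin cx x'(1)] lin_map_add[OF avg_lin cp qS]
        lin_map_scale[OF up_lin x(1)] lin_map_scale[OF avg_lin pS] x x' ..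
    then show ?case
      using V.subspace_add[OF ob_subspace cx x'(1)] V.subspace_add[OF ob_subspace cp qS] by blast
  qed
  then show ?thesis by blast
qed

end


section \<open>Functions on \<open>Hom([d],[n])\<close>\<close>

lemma lookup_pm_scale:
  assumes "module s"
  shows "Poly_Mapping.lookup (pm_scale s c x) i = s c (Poly_Mapping.lookup x i)"
proof -
  interpret module s by fact
  show ?thesis by (simp add: pm_scale_def Poly_Mapping.map.rep_eq when_def)
qed

lemma vector_space_pm_scale:
  assumes "vector_space (s :: 'k::field \<Rightarrow> 'v::ab_group_add \<Rightarrow> 'v)"
  shows "vector_space (pm_scale s :: 'k \<Rightarrow> ('i \<Rightarrow>\<^sub>0 'v) \<Rightarrow> _)"
proof -
  interpret vector_space s by fact
  show ?thesis
    by unfold_locales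
      (rule poly_mapping_eqI; simp add: lookup_pm_scale[OF module_axioms] lookup_add scale_right_distrib scale_left_distrib)+
qed

lemma keys_pm_scale: "module s \<Longrightarrow> Poly_Mapping.keys (pm_scale s c x) \<subseteq> Poly_Mapping.keys x"
  using lookup_pm_scale[of s c x] module.scale_zero_right[of s c] by (auto simp: in_keys_iff)

lemma lookup_push:
  assumes "finite A" "Poly_Mapping.keys x \<subseteq> A"
  shows "Poly_Mapping.lookup (push h x) f' = (\<Sum>f\<in>A. if h f = f' then Poly_Mapping.lookup x f else 0)"
proof -
  have "Poly_Mapping.lookup (push h x) f' =
      (\<Sum>f\<in>Poly_Mapping.keys x. if h f = f' then Poly_Mapping.lookup x f else 0)"
    by (simp add: push_def lookup_sum lookup_single when_def)
  also have "\<dots> = (\<Sum>f\<in>A. if h f = f' then Poly_Mapping.lookup x f else 0)"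
    using assms by (intro sum.mono_neutral_left) (auto simp: in_keys_iff)
  finally show ?thesis .
qed

lemma keys_push:
  assumes "Poly_Mapping.keys x \<subseteq> A" "h ` A \<subseteq> B"
  shows "Poly_Mapping.keys (push h x) \<subseteq> B"
proof
  fix f' assume "f' \<in> Poly_Mapping.keys (push h x)"
  then have "(\<Sum>f\<in>Poly_Mapping.keys x. if h f = f' then Poly_Mapping.lookup x f else 0) \<noteq> 0"
    by (simp add: in_keys_iff lookup_push[OF finite_keys subset_refl])
  then obtain f where "f \<in> Poly_Mapping.keys x" "h f = f'"
    by (elim sum.not_neutral_contains_not_neutral) (auto split: if_splits)
  then show "f' \<in> B" using assms by blast
qed

lemma push_add: "push h (x + y) = push h x + push h y"
proof (rule poly_mapping_eqI)
  fix k
  let ?A = "Poly_Mapping.keys x \<union> Poly_Mapping.keys y"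
  have "finite ?A" "Poly_Mapping.keys (x + y) \<subseteq> ?A" by (simp_all add: Poly_Mapping.keys_add)
  then show "Poly_Mapping.lookup (push h (x + y)) k = Poly_Mapping.lookup (push h x + push h y) k"
    by (simp add: lookup_push[of ?A] lookup_add sum.distrib[symmetric] if_distrib cong: if_cong)
qed

lemma push_pm_scale:
  assumes "module s"
  shows "push h (pm_scale s c x) = pm_scale s c (push h x)"
proof (rule poly_mapping_eqI)
  interpret module s by fact
  fix k
  show "Poly_Mapping.lookup (push h (pm_scale s c x)) k = Poly_Mapping.lookup (pm_scale s c (push h x)) k"
    by (simp add: lookup_push[of "Poly_Mapping.keys x"] keys_pm_scale[OF assms]
        lookup_pm_scale[OF assms] scale_sum_right if_distrib cong: if_cong)
qed

lemma push_single: "push h (Poly_Mapping.single f u) = Poly_Mapping.single (h f) u"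
  by (cases "u = 0") (simp_all add: push_def)

lemma push_cong:
  "(\<And>f. f \<in> Poly_Mapping.keys x \<Longrightarrow> h f = h' f) \<Longrightarrow> push h x = push h' x"
  unfolding push_def by (intro sum.cong) auto

lemma push_sum: "push h (\<Sum>i\<in>I. x i) = (\<Sum>i\<in>I. push h (x i))"
  by (induction I rule: infinite_finite_induct) (simp_all add: push_add push_def[of h 0])

lemma push_push: "push h (push h' x) = push (\<lambda>f. h (h' f)) x"
  unfolding push_def[of h' x] push_sum push_single by (simp add: push_def)

lemma push_id: "push (\<lambda>f. f) x = x"
  by (rule poly_mapping_eqI) (simp add: lookup_push[OF finite_keys subset_refl] in_keys_iff)

lemma lookup_push_inj:
  assumes "inj_on h A" "Poly_Mapping.keys x \<subseteq> A" "f \<in> A"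
  shows "Poly_Mapping.lookup (push h x) (h f) = Poly_Mapping.lookup x f"
proof -
  have "Poly_Mapping.lookup (push h x) (h f) =
      (\<Sum>f'\<in>Poly_Mapping.keys x. if f' = f then Poly_Mapping.lookup x f' else 0)"
    unfolding lookup_push[OF finite_keys subset_refl] using assms
    by (intro sum.cong) (auto dest: inj_onD)
  also have "\<dots> = Poly_Mapping.lookup x f" by (simp add: in_keys_iff)
  finally show ?thesis .
qed

text \<open>The coefficients are reduced to rational ones by the coordinate functionals of their
  \<open>\<rat>\<close>-span, and over \<open>\<rat>\<close> the standard inner product is definite.\<close>

lemma rational_span_nondegenerate:
  fixes q :: "'i \<Rightarrow> 'k::field_char_0" and u :: "'i \<Rightarrow> 'x \<Rightarrow> nat"
  assumes I: "finite I" and X: "finite X" and F: "\<And>x. x \<in> X \<Longrightarrow> F x = (\<Sum>p\<in>I. q p * of_nat (u p x))"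
    and orth: "\<And>p. p \<in> I \<Longrightarrow> (\<Sum>x\<in>X. F x * of_nat (u p x)) = 0"
    and x: "x \<in> X"
  shows "F x = 0"
proof -
  \<comment> \<open>The field \<open>'k\<close> as a vector space over the rationals.\<close>
  define s :: "rat \<Rightarrow> 'k \<Rightarrow> 'k" where "s r y = of_rat r * y" for r y
  interpret vector_space s
    by unfold_locales (auto simp: s_def of_rat_add of_rat_mult algebra_simps)
  let ?T = "span (q ` I)"
  have sub: "subspace ?T" by simp
  obtain c where fr: "frame s ?T I c q"
    using frame_of_spanning[OF vector_space_axioms I refl] by blast
  have c: "lin_map s ?T (*) UNIV (c p)" if "p \<in> I" for p using fr that by (simp add: frame_def)
  have qT: "q p \<in> ?T" if "p \<in> I" for p using that span_base by blast
  have Fs: "F x = (\<Sum>p\<in>I. s (of_nat (u p x)) (q p))" if "x \<in> X" for x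
    using F[OF that] by (simp add: s_def mult.commute)
  have FT: "F x \<in> ?T" if "x \<in> X" for x
    unfolding Fs[OF that] by (intro span_sum span_scale qT)
  \<comment> \<open>Each coordinate of \<open>F\<close> is a rational combination of the
    \<open>u p\<close> and still orthogonal to all of them, so the sum of its squares
    vanishes.\<close>
  have "c b (F x) = 0" if b: "b \<in> I" for b
  proof -
    have cF: "c b (F x) = (\<Sum>p\<in>I. of_nat (u p x) * c b (q p))" if "x \<in> X" for x
      unfolding Fs[OF that]
      by (subst lin_map_sum[OF c[OF b] module_axioms sub])
        (auto intro!: span_scale qT sum.cong simp: lin_map_scale[OF c[OF b] qT])
    have o: "(\<Sum>x\<in>X. of_nat (u p x) * c b (F x)) = 0" if p: "p \<in> I" for p
    proof -
      have "(\<Sum>x\<in>X. of_nat (u p x) * c b (F x)) = (\<Sum>x\<in>X. c b (s (of_nat (u p x)) (F x)))"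
        by (intro sum.cong refl) (simp add: lin_map_scale[OF c[OF b] FT])
      also have "\<dots> = c b (\<Sum>x\<in>X. s (of_nat (u p x)) (F x))"
        by (rule lin_map_sum[OF c[OF b] module_axioms sub, symmetric]) (intro span_scale FT)
      also have "(\<Sum>x\<in>X. s (of_nat (u p x)) (F x)) = 0"
        using orth[OF p] by (simp add: s_def mult.commute)
      also have "c b 0 = 0" by (rule lin_map_zero[OF c[OF b] module_axioms sub])
      finally show ?thesis .
    qed
    have "(\<Sum>x\<in>X. c b (F x) * c b (F x)) = (\<Sum>x\<in>X. \<Sum>p\<in>I. c b (q p) * (of_nat (u p x) * c b (F x)))"
    proof (rule sum.cong[OF refl])
      fix x assume "x \<in> X"
      then have "c b (F x) * z = (\<Sum>p\<in>I. c b (q p) * (of_nat (u p x) * z))" for z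
        by (simp add: cF sum_distrib_left sum_distrib_right mult_ac)
      then show "c b (F x) * c b (F x) = (\<Sum>p\<in>I. c b (q p) * (of_nat (u p x) * c b (F x)))" .
    qed
    also have "\<dots> = (\<Sum>p\<in>I. c b (q p) * (\<Sum>x\<in>X. of_nat (u p x) * c b (F x)))"
      by (subst sum.swap) (simp add: sum_distrib_left)
    also have "\<dots> = 0" using o by simp
    finally have "(\<Sum>x\<in>X. c b (F x) * c b (F x)) = 0" .
    then show ?thesis using X x by (subst (asm) sum_nonneg_eq_0_iff) auto
  qed
  moreover have "(\<Sum>b\<in>I. s (c b (F x)) (q b)) = F x" using fr FT[OF x] by (simp add: frame_def)
  ultimately show ?thesis by (simp add: s_def)
qed

context finite_group
begin

text \<open>On \<open>[a]\<close> and on the values of \<open>f\<close> the element \<open>w\<close>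
  stays inside \<open>[n]\<close>, so its restriction to these points extends to an automorphism of
  \<open>[n]\<close>.\<close>

lemma stab_restrict:
  assumes a: "a \<le> n" and f: "f \<in> Hom D {1..n}" and w: "w \<in> stab {1..a} {1..Suc n}"
    and wf: "comp D w f \<in> Hom D {1..n}"
  shows "\<exists>w'\<in>stab {1..a} {1..n}. comp D w' f = comp D w f"
proof -
  let ?B = "{1..a} \<union> fst f ` D"
  have wS: "w \<in> Wr (Suc n)" "comp {1..a} w (gid {1..a}) = gid {1..a}" using w unfolding stab_def by auto
  have B: "?B \<subseteq> {1..n}" "?B \<subseteq> {1..Suc n}" using a HomD(1)[OF f] by fastforce+
  let ?w = "comp ?B w (gid ?B)"
  have "?w \<in> Hom ?B {1..n}"
  proof (rule Hom_restrict_target[OF comp_in_Hom[OF gid_in_Hom[OF B(2)] wS(1)]])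
    fix i assume i: "i \<in> ?B"
    show "fst ?w i \<in> {1..n}"
      unfolding fst_res[OF i]
    proof (cases "i \<in> {1..a}")
      case True
      then have "fst w i = i" using wS(2) fst_res[OF True, of w] fst_gid[OF True] by simp
      then show "fst w i \<in> {1..n}" using i B by auto
    next
      case False
      then obtain j where j: "j \<in> D" "i = fst f j" using i by blast
      then show "fst w i \<in> {1..n}" using HomD(1)[OF wf j(1)] fst_comp[OF j(1), of w f] by simp
    qed
  qed
  then obtain w' where w': "w' \<in> Wr n" "comp ?B w' (gid ?B) = ?w"
    using Hom_extend[OF _ B(1)] by blast
  have same: "comp Q w' h = comp Q w h" if h: "h \<in> Hom Q ?B" for Q h
  proof -
    have "comp Q w' h = comp Q ?w h"
      using comp_assoc[OF h gid_in_Hom[OF B(1)] w'(1)] comp_gid_left[OF h] w'(2) by simp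
    also have "\<dots> = comp Q w h"
      using comp_assoc[OF h gid_in_Hom[OF B(2)] wS(1)] comp_gid_left[OF h] by simp
    finally show ?thesis .
  qed
  have "comp {1..a} w' (gid {1..a}) = gid {1..a}"
    using same[OF gid_in_Hom[of "{1..a}" ?B]] wS(2) by simp
  moreover have "comp D w' f = comp D w f"
    by (rule same, rule Hom_restrict_target[OF f]) simp
  ultimately show ?thesis using w'(1) by (intro bexI[of _ w']) (simp_all add: stab_def)
qed

text \<open>On functions on \<open>Hom([d],[n])\<close> the map induced on coinvariants by \<open>[n] \<subseteq> [n+1]\<close> is injective:
  two maps into \<open>[n]\<close> that are conjugate under the stabilizer of \<open>[a]\<close> in \<open>W_{n+1}\<close> are already
  conjugate under the stabilizer in \<open>W_n\<close>.\<close>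

lemma function_up_inj:
  fixes y :: "'g gmap \<Rightarrow>\<^sub>0 'u::ab_group_add" and t :: "'k::field_char_0 \<Rightarrow> 'u \<Rightarrow> 'u"
  assumes t: "vector_space t" and D: "finite D" and a: "a \<le> n" and y: "Poly_Mapping.keys y \<subseteq> Hom D {1..n}"
    and inv: "\<And>w. w \<in> stab {1..a} {1..n} \<Longrightarrow> push (comp D w) y = y"
    and zero: "(\<Sum>w\<in>stab {1..a} {1..Suc n}. push (comp D w) (push (comp D (gid {1..n})) y)) = 0"
  shows "y = 0"
proof (rule poly_mapping_eqI)
  interpret vector_space t by fact
  let ?N = "{1..n}" and ?M = "{1..Suc n}"
  fix f
  show "Poly_Mapping.lookup y f = Poly_Mapping.lookup 0 f"
  proof (cases "f \<in> Hom D ?N")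
    case False
    then show ?thesis using y by (auto simp: in_keys_iff)
  next
    case f: True
    have NM: "Hom D ?N \<subseteq> Hom D ?M" by (rule Hom_mono) auto
    have fM: "f \<in> Hom D ?M" using f NM by blast
    have aM: "{1..a} \<subseteq> ?M" using a by auto
    have "push (comp D (gid ?N)) y = push (\<lambda>f. f) y"
      using y comp_gid_left by (intro push_cong) blast
    then have "push (comp D (gid ?N)) y = y" by (simp only: push_id)
    then have "0 = Poly_Mapping.lookup (\<Sum>w\<in>stab {1..a} ?M. push (comp D w) y) f"
      using zero by simp
    \<comment> \<open>The summand for \<open>w\<close> at \<open>f\<close> is the value of
      \<open>y\<close> at \<open>w\<inverse> f\<close>. This is zero if that map leaves
      \<open>[n]\<close>, and otherwise equals the value at \<open>f\<close>, by invariance under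
      the element from \<open>stab_restrict\<close>.\<close>
    also have "\<dots> = (\<Sum>w\<in>stab {1..a} ?M. if comp D (ginv ?M w) f \<in> Hom D ?N then Poly_Mapping.lookup y f else 0)"
      unfolding lookup_sum
    proof (rule sum.cong[OF refl])
      fix w assume w: "w \<in> stab {1..a} ?M"
      then have wM: "w \<in> Hom ?M ?M" and wa: "comp {1..a} w (gid {1..a}) = gid {1..a}" by (auto simp: stab_def)
      let ?w = "ginv ?M w"
      have wi: "?w \<in> Hom ?M ?M" by (rule ginv(1)[OF _ wM]) simp
      have "comp {1..a} ?w (gid {1..a}) = gid {1..a}"
        using comp_ginv_cancel(1)[OF _ wM gid_in_Hom[OF aM]] wa by simp
      then have ws: "?w \<in> stab {1..a} ?M" using wi by (simp add: stab_def)
      have f': "comp D ?w f \<in> Hom D ?M" by (rule comp_in_Hom[OF fM wi])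
      have "Poly_Mapping.lookup (push (comp D w) y) f = Poly_Mapping.lookup (push (comp D w) y) (comp D w (comp D ?w f))"
        using comp_ginv_cancel(2)[OF _ wM fM] by simp
      also have "\<dots> = Poly_Mapping.lookup y (comp D ?w f)"
        by (rule lookup_push_inj[OF bij_betw_imp_inj_on[OF bij_comp_left[OF _ wM]] _ f']) (use y NM in auto)
      also have "\<dots> = (if comp D ?w f \<in> Hom D ?N then Poly_Mapping.lookup y f else 0)"
      proof (cases "comp D ?w f \<in> Hom D ?N")
        case True
        obtain w' where w': "w' \<in> stab {1..a} ?N" "comp D w' f = comp D ?w f"
          using stab_restrict[OF a f ws True] by blast
        have w'N: "w' \<in> Hom ?N ?N" using w'(1) by (simp add: stab_def)
        have "Poly_Mapping.lookup y (comp D w' f) = Poly_Mapping.lookup (push (comp D w') y) (comp D w' f)"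
          unfolding inv[OF w'(1)] ..
        also have "\<dots> = Poly_Mapping.lookup y f"
          by (rule lookup_push_inj[OF bij_betw_imp_inj_on[OF bij_comp_left[OF _ w'N]] y f]) simp
        finally show ?thesis using True w'(2) by simp
      next
        case False
        then show ?thesis using y by (auto simp: in_keys_iff)
      qed
      finally show "Poly_Mapping.lookup (push (comp D w) y) f = \<dots>" .
    qed
    also have "\<dots> = t (of_nat (card {w \<in> stab {1..a} ?M. comp D (ginv ?M w) f \<in> Hom D ?N})) (Poly_Mapping.lookup y f)"
      by (simp add: sum.If_cases[OF finite_stab] sum_constant_scale Int_def)
    finally have "t (of_nat (card {w \<in> stab {1..a} ?M. comp D (ginv ?M w) f \<in> Hom D ?N})) (Poly_Mapping.lookup y f) = 0"
      by simp
    \<comment> \<open>The identity is counted, so the value at \<open>f\<close> occurs with nonzero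
      multiplicity.\<close>
    moreover have "card {w \<in> stab {1..a} ?M. comp D (ginv ?M w) f \<in> Hom D ?N} \<noteq> 0"
    proof -
      have gM: "gid ?M \<in> Hom ?M ?M" by (rule gid_in_Hom) simp
      have "ginv ?M (gid ?M) = gid ?M"
        using ginv(2)[OF _ gM] comp_gid_right[OF ginv(1)[OF _ gM]] by simp
      then have mem: "gid ?M \<in> {w \<in> stab {1..a} ?M. comp D (ginv ?M w) f \<in> Hom D ?N}"
        using gid_in_stab[OF aM] comp_gid_left[OF fM] f by simp
      have fin: "finite {w \<in> stab {1..a} ?M. comp D (ginv ?M w) f \<in> Hom D ?N}"
        using finite_stab[of ?M] by simp
      show ?thesis
        unfolding card_0_eq[OF fin] using mem by (metis empty_iff)
    qed
    ultimately show ?thesis by simp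
  qed
qed

lemma fig_module_M: "fig_module G (pm_scale (*) :: 'k::field_char_0 \<Rightarrow> _) (fig_M G d)"
proof -
  let ?D = "{1..d}"
  let ?s = "pm_scale (*) :: 'k \<Rightarrow> ('g gmap \<Rightarrow>\<^sub>0 'k) \<Rightarrow> _"
  interpret vector_space ?s by (rule vector_space_pm_scale[OF vector_space_mult])
  have im: "comp ?D f ` Hom ?D S \<subseteq> Hom ?D T" if "f \<in> Hom S T" for f S T
    using comp_in_Hom that by blast
  show ?thesis
    unfolding fig_module_def fig_M_def fig_functor.simps
  proof (intro conjI allI impI ballI; (elim conjE)?)
    show "vector_space ?s" by (rule vector_space_axioms)
    show "subspace {x. Poly_Mapping.keys x \<subseteq> Hom ?D S}" for S
    proof (intro subspaceI CollectI)
      show "Poly_Mapping.keys (0 :: 'g gmap \<Rightarrow>\<^sub>0 'k) \<subseteq> Hom ?D S" by simp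
      fix x y :: "'g gmap \<Rightarrow>\<^sub>0 'k" and c :: 'k
      assume "x \<in> {x. Poly_Mapping.keys x \<subseteq> Hom ?D S}"
      then have x: "Poly_Mapping.keys x \<subseteq> Hom ?D S" by simp
      show "Poly_Mapping.keys (?s c x) \<subseteq> Hom ?D S"
        by (rule order_trans[OF keys_pm_scale[OF module_mult] x])
      assume "y \<in> {x. Poly_Mapping.keys x \<subseteq> Hom ?D S}"
      then show "Poly_Mapping.keys (x + y) \<subseteq> Hom ?D S"
        by (intro order_trans[OF Poly_Mapping.keys_add] Un_least x) simp
    qed
    show "lin_map ?s {x. Poly_Mapping.keys x \<subseteq> Hom ?D S} ?s {x. Poly_Mapping.keys x \<subseteq> Hom ?D T} (push (comp ?D f))"
      if "f \<in> Hom S T" for S T f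
      using keys_push[OF _ im[OF that]] by (intro lin_mapI) (simp_all add: push_add push_pm_scale[OF module_mult])
  next
    fix S :: "nat set" and x :: "'g gmap \<Rightarrow>\<^sub>0 'k" assume "x \<in> {x. Poly_Mapping.keys x \<subseteq> Hom ?D S}"
    then have "push (comp ?D (gid S)) x = push (\<lambda>f. f) x"
      using comp_gid_left by (intro push_cong) blast
    then show "push (comp ?D (gid S)) x = x" by (simp only: push_id)
  next
    fix R S T and f h :: "'g gmap" and x :: "'g gmap \<Rightarrow>\<^sub>0 'k"
    assume "x \<in> {x. Poly_Mapping.keys x \<subseteq> Hom ?D R}" "f \<in> Hom R S" "h \<in> Hom S T"
    then show "push (comp ?D (comp R h f)) x = push (comp ?D h) (push (comp ?D f) x)"
      unfolding push_push by (intro push_cong comp_assoc) auto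
  qed
qed

end


section \<open>Stability of characters\<close>

lemma sum_if_card:
  "finite A \<Longrightarrow> (\<Sum>x\<in>A. if P x then c else 0) = of_nat (card {x \<in> A. P x}) * (c :: 'a::comm_semiring_1)"
  by (simp add: sum.If_cases Int_def)

context finite_group
begin

text \<open>\<open>w\<close> together with right multiplication by \<open>h\<inverse>\<close>
  permutes the basis of maps \<open>f\<close>, and the trace counts its fixed points:
  \<open>w f h\<inverse> = f\<close> says \<open>w f = f h\<close>.\<close>

lemma cnt_as_trace:
  assumes h: "h \<in> Wr d" and w: "w \<in> Wr n"
  shows "of_nat (cnt {1..d} h {1..n} w) =
    trace_on (pm_scale (*)) (fobj (fig_M G d) {1..n})
      (\<lambda>x. fmap (fig_M G d) {1..n} {1..n} w (push (\<lambda>f. comp {1..d} f (ginv {1..d} h)) x) :: 'g gmap \<Rightarrow>\<^sub>0 'k::field_char_0)"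
proof -
  let ?D = "{1..d}" and ?N = "{1..n}"
  let ?s = "pm_scale (*) :: 'k \<Rightarrow> ('g gmap \<Rightarrow>\<^sub>0 'k) \<Rightarrow> _"
  let ?U = "fobj (fig_M G d) ?N :: ('g gmap \<Rightarrow>\<^sub>0 'k) set"
  let ?hi = "ginv ?D h"
  interpret M: fig_mod G ?s "fig_M G d" by unfold_locales (rule fig_module_M)
  have U: "?U = {x. Poly_Mapping.keys x \<subseteq> Hom ?D ?N}" by (simp add: fig_M_def)
  have fm: "fmap (fig_M G d) ?N ?N w = push (comp ?D w)" by (simp add: fig_M_def)
  have hi: "?hi \<in> Hom ?D ?D" by (rule ginv(1)[OF _ h]) simp
  have finH: "finite (Hom ?D ?N)" by (rule finite_Hom) auto
  have fr: "frame ?s ?U (Hom ?D ?N) (\<lambda>f x. Poly_Mapping.lookup x f) (\<lambda>f. Poly_Mapping.single f 1)"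
    unfolding frame_def
  proof (intro conjI ballI finH)
    fix f assume "f \<in> Hom ?D ?N"
    then show "Poly_Mapping.single f 1 \<in> ?U" unfolding U by simp
    show "lin_map ?s ?U (*) UNIV (\<lambda>x. Poly_Mapping.lookup x f)"
      by (intro lin_mapI) (simp_all add: lookup_add lookup_pm_scale[OF module_mult])
  next
    fix x assume "x \<in> ?U"
    then have x: "Poly_Mapping.keys x \<subseteq> Hom ?D ?N" unfolding U by simp
    show "(\<Sum>f\<in>Hom ?D ?N. ?s (Poly_Mapping.lookup x f) (Poly_Mapping.single f 1)) = x"
    proof (rule poly_mapping_eqI)
      fix k
      have "Poly_Mapping.lookup (\<Sum>f\<in>Hom ?D ?N. ?s (Poly_Mapping.lookup x f) (Poly_Mapping.single f 1)) k =
          (\<Sum>f\<in>Hom ?D ?N. if f = k then Poly_Mapping.lookup x k else 0)"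
        unfolding lookup_sum lookup_pm_scale[OF module_mult]
        by (intro sum.cong refl) (simp add: lookup_single when_def)
      also have "\<dots> = Poly_Mapping.lookup x k"
        using finH x by (auto simp: in_keys_iff)
      finally show "Poly_Mapping.lookup (\<Sum>f\<in>Hom ?D ?N. ?s (Poly_Mapping.lookup x f) (Poly_Mapping.single f 1)) k
          = Poly_Mapping.lookup x k" .
    qed
  qed
  have Rl: "lin_map ?s ?U ?s ?U (push (\<lambda>f. comp ?D f ?hi))"
  proof (rule lin_mapI)
    fix x assume "x \<in> ?U"
    then show "push (\<lambda>f. comp ?D f ?hi) x \<in> ?U"
      unfolding U using comp_in_Hom[OF hi] by (intro CollectI keys_push[of x "Hom ?D ?N"]) auto
  qed (simp_all add: push_add push_pm_scale[OF module_mult])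
  have "trace_on ?s ?U (\<lambda>x. fmap (fig_M G d) ?N ?N w (push (\<lambda>f. comp ?D f ?hi) x)) =
      (\<Sum>f\<in>Hom ?D ?N. Poly_Mapping.lookup (push (comp ?D w) (push (\<lambda>f. comp ?D f ?hi) (Poly_Mapping.single f 1))) f)"
    unfolding fm[symmetric]
    by (rule trace_frame[OF M.V.vector_space_axioms M.ob_subspace fr lin_map_compose[OF Rl M.mp_lin[OF w]]])
  also have "\<dots> = (\<Sum>f\<in>Hom ?D ?N. if comp ?D w f = comp ?D f h then 1 else 0)"
  proof (rule sum.cong[OF refl])
    fix f assume f: "f \<in> Hom ?D ?N"
    have wf: "comp ?D w f \<in> Hom ?D ?N" by (rule comp_in_Hom[OF f w])
    have "(comp ?D w (comp ?D f ?hi) = f) = (comp ?D w f = comp ?D f h)"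
      unfolding comp_assoc[OF hi f w, symmetric]
      using comp_comp_ginv[OF _ h wf] comp_comp_ginv[OF _ h f] by force
    then show "Poly_Mapping.lookup (push (comp ?D w) (push (\<lambda>f. comp ?D f ?hi) (Poly_Mapping.single f 1))) f =
      (if comp ?D w f = comp ?D f h then 1 else 0)"
      unfolding push_single lookup_single when_def by simp
  qed
  also have "\<dots> = of_nat (cnt ?D h ?N w)"
    unfolding sum_if_card[OF finH] cnt_def by simp
  finally show ?thesis by simp
qed

text \<open>The conditions of \<open>mean_trace_Suc\<close> hold for \<open>M(d)\<close>: it is
  generated by the identity of \<open>[d]\<close>, which gives surjectivity for
  \<open>n \<ge> a + d\<close>, and injectivity comes from \<open>function_up_inj\<close>. Right
  multiplication by \<open>h\<inverse>\<close> commutes with all induced maps and serves as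
  \<open>R\<close>.\<close>

lemma mean_cnt_Suc:
  assumes h: "h \<in> Wr d" and h1: "h1 \<in> Wr a" and n: "a + d \<le> n"
  shows "mean a n (\<lambda>w. of_nat (cnt {1..d} h {1..n} w) :: 'k::field_char_0) h1 =
    mean a (Suc n) (\<lambda>w. of_nat (cnt {1..d} h {1..Suc n} w)) h1"
proof -
  let ?D = "{1..d}"
  let ?s = "pm_scale (*) :: 'k \<Rightarrow> ('g gmap \<Rightarrow>\<^sub>0 'k) \<Rightarrow> _"
  interpret M: fig_mod G ?s "fig_M G d" by unfold_locales (rule fig_module_M)
  let ?R = "push (\<lambda>f. comp ?D f (ginv ?D h)) :: ('g gmap \<Rightarrow>\<^sub>0 'k) \<Rightarrow> _"
  have hi: "ginv ?D h \<in> Hom ?D ?D" by (rule ginv(1)[OF _ h]) simp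
  have ob: "M.ob n = {x. Poly_Mapping.keys x \<subseteq> Hom ?D {1..n}}" for n by (simp add: fig_M_def)
  have mp: "M.mp m n f = push (comp ?D f)" for m n f by (simp add: fig_M_def)
  have an: "a \<le> n" using n by simp
  have gen: "M.generated d {()} (\<lambda>_. d) (\<lambda>_. Poly_Mapping.single (gid ?D) 1)"
    unfolding M.generated_def
  proof (intro conjI ballI allI)
    show v: "Poly_Mapping.single (gid ?D) 1 \<in> M.ob d"
      unfolding ob by (simp add: gid_in_Hom)
    fix n
    let ?V = "(\<lambda>(j, f). M.mp d n f (Poly_Mapping.single (gid ?D) 1)) ` (SIGMA j:{()}. Hom ?D {1..n})"
    show "M.V.span ?V = M.ob n"
    proof (rule M.V.span_subspace[OF _ _ M.ob_subspace])
      have eq: "M.mp d n f (Poly_Mapping.single (gid ?D) 1) = Poly_Mapping.single f 1" if "f \<in> Hom ?D {1..n}" for f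
        unfolding mp push_single comp_gid_right[OF that] ..
      show "?V \<subseteq> M.ob n"
      proof
        fix z assume "z \<in> ?V"
        then obtain f where f: "f \<in> Hom ?D {1..n}" "z = M.mp d n f (Poly_Mapping.single (gid ?D) 1)"
          by (elim imageE SigmaE) simp
        show "z \<in> M.ob n" unfolding f(2) by (rule M.mp_in[OF f(1) v])
      qed
      show "M.ob n \<subseteq> M.V.span ?V"
      proof
        fix x assume "x \<in> M.ob n"
        then have x: "Poly_Mapping.keys x \<subseteq> Hom ?D {1..n}" unfolding ob by simp
        have "x = (\<Sum>f\<in>Poly_Mapping.keys x. ?s (Poly_Mapping.lookup x f) (Poly_Mapping.single f 1))"
          by (rule poly_mapping_eqI)
            (simp add: lookup_sum lookup_pm_scale[OF module_mult] lookup_single when_def if_distrib in_keys_iff cong: if_cong)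
        also have "\<dots> \<in> M.V.span ?V"
        proof (intro M.V.span_sum M.V.span_scale M.V.span_base)
          fix f assume "f \<in> Poly_Mapping.keys x"
          then have f: "f \<in> Hom ?D {1..n}" using x by blast
          show "Poly_Mapping.single f 1 \<in> ?V"
            by (rule image_eqI[of _ _ "((), f)"]) (use eq[OF f] f in simp_all)
        qed
        finally show "x \<in> M.V.span ?V" .
      qed
    qed
  qed simp_all
  note fd = M.generated_fin_dim[OF gen]
  have "mean a n (\<lambda>w. trace_on ?s (M.ob n) (\<lambda>x. M.mp n n w (?R x))) h1 =
    mean a (Suc n) (\<lambda>w. trace_on ?s (M.ob (Suc n)) (\<lambda>x. M.mp (Suc n) (Suc n) w (?R x))) h1"
  proof (rule M.mean_trace_Suc[OF fd fd an h1, where R = "\<lambda>_. ?R"])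
    show "lin_map ?s (M.ob n) ?s (M.ob n) ?R" for n
    proof (rule lin_mapI)
      fix x assume "x \<in> M.ob n"
      then show "?R x \<in> M.ob n"
        unfolding ob using comp_in_Hom[OF hi] by (intro CollectI keys_push[of x "Hom ?D {1..n}"]) auto
    qed (simp_all add: push_add push_pm_scale[OF module_mult])
    show "?R (M.mp m n f x) = M.mp m n f (?R x)" if "f \<in> Hom {1..m} {1..n}" "x \<in> M.ob m" for m n f x
      unfolding mp push_push
      by (intro push_cong comp_assoc[OF hi _ that(1)]) (use that(2) ob in blast)
  next
    fix x assume x: "x \<in> M.ob n" and inv: "M.avg a n (gid {1..a}) x = x" and zero: "M.up a n x = 0"
    show "x = 0"
    proof (rule function_up_inj[OF vector_space_mult _ an])
      show "finite ?D" by simp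
      show "Poly_Mapping.keys x \<subseteq> Hom ?D {1..n}" using x unfolding ob by simp
      show "push (comp ?D w) x = x" if "w \<in> stab {1..a} {1..n}" for w
      proof -
        have w: "w \<in> cst a n (gid {1..a})" using that unfolding cst_gid .
        have "M.mp n n w (M.avg a n (gid {1..a}) x) = M.avg a n (gid {1..a}) x"
          unfolding M.avg_post[OF an M.gid_Wr M.gid_Wr w x] comp_gid_left[OF M.gid_Wr] ..
        then show ?thesis unfolding inv mp .
      qed
      have "card (stab {1..a} {1..Suc n}) \<noteq> 0"
        using card_stab_pos[of "{1..Suc n}" "{1..a}"] an by auto
      then show "(\<Sum>w\<in>stab {1..a} {1..Suc n}. push (comp ?D w) (push (comp ?D (gid {1..n})) x)) = 0"
        using zero unfolding M.up_def M.avg_def cst_gid mp M.V.scale_eq_0_iff by simp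
    qed
  next
    fix y assume "y \<in> M.ob (Suc n)"
    then show "\<exists>x\<in>M.ob n. M.up a n x = M.avg a (Suc n) (gid {1..a}) y"
      by (rule M.up_surj[OF gen n])
  qed
  moreover have "mean a n (\<lambda>w. of_nat (cnt ?D h {1..n} w) :: 'k) h1 =
      mean a n (\<lambda>w. trace_on ?s (M.ob n) (\<lambda>x. M.mp n n w (?R x))) h1" for n
    unfolding mean_def
    by (intro arg_cong2[where f = "(*)"] refl sum.cong cnt_as_trace[OF h] M.cst_Wr)
  ultimately show ?thesis by (simp only:)
qed

definition class_fun :: "nat \<Rightarrow> ('g gmap \<Rightarrow> 'k) \<Rightarrow> bool" where
  "class_fun n F \<longleftrightarrow> (\<forall>g\<in>Wr n. \<forall>w\<in>Wr n. F (comp {1..n} w (comp {1..n} g (ginv {1..n} w))) = F g)"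

text \<open>Composition with \<open>w\<inverse>\<close> matches the maps counted for the conjugate
  with those counted for \<open>g\<close>.\<close>

lemma cnt_class_fun:
  assumes "h \<in> Hom R R"
  shows "class_fun n (\<lambda>g. of_nat (cnt R h {1..n} g))"
  unfolding class_fun_def
proof (intro ballI arg_cong[where f = of_nat])
  let ?S = "{1..n}"
  fix g w assume g: "g \<in> Wr n" and w: "w \<in> Wr n"
  have wi: "ginv ?S w \<in> Wr n" by (rule ginv(1)[OF _ w]) simp
  have gwi: "comp ?S g (ginv ?S w) \<in> Wr n" by (rule comp_in_Hom[OF wi g])
  have c: "comp R (comp ?S w (comp ?S g (ginv ?S w))) \<phi> = comp R w (comp R g (comp R (ginv ?S w) \<phi>))"
    if "\<phi> \<in> Hom R ?S" for \<phi>
    using comp_assoc[OF that gwi w] comp_assoc[OF that wi g] by simp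
  have inv: "comp R (ginv ?S w) (comp R w \<phi>) = \<phi>" "comp R w (comp R (ginv ?S w) \<phi>) = \<phi>" if "\<phi> \<in> Hom R ?S" for \<phi>
    using comp_ginv_cancel[OF _ w that] by simp_all
  show "cnt R h ?S (comp ?S w (comp ?S g (ginv ?S w))) = cnt R h ?S g"
    unfolding cnt_def
  proof (rule bij_betw_same_card, rule bij_betw_byWitness[where f = "comp R (ginv ?S w)" and f' = "comp R w"])
    let ?A = "{\<phi> \<in> Hom R ?S. comp R (comp ?S w (comp ?S g (ginv ?S w))) \<phi> = comp R \<phi> h}"
    let ?B = "{\<phi> \<in> Hom R ?S. comp R g \<phi> = comp R \<phi> h}"
    show "\<forall>a\<in>?A. comp R w (comp R (ginv ?S w) a) = a" "\<forall>a\<in>?B. comp R (ginv ?S w) (comp R w a) = a"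
      using inv by blast+
    have h: "comp R (comp R v \<phi>) h = comp R v (comp R \<phi> h)" if "v \<in> Wr n" "\<phi> \<in> Hom R ?S" for v \<phi>
      by (rule comp_assoc[OF assms that(2,1)])
    show "comp R (ginv ?S w) ` ?A \<subseteq> ?B"
    proof (rule image_subsetI, elim CollectE conjE, intro CollectI conjI)
      fix \<phi> assume \<phi>: "\<phi> \<in> Hom R ?S" "comp R (comp ?S w (comp ?S g (ginv ?S w))) \<phi> = comp R \<phi> h"
      show \<psi>: "comp R (ginv ?S w) \<phi> \<in> Hom R ?S" by (rule comp_in_Hom[OF \<phi>(1) wi])
      have "comp R g (comp R (ginv ?S w) \<phi>) = comp R (ginv ?S w) (comp R \<phi> h)"
        unfolding \<phi>(2)[symmetric] c[OF \<phi>(1)] by (rule inv(1)[OF comp_in_Hom[OF \<psi> g], symmetric])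
      then show "comp R g (comp R (ginv ?S w) \<phi>) = comp R (comp R (ginv ?S w) \<phi>) h"
        unfolding h[OF wi \<phi>(1)] .
    qed
    show "comp R w ` ?B \<subseteq> ?A"
    proof (rule image_subsetI, elim CollectE conjE, intro CollectI conjI)
      fix \<psi> assume \<psi>: "\<psi> \<in> Hom R ?S" "comp R g \<psi> = comp R \<psi> h"
      show \<phi>: "comp R w \<psi> \<in> Hom R ?S" by (rule comp_in_Hom[OF \<psi>(1) w])
      show "comp R (comp ?S w (comp ?S g (ginv ?S w))) (comp R w \<psi>) = comp R (comp R w \<psi>) h"
        unfolding c[OF \<phi>] inv(1)[OF \<psi>(1)] \<psi>(2) h[OF w \<psi>(1)] ..
    qed
  qed
qed

text \<open>Exchange the sums over \<open>w\<close> and \<open>\<phi>\<close>. Conjugation by an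
  extension of \<open>\<phi>\<close> carries the coset \<open>cst a n h\<close> onto the
  \<open>w\<close> with \<open>w \<phi> = \<phi> h\<close>, so for a class function each
  \<open>\<phi>\<close> contributes the same amount.\<close>

lemma mean_pairing:
  fixes F :: "'g gmap \<Rightarrow> 'k::field_char_0"
  assumes F: "class_fun n F" and a: "a \<le> n" and h: "h \<in> Wr a"
  shows "(\<Sum>w\<in>Wr n. F w * of_nat (cnt {1..a} h {1..n} w)) = of_nat (card (Hom {1..a} {1..n})) * (\<Sum>w\<in>cst a n h. F w)"
proof -
  let ?A = "{1..a}" and ?N = "{1..n}"
  have finH: "finite (Hom ?A ?N)" and finW: "finite (Wr n)" by (rule finite_Hom; simp)+
  have "(\<Sum>w\<in>Wr n. F w * of_nat (cnt ?A h ?N w)) =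
      (\<Sum>w\<in>Wr n. \<Sum>\<phi>\<in>Hom ?A ?N. if comp ?A w \<phi> = comp ?A \<phi> h then F w else 0)"
    unfolding sum_if_card[OF finH] cnt_def by (simp only: mult.commute)
  also have "\<dots> = (\<Sum>\<phi>\<in>Hom ?A ?N. \<Sum>w\<in>Wr n. if comp ?A w \<phi> = comp ?A \<phi> h then F w else 0)"
    by (rule sum.swap)
  also have "\<dots> = (\<Sum>\<phi>\<in>Hom ?A ?N. \<Sum>w\<in>cst a n h. F w)"
  proof (rule sum.cong[OF refl])
    fix \<phi> assume \<phi>: "\<phi> \<in> Hom ?A ?N"
    have AN: "?A \<subseteq> ?N" using a by auto
    note gA = gid_in_Hom[OF AN]
    obtain v where v: "v \<in> Wr n" "comp ?A v (gid ?A) = \<phi>" by (rule Hom_extend[OF _ AN \<phi>]) simp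
    have vi: "ginv ?N v \<in> Wr n" by (rule ginv(1)[OF _ v(1)]) simp
    have v\<phi>: "comp ?A (ginv ?N v) \<phi> = gid ?A"
      using comp_ginv_cancel(1)[OF _ v(1) gA] v(2) by simp
    have vh: "comp ?A v h = comp ?A \<phi> h"
      using comp_assoc[OF h gA v(1)] comp_gid_left[OF h] v(2) by simp
    let ?c = "\<lambda>w. comp ?N v (comp ?N w (ginv ?N v))" and ?c' = "\<lambda>w. comp ?N (comp ?N (ginv ?N v) w) v"
    have cW: "?c w \<in> Wr n" "?c' w \<in> Wr n" if "w \<in> Wr n" for w
      using comp_in_Hom that v(1) vi by blast+
    have cc: "?c' (?c w) = w" "?c (?c' w) = w" if w: "w \<in> Wr n" for w
    proof -
      have 1: "comp ?N w (ginv ?N v) \<in> Wr n" "comp ?N (ginv ?N v) w \<in> Wr n" using comp_in_Hom w vi by blast+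
      show "?c' (?c w) = w"
        using comp_ginv_cancel(1)[OF _ v(1) 1(1)] comp_comp_ginv(2)[OF _ v(1) w] by simp
      show "?c (?c' w) = w"
        using comp_comp_ginv(1)[OF _ v(1) 1(2)] comp_ginv_cancel(2)[OF _ v(1) w] by simp
    qed
    have A1: "comp ?A (?c w) \<phi> = comp ?A v (comp ?A w (gid ?A))" if w: "w \<in> Wr n" for w
      using comp_assoc[OF \<phi> comp_in_Hom[OF vi w] v(1)] comp_assoc[OF \<phi> vi w] v\<phi> by simp
    have iff: "comp ?A (?c w) \<phi> = comp ?A \<phi> h \<longleftrightarrow> w \<in> cst a n h" if w: "w \<in> Wr n" for w
      unfolding A1[OF w] vh[symmetric]
      using comp_left_cancel[OF v(1) comp_in_Hom[OF gA w] Wr_le[OF a h]] w by (auto simp: cst_def)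
    have "(\<Sum>w\<in>Wr n. if comp ?A w \<phi> = comp ?A \<phi> h then F w else 0) =
        (\<Sum>w\<in>Wr n. if comp ?A (?c w) \<phi> = comp ?A \<phi> h then F (?c w) else 0)"
    proof (rule sum.reindex_bij_betw[symmetric])
      show "bij_betw ?c (Wr n) (Wr n)"
        by (rule bij_betw_byWitness[where f' = ?c']) (use cc cW in auto)
    qed
    also have "\<dots> = (\<Sum>w\<in>Wr n. if w \<in> cst a n h then F w else 0)"
      using iff F v(1) by (intro sum.cong) (auto simp: class_fun_def)
    also have "\<dots> = (\<Sum>w\<in>cst a n h. F w)"
      by (subst sum.inter_restrict[OF finW, symmetric]) (rule sum.cong, auto simp: cst_def)
    finally show "(\<Sum>w\<in>Wr n. if comp ?A w \<phi> = comp ?A \<phi> h then F w else 0) = (\<Sum>w\<in>cst a n h. F w)" .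
  qed
  finally show ?thesis by simp
qed

text \<open>By \<open>mean_pairing\<close> a class function with zero averages is orthogonal to all
  counts, in particular to those it is a combination of.\<close>

lemma cnt_span_nondegenerate:
  fixes F :: "'g gmap \<Rightarrow> 'k::field_char_0"
  assumes F: "in_cnt_span e {1..n} F" "class_fun n F" and n: "e \<le> n"
    and zero: "\<And>a h. (a, h) \<in> idx e \<Longrightarrow> mean a n F h = 0" and g: "g \<in> Wr n"
  shows "F g = 0"
proof -
  obtain q where q: "\<And>g. g \<in> Wr n \<Longrightarrow> F g = (\<Sum>(a, h)\<in>idx e. q (a, h) * of_nat (cnt {1..a} h {1..n} g))"
    using F(1) unfolding in_cnt_span_def by blast
  show ?thesis
  proof (rule rational_span_nondegenerate[OF finite_idx, of "Wr n" F q "\<lambda>(a, h). cnt {1..a} h {1..n}"])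
    show "finite (Wr n)" by (rule finite_Hom) auto
    show "F g = (\<Sum>p\<in>idx e. q p * of_nat ((case p of (a, h) \<Rightarrow> cnt {1..a} h {1..n}) g))" if "g \<in> Wr n" for g
      unfolding q[OF that] by (simp add: case_prod_beta)
    fix p assume p: "p \<in> idx e"
    then obtain a h where ah: "p = (a, h)" "a \<le> e" "h \<in> Wr a" by (auto simp: idx_def)
    have an: "a \<le> n" using ah(2) n by simp
    have "card (stab {1..a} {1..n}) \<noteq> 0" using card_stab_pos[of "{1..n}" "{1..a}"] an by auto
    then have "(\<Sum>w\<in>cst a n h. F w) = 0"
      using zero[of a h] p ah(1) by (simp add: mean_def)
    then show "(\<Sum>g\<in>Wr n. F g * of_nat ((case p of (a, h) \<Rightarrow> cnt {1..a} h {1..n}) g)) = 0"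
      using mean_pairing[OF F(2) an ah(3)] ah(1) by simp
  qed (rule g)
qed

lemma mean_linear:
  "mean a n (\<lambda>w. F w - (\<Sum>p\<in>I. q p * F' p w)) h = mean a n F h - (\<Sum>p\<in>I. q p * mean a n (F' p) h)"
proof -
  have "(\<Sum>w\<in>A. \<Sum>p\<in>I. q p * F' p w) = (\<Sum>p\<in>I. q p * (\<Sum>w\<in>A. F' p w))" for A
    by (subst sum.swap) (simp add: sum_distrib_left)
  then show ?thesis
    unfolding mean_def sum_subtractf
    by (simp add: right_diff_distrib sum_distrib_left mult.left_commute)
qed

end

context fig_mod
begin

text \<open>Since \<open>a\<close> runs up to \<open>e\<close>, the bound \<open>e + max c e\<close>
  puts every \<open>n\<close> in the range where \<open>up\<close> is bijective on the invariants of
  \<open>X\<close> and where the averages of the counts are stable.\<close>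

theorem character_stable:
  assumes gen: "generated e J d v"
    and inj: "\<And>a n x. a \<le> e \<Longrightarrow> a + c \<le> n \<Longrightarrow> x \<in> ob n \<Longrightarrow> avg a n (gid {1..a}) x = x \<Longrightarrow> up a n x = 0 \<Longrightarrow> x = 0"
  shows "\<exists>q. \<forall>n\<ge>e + max c e. \<forall>g\<in>Wr n.
    trace_on s (ob n) (mp n n g) = (\<Sum>(a, h)\<in>idx e. q (a, h) * of_nat (cnt {1..a} h {1..n} g))"
proof -
  let ?N = "e + max c e"
  let ?f = "\<lambda>n g. trace_on s (ob n) (mp n n g)"
  let ?u = "\<lambda>p n g. of_nat (cnt {1..fst p} (snd p) {1..n} g) :: 'k"
  note fd = generated_fin_dim[OF gen]
  obtain q where q: "\<And>g. g \<in> Wr ?N \<Longrightarrow> ?f ?N g = (\<Sum>(a, h)\<in>idx e. q (a, h) * of_nat (cnt {1..a} h {1..?N} g))"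
    using character_in_span[OF gen, of ?N] unfolding in_cnt_span_def by blast
  \<comment> \<open>The error of the combination chosen at \<open>?N\<close>. It vanishes there,
    hence has zero averages, and these persist.\<close>
  define \<theta> where "\<theta> n g = ?f n g - (\<Sum>p\<in>idx e. q p * ?u p n g)" for n g
  have theta_Suc: "mean a n (\<theta> n) h = mean a (Suc n) (\<theta> (Suc n)) h" if n: "?N \<le> n" and ah: "(a, h) \<in> idx e" for n a h
  proof -
    have a: "a \<le> e" "h \<in> Wr a" using ah by (auto simp: idx_def)
    have "mean a n (?f n) h = mean a (Suc n) (?f (Suc n)) h"
    proof (rule mean_trace_Suc[OF fd fd _ a(2), of n "\<lambda>_ x. x"])
      show "x = 0" if "x \<in> ob n" "avg a n (gid {1..a}) x = x" "up a n x = 0" for x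
        by (rule inj[OF a(1) _ that]) (use n a in simp)
      show "\<exists>x\<in>ob n. up a n x = avg a (Suc n) (gid {1..a}) y" if "y \<in> ob (Suc n)" for y
        by (rule up_surj[OF gen _ that]) (use n a in simp)
    qed (use n a in \<open>auto simp: lin_map_def\<close>)
    moreover have "mean a n (?u p n) h = mean a (Suc n) (?u p (Suc n)) h" if "p \<in> idx e" for p
      by (rule mean_cnt_Suc[OF _ a(2)]) (use that n a in \<open>auto simp: idx_def\<close>)
    ultimately show ?thesis unfolding \<theta>_def mean_linear by simp
  qed
  have zero: "mean a n (\<theta> n) h = 0" if n: "?N \<le> n" and ah: "(a, h) \<in> idx e" for n a h
    using n
  proof (induction n rule: dec_induct)
    case base
    have "\<theta> ?N w = 0" if "w \<in> cst a ?N h" for w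
      unfolding \<theta>_def q[OF cst_Wr[OF that]] by (simp add: case_prod_beta)
    then show ?case by (simp add: mean_def)
  next
    case (step n)
    then show ?case using theta_Suc[OF step(1) ah] by simp
  qed
  have "?f n g = (\<Sum>(a, h)\<in>idx e. q (a, h) * of_nat (cnt {1..a} h {1..n} g))" if n: "?N \<le> n" and g: "g \<in> Wr n" for n g
  proof -
    have "\<theta> n g = 0"
    proof (rule cnt_span_nondegenerate[OF _ _ _ zero[OF n] g])
      have "in_cnt_span e {1..n} (\<lambda>g. ?f n g + (- 1) * (\<Sum>p\<in>idx e. q p * ?u p n g))"
        by (intro in_cnt_span_add in_cnt_span_scale in_cnt_span_sum character_in_span[OF gen] cnt_in_span)
          (auto simp: idx_def)
      then show "in_cnt_span e {1..n} (\<theta> n)"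
        by (rule in_cnt_span_cong) (simp add: \<theta>_def)
      show "class_fun n (\<theta> n)"
        unfolding class_fun_def \<theta>_def
      proof (intro ballI arg_cong2[where f = "(-)"] sum.cong refl arg_cong2[where f = "(*)"])
        fix p g w assume p: "p \<in> idx e" and gw: "g \<in> Wr n" "w \<in> Wr n"
        have "snd p \<in> Wr (fst p)" using p by (auto simp: idx_def)
        from cnt_class_fun[OF this] gw show "?u p n (comp {1..n} w (comp {1..n} g (ginv {1..n} w))) = ?u p n g"
          unfolding class_fun_def by blast
      qed (rule trace_class_fun[OF fd])
      show "e \<le> n" using n by simp
    qed
    then show ?thesis by (simp add: \<theta>_def case_prod_beta)
  qed
  then show ?thesis by blast
qed

end


section \<open>Homomorphisms\<close>

lemma fig_module_hom_lin: "fig_module_hom G s X t Y \<eta> \<Longrightarrow> finite S \<Longrightarrow> lin_map s (fobj X S) t (fobj Y S) (\<eta> S)"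
  by (simp add: fig_module_hom_def)

lemma fig_module_hom_nat:
  assumes "fig_module_hom G s X t Y \<eta>" "finite S" "finite T" "f \<in> fig_Hom G S T" "x \<in> fobj X S"
  shows "\<eta> T (fmap X S T f x) = fmap Y S T f (\<eta> S x)"
  by (rule conjunct2[OF assms(1)[unfolded fig_module_hom_def], rule_format]) (intro conjI assms)+

lemma push_zero: "push h 0 = 0"
  by (simp add: push_def)

section \<open>Direct sums\<close>

lemma subspace_dsum:
  fixes s :: "'k::field \<Rightarrow> 'v::ab_group_add \<Rightarrow> 'v" and F :: "'i \<Rightarrow> ('g, 'v) fig_functor"
  assumes s: "vector_space s" and F: "\<And>i. i \<in> I \<Longrightarrow> module.subspace s (fobj (F i) S)"
  shows "module.subspace (pm_scale s) (fobj (fig_dsum I F) S)"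
proof -
  interpret s: vector_space s by fact
  interpret p: vector_space "pm_scale s :: _ \<Rightarrow> ('i \<Rightarrow>\<^sub>0 'v) \<Rightarrow> _"
    by (rule vector_space_pm_scale[OF s])
  show ?thesis
  proof (rule p.subspaceI)
    show "0 \<in> fobj (fig_dsum I F) S"
      using F s.subspace_0 by (simp add: fig_dsum_def)
    fix x y c assume x: "x \<in> fobj (fig_dsum I F) S"
    then have kx: "Poly_Mapping.keys x \<subseteq> I" by (simp add: fig_dsum_def)
    show "pm_scale s c x \<in> fobj (fig_dsum I F) S"
      using x F s.subspace_scale order_trans[OF keys_pm_scale[OF s.module_axioms, of c x] kx]
      by (simp add: fig_dsum_def lookup_pm_scale[OF s.module_axioms])
    assume y: "y \<in> fobj (fig_dsum I F) S"
    then have "Poly_Mapping.keys y \<subseteq> I" by (simp add: fig_dsum_def)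
    then have "Poly_Mapping.keys (x + y) \<subseteq> I" using kx Poly_Mapping.keys_add[of x y] by blast
    then show "x + y \<in> fobj (fig_dsum I F) S"
      using x y F s.subspace_add by (simp add: fig_dsum_def lookup_add)
  qed
qed

lemma single_in_dsum:
  assumes "i \<in> I" "y \<in> fobj (F i) S" "\<And>j. j \<in> I \<Longrightarrow> 0 \<in> fobj (F j) S"
  shows "Poly_Mapping.single i y \<in> fobj (fig_dsum I F) S"
  using assms by (simp add: fig_dsum_def lookup_single when_def)

lemma lookup_fmap_dsum:
  assumes "\<And>i. fmap (F i) S T f 0 = 0"
  shows "Poly_Mapping.lookup (fmap (fig_dsum I F) S T f x) i = fmap (F i) S T f (Poly_Mapping.lookup x i)"
proof -
  have "Poly_Mapping.lookup (fmap (fig_dsum I F) S T f x) i =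
      (\<Sum>j\<in>Poly_Mapping.keys x. if j = i then fmap (F i) S T f (Poly_Mapping.lookup x i) else 0)"
    unfolding fig_dsum_def fig_functor.simps lookup_sum
    by (intro sum.cong refl) (simp add: lookup_single when_def)
  also have "\<dots> = fmap (F i) S T f (Poly_Mapping.lookup x i)"
    using assms by (simp add: in_keys_iff)
  finally show ?thesis .
qed

lemma poly_mapping_sum_single:
  assumes "finite A" "Poly_Mapping.keys x \<subseteq> A"
  shows "(\<Sum>i\<in>A. Poly_Mapping.single i (Poly_Mapping.lookup x i)) = (x :: 'i \<Rightarrow>\<^sub>0 'v::ab_group_add)"
proof (rule poly_mapping_eqI)
  fix k
  have "Poly_Mapping.lookup (\<Sum>i\<in>A. Poly_Mapping.single i (Poly_Mapping.lookup x i)) k =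
      (\<Sum>i\<in>A. if i = k then Poly_Mapping.lookup x k else 0)"
    unfolding lookup_sum by (intro sum.cong refl) (simp add: lookup_single when_def)
  also have "\<dots> = Poly_Mapping.lookup x k" using assms by (auto simp: in_keys_iff)
  finally show "Poly_Mapping.lookup (\<Sum>i\<in>A. Poly_Mapping.single i (Poly_Mapping.lookup x i)) k = Poly_Mapping.lookup x k" .
qed

lemma pm_scale_single:
  assumes "module s"
  shows "pm_scale s c (Poly_Mapping.single i u) = Poly_Mapping.single i (s c u)"
  using module.scale_zero_right[OF assms]
  by (intro poly_mapping_eqI) (simp add: lookup_pm_scale[OF assms] lookup_single when_def)

lemma single_sum: "Poly_Mapping.single i (\<Sum>j\<in>J. f j) = (\<Sum>j\<in>J. Poly_Mapping.single i (f j :: 'v::ab_group_add))"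
  by (rule poly_mapping_eqI) (simp add: lookup_single lookup_sum when_def)

context fig_mod
begin

text \<open>The generator \<open>v j\<close> is the image of the identity of \<open>[d j]\<close>;
  by naturality its translates are the images of the basis vectors of the direct sum.\<close>

lemma fin_gen_generated:
  assumes "fin_gen_in G s X {..e}"
  shows "\<exists>(J :: nat set) d v. generated e J d v"
proof -
  obtain N d \<eta> where d: "\<And>j. j < N \<Longrightarrow> d j \<le> e"
    and hom: "fig_module_hom G (pm_scale (pm_scale (*)))
      (fig_dsum {..<N} (\<lambda>j. fig_M G (d j)) :: ('g, nat \<Rightarrow>\<^sub>0 'g gmap \<Rightarrow>\<^sub>0 'k) fig_functor) s X \<eta>"
    and surj: "fig_surj (fig_dsum {..<N} (\<lambda>j. fig_M G (d j)) :: ('g, nat \<Rightarrow>\<^sub>0 'g gmap \<Rightarrow>\<^sub>0 'k) fig_functor) X \<eta>"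
    using assms unfolding fin_gen_in_def by (auto simp del: fig_functor.simps)
  let ?s = "pm_scale (pm_scale (*)) :: 'k \<Rightarrow> (nat \<Rightarrow>\<^sub>0 'g gmap \<Rightarrow>\<^sub>0 'k) \<Rightarrow> _"
  let ?F = "\<lambda>j. fig_M G (d j) :: ('g, 'g gmap \<Rightarrow>\<^sub>0 'k) fig_functor"
  let ?D = "fig_dsum {..<N} ?F"
  let ?e = "\<lambda>j f. Poly_Mapping.single j (Poly_Mapping.single f (1::'k))"
  define v where "v j = \<eta> {1..d j} (?e j (gid {1..d j}))" for j
  interpret P: vector_space ?s by (intro vector_space_pm_scale vector_space_mult)
  have vsm: "vector_space (pm_scale (*) :: 'k \<Rightarrow> ('g gmap \<Rightarrow>\<^sub>0 'k) \<Rightarrow> _)"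
    by (intro vector_space_pm_scale vector_space_mult)
  have Fob: "fobj (?F j) S = {x. Poly_Mapping.keys x \<subseteq> Hom {1..d j} S}" for j S by (simp add: fig_M_def)
  have Fmp: "fmap (?F j) S T f = push (comp {1..d j} f)" for j S T f by (simp add: fig_M_def)
  have sub: "P.subspace (fobj ?D {1..n})" for n
  proof (rule subspace_dsum[OF vsm])
    fix j
    interpret M: fig_mod G "pm_scale (*) :: 'k \<Rightarrow> ('g gmap \<Rightarrow>\<^sub>0 'k) \<Rightarrow> _" "?F j"
      by unfold_locales (rule fig_module_M)
    show "M.V.subspace (fobj (?F j) {1..n})" by (rule M.ob_subspace)
  qed
  have eD: "?e j f \<in> fobj ?D {1..n}" if "j < N" "f \<in> Hom {1..d j} {1..n}" for j f n
    by (rule single_in_dsum) (use that in \<open>simp_all add: Fob\<close>)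
  have gD: "?e j (gid {1..d j}) \<in> fobj ?D {1..d j}" if "j < N" for j
    by (rule eD[OF that]) (rule gid_in_Hom, simp)
  have lin: "lin_map ?s (fobj ?D {1..n}) s (ob n) (\<eta> {1..n})" for n
    by (rule fig_module_hom_lin[OF hom]) simp
  have vj: "mp (d j) n f (v j) = \<eta> {1..n} (?e j f)" if j: "j < N" and f: "f \<in> Hom {1..d j} {1..n}" for j f n
  proof -
    have "fmap ?D {1..d j} {1..n} f (?e j (gid {1..d j})) = ?e j f"
    proof (rule poly_mapping_eqI)
      fix i
      have "Poly_Mapping.lookup (fmap ?D {1..d j} {1..n} f (?e j (gid {1..d j}))) i =
          fmap (?F i) {1..d j} {1..n} f (Poly_Mapping.lookup (?e j (gid {1..d j})) i)"
        by (rule lookup_fmap_dsum) (simp add: Fmp push_zero)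
      also have "\<dots> = Poly_Mapping.lookup (?e j f) i"
        unfolding Fmp using comp_gid_right[OF f]
          by (cases "i = j") (simp_all add: lookup_single push_single push_zero del: One_nat_def)
      finally show "Poly_Mapping.lookup (fmap ?D {1..d j} {1..n} f (?e j (gid {1..d j}))) i = Poly_Mapping.lookup (?e j f) i" .
    qed
    then show ?thesis
      unfolding v_def using fig_module_hom_nat[OF hom _ _ f gD[OF j]] by simp
  qed
  have "generated e {..<N} d v"
    unfolding generated_def
  proof (intro conjI ballI allI)
    fix j assume "j \<in> {..<N}"
    then show "d j \<le> e" "v j \<in> ob (d j)"
      unfolding v_def using d gD lin_map_in[OF lin] by blast+
  next
    fix n
    let ?V = "(\<lambda>(j, f). mp (d j) n f (v j)) ` (SIGMA j:{..<N}. Hom {1..d j} {1..n})"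
    show "V.span ?V = ob n"
    proof (rule V.span_subspace[OF _ _ ob_subspace])
      show "?V \<subseteq> ob n"
      proof
        fix z assume "z \<in> ?V"
        then obtain j f where f: "j < N" "f \<in> Hom {1..d j} {1..n}" "z = mp (d j) n f (v j)"
          by (elim imageE SigmaE) simp
        show "z \<in> ob n" unfolding f(3) vj[OF f(1,2)] by (rule lin_map_in[OF lin eD[OF f(1,2)]])
      qed
      show "ob n \<subseteq> V.span ?V"
      proof
        fix y assume "y \<in> ob n"
        then have "y \<in> \<eta> {1..n} ` fobj ?D {1..n}" using surj by (simp add: fig_surj_def)
        then obtain x where x: "x \<in> fobj ?D {1..n}" "y = \<eta> {1..n} x" by blast
        have kx: "Poly_Mapping.keys x \<subseteq> {..<N}" and lx: "\<And>j. j < N \<Longrightarrow> Poly_Mapping.keys (Poly_Mapping.lookup x j) \<subseteq> Hom {1..d j} {1..n}"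
          using x(1) by (auto simp: fig_dsum_def Fob)
        have finH: "finite (Hom {1..d j} {1..n})" for j by (rule finite_Hom) auto
        let ?c = "\<lambda>j f. Poly_Mapping.lookup (Poly_Mapping.lookup x j) f"
        have "x = (\<Sum>j\<in>{..<N}. Poly_Mapping.single j (Poly_Mapping.lookup x j))"
          by (rule poly_mapping_sum_single[symmetric]) (use kx in auto)
        also have "\<dots> = (\<Sum>j\<in>{..<N}. \<Sum>f\<in>Hom {1..d j} {1..n}. ?s (?c j f) (?e j f))"
        proof (rule sum.cong[OF refl])
          fix j assume "j \<in> {..<N}"
          then have eq: "Poly_Mapping.lookup x j = (\<Sum>f\<in>Hom {1..d j} {1..n}. Poly_Mapping.single f (?c j f))"
            using lx by (intro poly_mapping_sum_single[symmetric] finH) auto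
          have "Poly_Mapping.single j (Poly_Mapping.lookup x j) =
              Poly_Mapping.single j (\<Sum>f\<in>Hom {1..d j} {1..n}. Poly_Mapping.single f (?c j f))"
            by (rule arg_cong[OF eq])
          also have "\<dots> = (\<Sum>f\<in>Hom {1..d j} {1..n}. Poly_Mapping.single j (Poly_Mapping.single f (?c j f)))"
            by (rule single_sum)
          also have "\<dots> = (\<Sum>f\<in>Hom {1..d j} {1..n}. ?s (?c j f) (?e j f))"
            by (intro sum.cong refl)
              (simp add: pm_scale_single[OF vector_space_module[OF vsm]] pm_scale_single[OF module_mult])
          finally show "Poly_Mapping.single j (Poly_Mapping.lookup x j) = \<dots>" .
        qed
        finally have xs: "x = (\<Sum>j\<in>{..<N}. \<Sum>f\<in>Hom {1..d j} {1..n}. ?s (?c j f) (?e j f))" .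
        have "y = (\<Sum>j\<in>{..<N}. \<eta> {1..n} (\<Sum>f\<in>Hom {1..d j} {1..n}. ?s (?c j f) (?e j f)))"
          unfolding x(2) by (subst xs, rule lin_map_sum[OF lin P.module_axioms sub])
            (intro P.subspace_sum[OF sub] P.subspace_scale[OF sub] eD; simp only: lessThan_iff)
        also have "\<dots> = (\<Sum>j\<in>{..<N}. \<Sum>f\<in>Hom {1..d j} {1..n}. s (?c j f) (\<eta> {1..n} (?e j f)))"
        proof (rule sum.cong[OF refl])
          fix j assume j: "j \<in> {..<N}"
          have "\<eta> {1..n} (\<Sum>f\<in>Hom {1..d j} {1..n}. ?s (?c j f) (?e j f)) = (\<Sum>f\<in>Hom {1..d j} {1..n}. \<eta> {1..n} (?s (?c j f) (?e j f)))"
            by (rule lin_map_sum[OF lin P.module_axioms sub]) (intro P.subspace_scale[OF sub] eD; use j in \<open>simp only: lessThan_iff\<close>)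
          also have "\<dots> = (\<Sum>f\<in>Hom {1..d j} {1..n}. s (?c j f) (\<eta> {1..n} (?e j f)))"
            by (intro sum.cong refl lin_map_scale[OF lin] eD) (use j in auto)
          finally show "\<eta> {1..n} (\<Sum>f\<in>Hom {1..d j} {1..n}. ?s (?c j f) (?e j f)) = \<dots>" .
        qed
        also have "\<dots> \<in> V.span ?V"
        proof (intro V.span_sum V.span_scale V.span_base)
          fix j f assume jf: "j \<in> {..<N}" "f \<in> Hom {1..d j} {1..n}"
          then show "\<eta> {1..n} (?e j f) \<in> ?V"
            by (intro image_eqI[of _ _ "(j, f)"]) (simp_all add: vj[simplified])
        qed
        finally show "y \<in> V.span ?V" .
      qed
    qed
  qed simp
  then show ?thesis by blast
qed

end

section \<open>Injectivity of \<open>up\<close> for submodules and quotients\<close>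

context finite_group
begin

lemma hom_avg:
  assumes X: "fig_mod G s X" and Y: "fig_mod G t Y" and hom: "fig_module_hom G s X t Y \<eta>" and x: "x \<in> fobj X {1..n}"
  shows "\<eta> {1..n} (fig_mod.avg G s X a n h x) = fig_mod.avg G t Y a n h (\<eta> {1..n} x)"
proof -
  interpret A: fig_mod G s X by fact
  interpret B: fig_mod G t Y by fact
  have l: "lin_map s (A.ob n) t (B.ob n) (\<eta> {1..n})" by (rule fig_module_hom_lin[OF hom]) simp
  have "\<eta> {1..n} (A.avg a n h x) = t (inverse (of_nat (card (stab {1..a} {1..n})))) (\<Sum>w\<in>cst a n h. \<eta> {1..n} (A.mp n n w x))"
    unfolding A.avg_def lin_map_scale[OF l A.sum_mp_in[OF x]]
    by (subst lin_map_sum[OF l A.V.module_axioms A.ob_subspace]) (intro A.mp_in A.cst_Wr x, assumption, rule refl)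
  also have "\<dots> = B.avg a n h (\<eta> {1..n} x)"
    unfolding B.avg_def
    by (intro arg_cong[where f = "t _"] sum.cong refl fig_module_hom_nat[OF hom _ _ _ x] A.cst_Wr) auto
  finally show ?thesis .
qed

lemma hom_up:
  assumes X: "fig_mod G s X" and Y: "fig_mod G t Y" and hom: "fig_module_hom G s X t Y \<eta>" and x: "x \<in> fobj X {1..n}"
  shows "\<eta> {1..Suc n} (fig_mod.up G s X a n x) = fig_mod.up G t Y a n (\<eta> {1..n} x)"
proof -
  interpret A: fig_mod G s X by fact
  interpret B: fig_mod G t Y by fact
  have "\<eta> {1..Suc n} (A.mp n (Suc n) (gid {1..n}) x) = B.mp n (Suc n) (gid {1..n}) (\<eta> {1..n} x)"
    by (rule fig_module_hom_nat[OF hom _ _ A.incl_Hom x]) auto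
  then show ?thesis
    unfolding A.up_def B.up_def hom_avg[OF X Y hom A.mp_in[OF A.incl_Hom x]] by simp
qed

text \<open>The constant \<open>c\<close> is the delay beyond \<open>a\<close>: 0 for relatively
  projective modules and their submodules, the degree of the relations for a quotient.\<close>

definition up_injective :: "('k::field_char_0 \<Rightarrow> 'v \<Rightarrow> 'v) \<Rightarrow> ('g, 'v::ab_group_add) fig_functor \<Rightarrow> nat \<Rightarrow> bool" where
  "up_injective s X c \<longleftrightarrow> (\<forall>a n. a + c \<le> n \<longrightarrow> (\<forall>x\<in>fobj X {1..n}.
     fig_mod.avg G s X a n (gid {1..a}) x = x \<longrightarrow> fig_mod.up G s X a n x = 0 \<longrightarrow> x = 0))"

text \<open>The inclusion is injective and commutes with \<open>avg\<close> and \<open>up\<close>,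
  so an invariant killed by \<open>up\<close> in \<open>K\<close> is one in
  \<open>P\<close>.\<close>

lemma up_injective_sub:
  assumes K: "fig_mod G u K" and P: "fig_mod G t P" and i: "fig_module_hom G u K t P \<iota>" "fig_inj K \<iota>"
    and inj: "up_injective t P c"
  shows "up_injective u K c"
  unfolding up_injective_def
proof (intro allI impI ballI)
  interpret K: fig_mod G u K by fact
  interpret P: fig_mod G t P by fact
  fix a n x assume n: "a + c \<le> n" and x: "x \<in> K.ob n" "K.avg a n (gid {1..a}) x = x" "K.up a n x = 0"
  have l: "lin_map u (K.ob n) t (P.ob n) (\<iota> {1..n})" for n by (rule fig_module_hom_lin[OF i(1)]) simp
  have z: "\<iota> {1..n} 0 = 0" for n by (rule lin_map_zero[OF l K.V.module_axioms K.ob_subspace])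
  have "\<iota> {1..n} x = 0"
  proof (rule inj[unfolded up_injective_def, rule_format, OF n])
    show "\<iota> {1..n} x \<in> P.ob n" by (rule lin_map_in[OF l x(1)])
    show "P.avg a n (gid {1..a}) (\<iota> {1..n} x) = \<iota> {1..n} x"
      using hom_avg[OF K P i(1) x(1), of a "gid {1..a}"] x(2) by simp
    show "P.up a n (\<iota> {1..n} x) = 0"
      using hom_up[OF K P i(1) x(1), of a] x(3) z by simp
  qed
  then have "\<iota> {1..n} x = \<iota> {1..n} 0" using z by simp
  moreover have "inj_on (\<iota> {1..n}) (K.ob n)" using i(2) by (simp add: fig_inj_def)
  ultimately show "x = 0" using x(1) K.V.subspace_0[OF K.ob_subspace] by (meson inj_onD)
qed

text \<open>Snake lemma: the cokernel of \<open>K \<rightarrow> P\<close> inherits injectivity where the map for \<open>K\<close> is onto.\<close>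

lemma up_injective_quotient:
  assumes K: "fig_mod G u K" and P: "fig_mod G t P" and V: "fig_mod G s V"
    and ex: "fig_short_exact G u K \<iota> t P \<pi> s V" and inj: "up_injective t P 0"
    and gen: "fig_mod.generated G u K r J d v"
  shows "up_injective s V r"
  unfolding up_injective_def
proof (intro allI impI ballI)
  interpret K: fig_mod G u K by fact
  interpret P: fig_mod G t P by fact
  interpret V: fig_mod G s V by fact
  have i: "fig_module_hom G u K t P \<iota>" and p: "fig_module_hom G t P s V \<pi>" and surj: "fig_surj P V \<pi>"
    and ker: "\<And>n. \<iota> {1..n} ` K.ob n = {x \<in> P.ob n. \<pi> {1..n} x = 0}"
    using ex by (auto simp: fig_short_exact_def)
  fix a n x assume n: "a + r \<le> n" and x: "x \<in> V.ob n" "V.avg a n (gid {1..a}) x = x" "V.up a n x = 0"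
  let ?e = "gid {1..a}"
  have an: "a \<le> n" and aS: "a \<le> Suc n" using n by auto
  have il: "lin_map u (K.ob n) t (P.ob n) (\<iota> {1..n})" for n by (rule fig_module_hom_lin[OF i]) simp
  have "x \<in> \<pi> {1..n} ` P.ob n" using surj x(1) by (simp add: fig_surj_def)
  then obtain y0 where y0: "y0 \<in> P.ob n" "\<pi> {1..n} y0 = x" by blast
  \<comment> \<open>The lift of \<open>x\<close> is averaged to become invariant; it remains a lift
    since \<open>x\<close> is invariant.\<close>
  define y where "y = P.avg a n ?e y0"
  have y: "y \<in> P.ob n" unfolding y_def by (rule P.avg_in[OF y0(1)])
  have py: "\<pi> {1..n} y = x" unfolding y_def hom_avg[OF P V p y0(1)] y0(2) by (rule x(2))
  have ey: "P.avg a n ?e y = y" unfolding y_def by (rule P.avg_unit(1)[OF an P.gid_Wr y0(1)])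
  have "\<pi> {1..Suc n} (P.up a n y) = 0" unfolding hom_up[OF P V p y] py by (rule x(3))
  then have "P.up a n y \<in> \<iota> {1..Suc n} ` K.ob (Suc n)" unfolding ker using P.up_in[OF y] by simp
  then obtain z where z: "z \<in> K.ob (Suc n)" "P.up a n y = \<iota> {1..Suc n} z" by blast
  \<comment> \<open>This is where the bound \<open>a + r\<close> enters: the map of \<open>K\<close>
    on invariants is onto.\<close>
  obtain z0 where z0: "z0 \<in> K.ob n" "K.up a n z0 = K.avg a (Suc n) ?e z"
    using K.up_surj[OF gen n z(1)] by blast
  define z' where "z' = K.avg a n ?e z0"
  have z': "z' \<in> K.ob n" unfolding z'_def by (rule K.avg_in[OF z0(1)])
  have ez': "K.avg a n ?e z' = z'" unfolding z'_def by (rule K.avg_unit(1)[OF an K.gid_Wr z0(1)])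
  have uz': "K.up a n z' = K.avg a (Suc n) ?e z"
    unfolding z'_def K.up_avg[OF an K.gid_Wr z0(1)] z0(2) by (rule K.avg_unit(1)[OF aS K.gid_Wr z(1)])
  have iz': "\<iota> {1..n} z' \<in> P.ob n" by (rule lin_map_in[OF il z'])
  have "P.up a n (\<iota> {1..n} z') = P.up a n y"
  proof -
    have "P.up a n (\<iota> {1..n} z') = \<iota> {1..Suc n} (K.avg a (Suc n) ?e z)"
      unfolding uz'[symmetric] hom_up[OF K P i z'] ..
    also have "\<dots> = P.avg a (Suc n) ?e (P.up a n y)"
      unfolding z(2) by (rule hom_avg[OF K P i z(1)])
    also have "\<dots> = P.up a n y"
      unfolding P.up_avg[OF an P.gid_Wr y, symmetric] ey ..
    finally show ?thesis .
  qed
  \<comment> \<open>The corrected lift is invariant and killed by \<open>up\<close>, hence zero, so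
    \<open>y\<close> comes from \<open>K\<close> and maps to zero.\<close>
  then have "P.up a n (y - \<iota> {1..n} z') = 0"
    using lin_map_minus[OF P.up_lin P.V.module_axioms P.ob_subspace y iz'] by simp
  moreover have "P.avg a n ?e (y - \<iota> {1..n} z') = y - \<iota> {1..n} z'"
    using lin_map_minus[OF P.avg_lin P.V.module_axioms P.ob_subspace y iz'] ey
      hom_avg[OF K P i z', of a ?e] ez' by simp
  moreover have "y - \<iota> {1..n} z' \<in> P.ob n" by (rule P.V.subspace_diff[OF P.ob_subspace y iz'])
  ultimately have "y - \<iota> {1..n} z' = 0"
    using inj[unfolded up_injective_def, rule_format, of a n "y - \<iota> {1..n} z'"] an by simp
  then have "y \<in> \<iota> {1..n} ` K.ob n" using z' by simp
  then show "x = 0" unfolding ker using py by simp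
qed

text \<open>The index type is free so that both \<open>idx e\<close> and the pairs coming from a
  relatively projective module fit. For infinite \<open>I\<close> the claim holds as well, since the
  sums are then 0 by convention.\<close>

lemma cnt_combination_polyfun:
  fixes q :: "'i \<Rightarrow> 'k::field_char_0"
  assumes "\<forall>p\<in>I. a p \<le> e \<and> h p \<in> Wr (a p)"
  shows "\<exists>F. polyfun ({1..} \<times> conjugacy_classes G) fst e F \<and>
    (\<forall>n. \<forall>g\<in>Wr n. (\<Sum>p\<in>I. q p * of_nat (cnt {1..a p} (h p) {1..n} g)) = F (\<lambda>(i, C). of_nat (labeled_cycles G n i C g)))"
proof -
  have "\<exists>F :: (nat \<times> 'g set \<Rightarrow> 'k) \<Rightarrow> 'k. polyfun ({1..} \<times> conjugacy_classes G) fst e F \<and>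
    (\<forall>n. \<forall>g\<in>Wr n. of_nat (cnt {1..a p} (h p) {1..n} g) = F (\<lambda>(i, C). of_nat (labeled_cycles G n i C g)))"
    if p: "p \<in> I" for p
  proof -
    have hp: "h p \<in> Wr (a p)" and ap: "card {1..a p} \<le> e" using bspec[OF assms p] by auto
    show ?thesis using cnt_polyfun[OF finite_atLeastAtMost hp] polyfun_mono[OF _ ap] by blast
  qed
  then obtain F :: "'i \<Rightarrow> (nat \<times> 'g set \<Rightarrow> 'k) \<Rightarrow> 'k" where
    F: "\<And>p. p \<in> I \<Longrightarrow> polyfun ({1..} \<times> conjugacy_classes G) fst e (F p)"
    "\<And>p n g. p \<in> I \<Longrightarrow> g \<in> Wr n \<Longrightarrow>
      of_nat (cnt {1..a p} (h p) {1..n} g) = F p (\<lambda>(i, C). of_nat (labeled_cycles G n i C g))"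
    by metis
  show ?thesis
  proof (intro exI[of _ "\<lambda>v. \<Sum>p\<in>I. q p * F p v"] conjI allI ballI)
    show "polyfun ({1..} \<times> conjugacy_classes G) fst e (\<lambda>v. \<Sum>p\<in>I. q p * F p v)"
      by (intro polyfun_sum polyfun_scale F(1))
  qed (simp add: F(2) del: One_nat_def)
qed

end


section \<open>Relatively projective modules\<close>

locale rel_proj = fig_mod G s X
  for G :: "('g, 'b) monoid_scheme" (structure) and s :: "'k::field_char_0 \<Rightarrow> 'v::ab_group_add \<Rightarrow> 'v"
    and X :: "('g, 'v) fig_functor" +
  fixes su :: "'k \<Rightarrow> 'u::ab_group_add \<Rightarrow> 'u" and I :: "'i set" and m :: "'i \<Rightarrow> nat" and U :: "'i \<Rightarrow> 'u set"
    and \<rho> :: "'i \<Rightarrow> 'g gmap \<Rightarrow> 'u \<Rightarrow> 'u" and \<theta> :: "nat set \<Rightarrow> 'v \<Rightarrow> ('i \<Rightarrow>\<^sub>0 'g gmap \<Rightarrow>\<^sub>0 'u)"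
  assumes su: "vector_space su" and rep: "\<And>i. i \<in> I \<Longrightarrow> group_rep (wreath G (m i)) su (U i) (\<rho> i)"
    and hom: "fig_module_hom G s X (pm_scale (pm_scale su)) (fig_dsum I (\<lambda>i. fig_Ind G (m i) (U i) (\<rho> i))) \<theta>"
    and inj: "fig_inj X \<theta>" and surj: "fig_surj X (fig_dsum I (\<lambda>i. fig_Ind G (m i) (U i) (\<rho> i))) \<theta>"
begin

abbreviation "Ind i \<equiv> fig_Ind G (m i) (U i) (\<rho> i)"
abbreviation "D \<equiv> fig_dsum I Ind"
abbreviation "M i \<equiv> {1..m i}"
abbreviation "sD \<equiv> pm_scale (pm_scale su) :: 'k \<Rightarrow> ('i \<Rightarrow>\<^sub>0 'g gmap \<Rightarrow>\<^sub>0 'u) \<Rightarrow> _"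

sublocale U: vector_space su by (rule su)
sublocale UU: vector_space "pm_scale su :: 'k \<Rightarrow> ('g gmap \<Rightarrow>\<^sub>0 'u) \<Rightarrow> _" by (rule vector_space_pm_scale[OF su])
sublocale UUU: vector_space sD by (rule vector_space_pm_scale[OF UU.vector_space_axioms])

lemma rep_facts:
  assumes "i \<in> I"
  shows "U.subspace (U i)" "\<And>w. w \<in> Wr (m i) \<Longrightarrow> lin_map su (U i) su (U i) (\<rho> i w)"
    "\<And>u. u \<in> U i \<Longrightarrow> \<rho> i (gid (M i)) u = u"
    "\<And>w w' u. w \<in> Wr (m i) \<Longrightarrow> w' \<in> Wr (m i) \<Longrightarrow> u \<in> U i \<Longrightarrow> \<rho> i (comp (M i) w w') u = \<rho> i w (\<rho> i w' u)"
proof -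
  have 1: "carrier (wreath G n) = Wr n" "x \<otimes>\<^bsub>wreath G n\<^esub> y = comp {1..n} x y" "\<one>\<^bsub>wreath G n\<^esub> = gid {1..n}" for n x y
    by (simp_all add: wreath_def)
  note r = rep[OF assms, unfolded group_rep_def 1]
  show "U.subspace (U i)" "\<And>w. w \<in> Wr (m i) \<Longrightarrow> lin_map su (U i) su (U i) (\<rho> i w)"
    "\<And>u. u \<in> U i \<Longrightarrow> \<rho> i (gid (M i)) u = u"
    "\<And>w w' u. w \<in> Wr (m i) \<Longrightarrow> w' \<in> Wr (m i) \<Longrightarrow> u \<in> U i \<Longrightarrow> \<rho> i (comp (M i) w w') u = \<rho> i w (\<rho> i w' u)"
    using r by blast+
qed

lemma rho_ginv:
  assumes "i \<in> I" "w \<in> Wr (m i)" "u \<in> U i"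
  shows "\<rho> i (ginv (M i) w) (\<rho> i w u) = u" "\<rho> i w (\<rho> i (ginv (M i) w) u) = u"
proof -
  have w: "ginv (M i) w \<in> Wr (m i)" by (rule ginv(1)[OF _ assms(2)]) simp
  show "\<rho> i (ginv (M i) w) (\<rho> i w u) = u"
    using rep_facts(4)[OF assms(1) w assms(2,3)] ginv(2)[OF _ assms(2)] rep_facts(3)[OF assms(1,3)] by simp
  show "\<rho> i w (\<rho> i (ginv (M i) w) u) = u"
    using rep_facts(4)[OF assms(1,2) w assms(3)] ginv(3)[OF _ assms(2)] rep_facts(3)[OF assms(1,3)] by simp
qed

lemma Ind_ob: "\<phi> \<in> fobj (Ind i) S \<longleftrightarrow> Poly_Mapping.keys \<phi> \<subseteq> Hom (M i) S \<and>
    (\<forall>f\<in>Hom (M i) S. Poly_Mapping.lookup \<phi> f \<in> U i \<and>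
      (\<forall>w\<in>Wr (m i). \<rho> i w (Poly_Mapping.lookup \<phi> (comp (M i) f w)) = Poly_Mapping.lookup \<phi> f))"
  unfolding fig_Ind_def wreath_def by simp

lemma D_ob: "x \<in> fobj D S \<longleftrightarrow> Poly_Mapping.keys x \<subseteq> I \<and> (\<forall>i\<in>I. Poly_Mapping.lookup x i \<in> fobj (Ind i) S)"
  unfolding fig_dsum_def by simp

lemma lookup_D: "Poly_Mapping.lookup (fmap D S T f x) i = push (comp (M i) f) (Poly_Mapping.lookup x i)"
proof -
  have e: "fmap (Ind j) S T f = push (comp (M j) f)" for j by (simp add: fig_Ind_def)
  show ?thesis by (subst lookup_fmap_dsum) (simp_all add: e push_zero)
qed

lemma theta_lin: "lin_map s (ob n) sD (fobj D {1..n}) (\<theta> {1..n})"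
  by (rule fig_module_hom_lin[OF hom]) simp

lemma theta_nat: "f \<in> Hom {1..j} {1..n} \<Longrightarrow> x \<in> ob j \<Longrightarrow> \<theta> {1..n} (mp j n f x) = fmap D {1..j} {1..n} f (\<theta> {1..j} x)"
  by (rule fig_module_hom_nat[OF hom]) simp_all

lemma theta_inj: "x \<in> ob n \<Longrightarrow> y \<in> ob n \<Longrightarrow> \<theta> {1..n} x = \<theta> {1..n} y \<Longrightarrow> x = y"
  using inj unfolding fig_inj_def by (meson finite_atLeastAtMost inj_onD)

lemma theta_image: "\<theta> {1..n} ` ob n = fobj D {1..n}"
  using surj by (simp add: fig_surj_def)

lemma theta_zero: "\<theta> {1..n} 0 = 0"
  by (rule lin_map_zero[OF theta_lin V.module_axioms ob_subspace])

text \<open>The isomorphism \<open>\<theta>\<close> turns elements into families of functions on the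
  maps from \<open>[m i]\<close> to \<open>[n]\<close>, and \<open>function_up_inj\<close> applies
  in every component. It asks only for \<open>a \<le> n\<close>, so there is no delay.\<close>

lemma up_injective_X: "up_injective s X 0"
  unfolding up_injective_def
proof (intro allI impI ballI)
  fix a n x assume an: "a + 0 \<le> n" and x: "x \<in> ob n" "avg a n (gid {1..a}) x = x" "up a n x = 0"
  have a: "a \<le> n" using an by simp
  let ?S = "stab {1..a} {1..Suc n}" and ?y = "\<theta> {1..n} x" and ?x = "mp n (Suc n) (gid {1..n}) x"
  have ix: "?x \<in> ob (Suc n)" by (rule mp_in[OF incl_Hom x(1)])
  have yD: "?y \<in> fobj D {1..n}" by (rule lin_map_in[OF theta_lin x(1)])
  have "card ?S \<noteq> 0" using card_stab_pos[of "{1..Suc n}" "{1..a}"] a by auto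
  then have s0: "(\<Sum>w\<in>?S. mp (Suc n) (Suc n) w ?x) = 0"
    using x(3) unfolding up_def avg_def cst_gid V.scale_eq_0_iff by simp
  have wS: "w \<in> Wr (Suc n)" if "w \<in> ?S" for w using that by (simp add: stab_def)
  have "(\<Sum>w\<in>?S. fmap D {1..Suc n} {1..Suc n} w (fmap D {1..n} {1..Suc n} (gid {1..n}) ?y)) =
      (\<Sum>w\<in>?S. \<theta> {1..Suc n} (mp (Suc n) (Suc n) w ?x))"
    by (intro sum.cong refl) (simp only: theta_nat[OF wS ix] theta_nat[OF incl_Hom x(1)])
  also have "\<dots> = \<theta> {1..Suc n} (\<Sum>w\<in>?S. mp (Suc n) (Suc n) w ?x)"
    by (rule lin_map_sum[OF theta_lin V.module_axioms ob_subspace, symmetric]) (rule mp_in[OF wS ix])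
  finally have z: "(\<Sum>w\<in>?S. fmap D {1..Suc n} {1..Suc n} w (fmap D {1..n} {1..Suc n} (gid {1..n}) ?y)) = 0"
    unfolding s0 theta_zero .
  have "?y = 0"
  proof (rule poly_mapping_eqI)
    fix i
    show "Poly_Mapping.lookup ?y i = Poly_Mapping.lookup 0 i"
    proof (cases "i \<in> I")
      case False
      then show ?thesis using yD unfolding D_ob by (auto simp: in_keys_iff)
    next
      case True
      have "Poly_Mapping.lookup ?y i = 0"
      proof (rule function_up_inj[OF su _ a])
        show "finite (M i)" by simp
        show "Poly_Mapping.keys (Poly_Mapping.lookup ?y i) \<subseteq> Hom (M i) {1..n}"
          using yD True unfolding D_ob Ind_ob by blast
        show "push (comp (M i) w) (Poly_Mapping.lookup ?y i) = Poly_Mapping.lookup ?y i" if "w \<in> stab {1..a} {1..n}" for w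
        proof -
          have w: "w \<in> cst a n (gid {1..a})" using that unfolding cst_gid .
          have "mp n n w (avg a n (gid {1..a}) x) = avg a n (gid {1..a}) x"
            unfolding avg_post[OF a gid_Wr gid_Wr w x(1)] comp_gid_left[OF gid_Wr] ..
          then have "fmap D {1..n} {1..n} w ?y = ?y"
            unfolding x(2) using theta_nat[OF cst_Wr[OF w] x(1)] by simp
          then show ?thesis using lookup_D[of "{1..n}" "{1..n}" w ?y i] by simp
        qed
        have "Poly_Mapping.lookup (\<Sum>w\<in>?S. fmap D {1..Suc n} {1..Suc n} w (fmap D {1..n} {1..Suc n} (gid {1..n}) ?y)) i = 0"
          unfolding z by simp
        then show "(\<Sum>w\<in>?S. push (comp (M i) w) (push (comp (M i) (gid {1..n})) (Poly_Mapping.lookup ?y i))) = 0"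
          unfolding lookup_sum lookup_D .
      qed
      then show ?thesis by simp
    qed
  qed
  then show "x = 0" using theta_inj[OF x(1) V.subspace_0[OF ob_subspace]] theta_zero by simp
qed

text \<open>The function supported on the orbit \<open>f W\<close> with value \<open>u\<close> at \<open>f\<close>.\<close>

definition orbit_fun :: "'i \<Rightarrow> 'g gmap \<Rightarrow> 'u \<Rightarrow> ('g gmap \<Rightarrow>\<^sub>0 'u)" where
  "orbit_fun i f u = (\<Sum>w\<in>Wr (m i). Poly_Mapping.single (comp (M i) f w) (\<rho> i (ginv (M i) w) u))"

lemma lookup_orbit_fun:
  "Poly_Mapping.lookup (orbit_fun i f u) f' = (\<Sum>w\<in>Wr (m i). if comp (M i) f w = f' then \<rho> i (ginv (M i) w) u else 0)"
  unfolding orbit_fun_def lookup_sum lookup_single when_def ..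

lemma ginv_in: "w \<in> Wr n \<Longrightarrow> ginv {1..n} w \<in> Wr n"
  by (rule ginv(1)) simp_all

text \<open>Equivariance comes from the substitution \<open>w \<mapsto> w v\<close> in the defining
  sum.\<close>

lemma orbit_fun_in_Ind:
  assumes i: "i \<in> I" and f: "f \<in> Hom (M i) S" and u: "u \<in> U i"
  shows "orbit_fun i f u \<in> fobj (Ind i) S"
  unfolding Ind_ob
proof (intro conjI ballI)
  note sub = rep_facts(1)[OF i]
  have \<rho>u: "\<rho> i (ginv (M i) w) u \<in> U i" if "w \<in> Wr (m i)" for w
    by (rule lin_map_in[OF rep_facts(2)[OF i ginv_in[OF that]] u])
  show "Poly_Mapping.keys (orbit_fun i f u) \<subseteq> Hom (M i) S"
  proof
    fix f' assume "f' \<in> Poly_Mapping.keys (orbit_fun i f u)"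
    then have "(\<Sum>w\<in>Wr (m i). if comp (M i) f w = f' then \<rho> i (ginv (M i) w) u else 0) \<noteq> 0"
      unfolding in_keys_iff lookup_orbit_fun .
    then obtain w where "w \<in> Wr (m i)" "comp (M i) f w = f'"
      by (elim sum.not_neutral_contains_not_neutral) (simp split: if_splits)
    then show "f' \<in> Hom (M i) S" using comp_in_Hom[OF _ f] by blast
  qed
  fix f' assume f': "f' \<in> Hom (M i) S"
  show "Poly_Mapping.lookup (orbit_fun i f u) f' \<in> U i"
    unfolding lookup_orbit_fun
    by (rule U.subspace_sum[OF sub]) (simp add: \<rho>u[simplified] U.subspace_0[OF sub])
  fix v assume v: "v \<in> Wr (m i)"
  have "\<rho> i v (Poly_Mapping.lookup (orbit_fun i f u) (comp (M i) f' v)) =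
      (\<Sum>w\<in>Wr (m i). \<rho> i v (if comp (M i) f w = comp (M i) f' v then \<rho> i (ginv (M i) w) u else 0))"
    unfolding lookup_orbit_fun
    by (rule lin_map_sum[OF rep_facts(2)[OF i v] U.module_axioms sub]) (simp add: \<rho>u[simplified] U.subspace_0[OF sub])
  also have "\<dots> = (\<Sum>w\<in>Wr (m i). \<rho> i v (if comp (M i) f (comp (M i) w v) = comp (M i) f' v then \<rho> i (ginv (M i) (comp (M i) w v)) u else 0))"
    by (rule sum.reindex_bij_betw[OF bij_comp_right[OF _ v],
          of "\<lambda>w. \<rho> i v (if comp (M i) f w = comp (M i) f' v then \<rho> i (ginv (M i) w) u else 0)", symmetric]) simp
  also have "\<dots> = (\<Sum>w\<in>Wr (m i). if comp (M i) f w = f' then \<rho> i (ginv (M i) w) u else 0)"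
  proof (rule sum.cong[OF refl])
    fix w assume w: "w \<in> Wr (m i)"
    have fw: "comp (M i) f w \<in> Hom (M i) S" by (rule comp_in_Hom[OF w f])
    have wv: "comp (M i) w v \<in> Wr (m i)" by (rule comp_in_Hom[OF v w])
    have eq: "comp (M i) f (comp (M i) w v) = comp (M i) f' v \<longleftrightarrow> comp (M i) f w = f'"
      unfolding comp_assoc[OF v w f, symmetric] using comp_right_cancel[OF _ v fw f'] by auto
    have "\<rho> i v (\<rho> i (ginv (M i) (comp (M i) w v)) u) = \<rho> i (ginv (M i) w) u"
    proof -
      let ?x = "\<rho> i (ginv (M i) (comp (M i) w v)) u"
      have x: "?x \<in> U i" by (rule \<rho>u[OF wv])
      have "\<rho> i w (\<rho> i v ?x) = u"
        using rep_facts(4)[OF i w v x] rho_ginv(2)[OF i wv u] by simp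
      then show ?thesis
        using rho_ginv(1)[OF i w lin_map_in[OF rep_facts(2)[OF i v] x]] by simp
    qed
    moreover have "\<rho> i v 0 = 0" by (rule lin_map_zero[OF rep_facts(2)[OF i v] U.module_axioms sub])
    ultimately show "\<rho> i v (if comp (M i) f (comp (M i) w v) = comp (M i) f' v then \<rho> i (ginv (M i) (comp (M i) w v)) u else 0)
        = (if comp (M i) f w = f' then \<rho> i (ginv (M i) w) u else 0)"
      unfolding eq by simp
  qed
  finally show "\<rho> i v (Poly_Mapping.lookup (orbit_fun i f u) (comp (M i) f' v)) = Poly_Mapping.lookup (orbit_fun i f u) f'"
    unfolding lookup_orbit_fun .
qed

lemma finite_Wr: "finite (Wr n)"
  by (rule finite_Hom) auto

lemma ginv_gid: "ginv {1..n} (gid {1..n}) = gid {1..n}"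
  using ginv(2)[OF _ gid_Wr] comp_gid_right[OF ginv(1)[OF _ gid_Wr]] by simp

text \<open>At the identity of \<open>[m i]\<close> only the summand of the identity
  contributes.\<close>

lemma lookup_orbit_fun_base:
  assumes "i \<in> I" "u \<in> U i"
  shows "Poly_Mapping.lookup (orbit_fun i (gid (M i)) u) (gid (M i)) = u"
proof -
  have "Poly_Mapping.lookup (orbit_fun i (gid (M i)) u) (gid (M i)) =
      (\<Sum>w\<in>Wr (m i). if w = gid (M i) then \<rho> i (ginv (M i) w) u else 0)"
    unfolding lookup_orbit_fun by (rule sum.cong[OF refl]) (simp only: comp_gid_left)
  also have "\<dots> = \<rho> i (ginv (M i) (gid (M i))) u"
    using finite_Wr[of "m i"] gid_Wr[of "m i"] by simp
  also have "\<dots> = u" unfolding ginv_gid by (rule rep_facts(3)[OF assms])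
  finally show ?thesis .
qed

lemma zero_in_Ind: "i \<in> I \<Longrightarrow> 0 \<in> fobj (Ind i) S"
  unfolding Ind_ob using U.subspace_0[OF rep_facts(1)] lin_map_zero[OF rep_facts(2) U.module_axioms rep_facts(1)] by simp

lemma orbit_fun_in_D:
  assumes "i \<in> I" "f \<in> Hom (M i) S" "u \<in> U i"
  shows "Poly_Mapping.single i (orbit_fun i f u) \<in> fobj D S"
  by (rule single_in_dsum, rule assms(1), rule orbit_fun_in_Ind[OF assms], rule zero_in_Ind)

lemma Hom_empty: "j < n \<Longrightarrow> Hom {1..n} {1..j} = {}"
proof (rule equals0I)
  fix f assume j: "j < n" and f: "f \<in> Hom {1..n} {1..j}"
  have "card {1..n} \<le> card {1..j}"
    by (rule card_inj_on_le[OF HomD(3)[OF f]]) (use HomD(1)[OF f] in auto)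
  then show False using j by simp
qed

text \<open>An element induced from \<open>[j]\<close> with \<open>j \<le> e < m i\<close> has zero
  component at \<open>i\<close>, as there is no map from \<open>[m i]\<close> to \<open>[j]\<close>.
  Since such elements span degree \<open>m i\<close>, the function \<open>orbit_fun\<close> of any
  \<open>u\<close> must vanish there, and its value at the identity is \<open>u\<close>.\<close>

lemma U_trivial:
  assumes span: "\<And>n. ob n \<subseteq> V.span {mp j n f y | j f y. j \<le> e \<and> f \<in> Hom {1..j} {1..n} \<and> y \<in> ob j}"
    and i: "i \<in> I" "e < m i"
  shows "U i = {0}"
proof -
  let ?n = "m i"
  let ?W = "{x \<in> ob ?n. Poly_Mapping.lookup (\<theta> (M i) x) i = 0}"
  have "V.subspace ?W"
  proof (rule V.subspaceI)
    show "0 \<in> ?W" using V.subspace_0[OF ob_subspace] theta_zero by simp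
    fix x y c assume x: "x \<in> ?W"
    then have xo: "x \<in> ob ?n" by simp
    show "s c x \<in> ?W"
      using x V.subspace_scale[OF ob_subspace xo] lin_map_scale[OF theta_lin xo]
      by (simp add: lookup_pm_scale[OF UU.module_axioms])
    assume y: "y \<in> ?W"
    then have yo: "y \<in> ob ?n" by simp
    show "x + y \<in> ?W"
      using x y V.subspace_add[OF ob_subspace xo yo] lin_map_add[OF theta_lin xo yo] by (simp add: lookup_add)
  qed
  moreover have "{mp j ?n f y | j f y. j \<le> e \<and> f \<in> Hom {1..j} {1..?n} \<and> y \<in> ob j} \<subseteq> ?W"
  proof
    fix z assume "z \<in> {mp j ?n f y | j f y. j \<le> e \<and> f \<in> Hom {1..j} {1..?n} \<and> y \<in> ob j}"
    then obtain j f y where z: "z = mp j ?n f y" "j \<le> e" "f \<in> Hom {1..j} {1..?n}" "y \<in> ob j" by blast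
    have "Poly_Mapping.lookup (\<theta> {1..j} y) i \<in> fobj (Ind i) {1..j}"
      using lin_map_in[OF theta_lin z(4)] i(1) unfolding D_ob by blast
    then have "Poly_Mapping.keys (Poly_Mapping.lookup (\<theta> {1..j} y) i) \<subseteq> {}"
      unfolding Ind_ob using Hom_empty[of j "m i"] i(2) z(2) by simp
    then have "Poly_Mapping.lookup (\<theta> {1..j} y) i = 0" by simp
    then have "Poly_Mapping.lookup (\<theta> (M i) z) i = 0"
      unfolding z(1) theta_nat[OF z(3,4)] lookup_D by (simp add: push_zero)
    then show "z \<in> ?W" using mp_in[OF z(3,4)] z(1) by simp
  qed
  ultimately have W: "ob ?n \<subseteq> ?W" using span[of ?n] V.span_minimal by blast
  have "u = 0" if u: "u \<in> U i" for u
  proof -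
    have "Poly_Mapping.single i (orbit_fun i (gid (M i)) u) \<in> \<theta> (M i) ` ob ?n"
      unfolding theta_image by (rule orbit_fun_in_D[OF i(1) gid_Wr u])
    then obtain x where x: "x \<in> ob ?n" "\<theta> (M i) x = Poly_Mapping.single i (orbit_fun i (gid (M i)) u)" by force
    then have "orbit_fun i (gid (M i)) u = 0" using W by force
    then show ?thesis using lookup_orbit_fun_base[OF i(1) u] by simp
  qed
  then show ?thesis using U.subspace_0[OF rep_facts(1)[OF i(1)]] by blast
qed

text \<open>Evaluation at the identity of \<open>[m i]\<close> maps degree \<open>m i\<close> of
  \<open>X\<close> onto \<open>U i\<close>; the functions \<open>orbit_fun\<close> provide
  preimages.\<close>

lemma U_fin_dim:
  assumes fd: "\<And>n. fin_dim s (ob n)" and i: "i \<in> I"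
  shows "fin_dim su (U i)"
proof -
  let ?ev = "\<lambda>x. Poly_Mapping.lookup (Poly_Mapping.lookup (\<theta> (M i) x) i) (gid (M i))"
  have in_U: "?ev x \<in> U i" if "x \<in> ob (m i)" for x
    using lin_map_in[OF theta_lin that] i gid_Wr unfolding D_ob Ind_ob by blast
  have l: "lin_map s (ob (m i)) su (U i) ?ev"
  proof (rule lin_mapI)
    fix x y assume "x \<in> ob (m i)" "y \<in> ob (m i)"
    then show "?ev (x + y) = ?ev x + ?ev y" using lin_map_add[OF theta_lin, of x "m i" y] by (simp add: lookup_add)
  next
    fix c x assume "x \<in> ob (m i)"
    then show "?ev (s c x) = su c (?ev x)"
      using lin_map_scale[OF theta_lin, of x "m i" c]
      by (simp add: lookup_pm_scale[OF UU.module_axioms] lookup_pm_scale[OF U.module_axioms])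
  qed (rule in_U)
  have "?ev ` ob (m i) = U i"
  proof (intro equalityI subsetI)
    fix u assume u: "u \<in> U i"
    have "Poly_Mapping.single i (orbit_fun i (gid (M i)) u) \<in> \<theta> (M i) ` ob (m i)"
      unfolding theta_image by (rule orbit_fun_in_D[OF i gid_Wr u])
    then obtain x where x: "x \<in> ob (m i)" "\<theta> (M i) x = Poly_Mapping.single i (orbit_fun i (gid (M i)) u)" by force
    have "?ev x = u" unfolding x(2) using lookup_orbit_fun_base[OF i u] by simp
    then show "u \<in> ?ev ` ob (m i)" using x(1) by blast
  qed (use in_U in blast)
  then show ?thesis using fin_dim_image[OF fd su l] by simp
qed

text \<open>Each nonzero \<open>U i\<close> with \<open>m i = d\<close> contributes to degree
  \<open>d\<close> an element with \<open>i\<close> in its support, while a finite spanning set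
  involves only finitely many indices. By \<open>triv\<close> only the degrees
  \<open>d \<le> e\<close> occur.\<close>

lemma support_finite:
  assumes fd: "\<And>n. fin_dim s (ob n)" and triv: "\<And>i. i \<in> I \<Longrightarrow> e < m i \<Longrightarrow> U i = {0}"
  shows "finite {i \<in> I. U i \<noteq> {0}}"
proof -
  have "finite {i \<in> I. m i = d \<and> U i \<noteq> {0}}" for d
  proof -
    have "fin_dim sD (fobj D {1..d})"
      using fin_dim_image[OF fd UUU.vector_space_axioms theta_lin, of d] unfolding theta_image .
    then obtain B where B: "finite B" "UUU.span B = fobj D {1..d}" by (auto simp: fin_dim_def)
    let ?J = "\<Union>b\<in>B. Poly_Mapping.keys b"
    have span: "Poly_Mapping.keys x \<subseteq> ?J" if "x \<in> UUU.span B" for x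
      using that
    proof (induction rule: UUU.span_induct_alt)
      case (step c b y)
      have "Poly_Mapping.keys (sD c b + y) \<subseteq> Poly_Mapping.keys b \<union> Poly_Mapping.keys y"
        using Poly_Mapping.keys_add[of "sD c b" y] keys_pm_scale[OF UU.module_axioms, of c b] by blast
      then show ?case using step by blast
    qed simp
    have "i \<in> ?J" if i: "i \<in> I" "m i = d" "U i \<noteq> {0}" for i
    proof -
      obtain u where u: "u \<in> U i" "u \<noteq> 0" using i(3) U.subspace_0[OF rep_facts(1)[OF i(1)]] by blast
      have "Poly_Mapping.single i (orbit_fun i (gid (M i)) u) \<in> UUU.span B"
        unfolding B(2) i(2)[symmetric] by (rule orbit_fun_in_D[OF i(1) gid_Wr u(1)])
      moreover have "orbit_fun i (gid (M i)) u \<noteq> 0"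
        using lookup_orbit_fun_base[OF i(1) u(1)] u(2) by (metis lookup_zero)
      ultimately show ?thesis using span by fastforce
    qed
    then have "{i \<in> I. m i = d \<and> U i \<noteq> {0}} \<subseteq> ?J" by blast
    moreover have "finite ?J" using B(1) by simp
    ultimately show ?thesis by (rule finite_subset)
  qed
  moreover have "{i \<in> I. U i \<noteq> {0}} \<subseteq> (\<Union>d\<in>{..e}. {i \<in> I. m i = d \<and> U i \<noteq> {0}})"
    using triv by (auto simp: not_less[symmetric])
  ultimately show ?thesis by (meson finite_UN_I finite_atMost finite_subset)
qed

text \<open>Summing \<open>orbit_fun\<close> over all \<open>f\<close>, with the values of
  \<open>\<phi>\<close>, reproduces \<open>\<phi>\<close> once for each \<open>w\<close> in
  \<open>W_{m i}\<close>, whence the factor. Expanding these values in the frame \<open>B\<close>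
  gives rank-one terms for the trace.\<close>

lemma orbit_fun_expansion:
  assumes i: "i \<in> I" and fr: "frame su (U i) B c (\<lambda>b. b)" and \<phi>: "\<phi> \<in> fobj (Ind i) {1..n}" and g: "g \<in> Wr n"
  shows "push (comp (M i) g) \<phi> = (\<Sum>f\<in>Hom (M i) {1..n}. \<Sum>b\<in>B.
    pm_scale su (inverse (of_nat (card (Wr (m i)))) * c b (Poly_Mapping.lookup \<phi> f)) (orbit_fun i (comp (M i) g f) b))"
proof -
  let ?H = "Hom (M i) {1..n}" and ?W = "Wr (m i)" and ?l = "Poly_Mapping.lookup \<phi>"
  let ?k = "inverse (of_nat (card ?W)) :: 'k"
  note sub = rep_facts(1)[OF i]
  have k: "?k * of_nat (card ?W) = 1"
  proof -
    have "card ?W \<noteq> 0" using finite_Wr[of "m i"] gid_Wr card_0_eq by blast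
    then show ?thesis by simp
  qed
  have finH: "finite ?H" by (rule finite_Hom) auto
  have \<phi>H: "Poly_Mapping.keys \<phi> \<subseteq> ?H" "\<And>f. f \<in> ?H \<Longrightarrow> ?l f \<in> U i"
    "\<And>f w. f \<in> ?H \<Longrightarrow> w \<in> ?W \<Longrightarrow> \<rho> i w (?l (comp (M i) f w)) = ?l f"
    using \<phi> unfolding Ind_ob by blast+
  have bU: "b \<in> U i" if "b \<in> B" for b using fr that by (simp add: frame_def)
  have exp: "(\<Sum>b\<in>B. pm_scale su (?k * c b u) (orbit_fun i f b)) = pm_scale su ?k (orbit_fun i f u)" if u: "u \<in> U i" for f u
  proof -
    have "orbit_fun i f u = (\<Sum>w\<in>?W. Poly_Mapping.single (comp (M i) f w) (\<rho> i (ginv (M i) w) (\<Sum>b\<in>B. su (c b u) b)))"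
      unfolding orbit_fun_def using fr u by (simp add: frame_def)
    also have "\<dots> = (\<Sum>w\<in>?W. \<Sum>b\<in>B. pm_scale su (c b u) (Poly_Mapping.single (comp (M i) f w) (\<rho> i (ginv (M i) w) b)))"
    proof (rule sum.cong[OF refl])
      fix w assume w: "w \<in> ?W"
      note l = rep_facts(2)[OF i ginv_in[OF w]]
      have "\<rho> i (ginv (M i) w) (\<Sum>b\<in>B. su (c b u) b) = (\<Sum>b\<in>B. \<rho> i (ginv (M i) w) (su (c b u) b))"
        by (rule lin_map_sum[OF l U.module_axioms sub]) (rule U.subspace_scale[OF sub bU])
      also have "\<dots> = (\<Sum>b\<in>B. su (c b u) (\<rho> i (ginv (M i) w) b))"
        by (intro sum.cong refl lin_map_scale[OF l bU])
      finally show "Poly_Mapping.single (comp (M i) f w) (\<rho> i (ginv (M i) w) (\<Sum>b\<in>B. su (c b u) b)) =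
          (\<Sum>b\<in>B. pm_scale su (c b u) (Poly_Mapping.single (comp (M i) f w) (\<rho> i (ginv (M i) w) b)))"
        by (simp only: single_sum pm_scale_single[OF U.module_axioms])
    qed
    also have "\<dots> = (\<Sum>b\<in>B. pm_scale su (c b u) (orbit_fun i f b))"
      unfolding orbit_fun_def UU.scale_sum_right by (rule sum.swap)
    finally show ?thesis by (simp add: UU.scale_sum_right)
  qed
  have "(\<Sum>f\<in>?H. orbit_fun i f (?l f)) = (\<Sum>w\<in>?W. \<Sum>f\<in>?H. Poly_Mapping.single (comp (M i) f w) (\<rho> i (ginv (M i) w) (?l f)))"
    unfolding orbit_fun_def by (rule sum.swap)
  also have "\<dots> = (\<Sum>w\<in>?W. \<phi>)"
  proof (rule sum.cong[OF refl])
    fix w assume w: "w \<in> ?W"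
    have "(\<Sum>f\<in>?H. Poly_Mapping.single (comp (M i) f w) (\<rho> i (ginv (M i) w) (?l f))) =
        (\<Sum>f\<in>?H. Poly_Mapping.single (comp (M i) f w) (?l (comp (M i) f w)))"
    proof (rule sum.cong[OF refl])
      fix f assume f: "f \<in> ?H"
      have "\<rho> i (ginv (M i) w) (?l f) = ?l (comp (M i) f w)"
        using rho_ginv(1)[OF i w \<phi>H(2)[OF comp_in_Hom[OF w f]]] \<phi>H(3)[OF f w] by simp
      then show "Poly_Mapping.single (comp (M i) f w) (\<rho> i (ginv (M i) w) (?l f)) =
        Poly_Mapping.single (comp (M i) f w) (?l (comp (M i) f w))" by simp
    qed
    also have "\<dots> = (\<Sum>f\<in>?H. Poly_Mapping.single f (?l f))"
      by (rule sum.reindex_bij_betw[OF bij_comp_right[OF _ w], of "\<lambda>f. Poly_Mapping.single f (?l f)"]) simp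
    also have "\<dots> = \<phi>" by (rule poly_mapping_sum_single[OF finH \<phi>H(1)])
    finally show "(\<Sum>f\<in>?H. Poly_Mapping.single (comp (M i) f w) (\<rho> i (ginv (M i) w) (?l f))) = \<phi>" .
  qed
  finally have "pm_scale su ?k (\<Sum>f\<in>?H. orbit_fun i f (?l f)) = pm_scale su (?k * of_nat (card ?W)) \<phi>"
    by (simp add: UU.sum_constant_scale)
  then have \<phi>e: "\<phi> = (\<Sum>f\<in>?H. pm_scale su ?k (orbit_fun i f (?l f)))"
    unfolding k UU.scale_sum_right by simp
  have po: "push (comp (M i) g) (orbit_fun i f u) = orbit_fun i (comp (M i) g f) u" if f: "f \<in> ?H" for f u
    unfolding orbit_fun_def push_sum push_single
    by (intro sum.cong refl) (simp only: comp_assoc[OF _ f g])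
  have "push (comp (M i) g) \<phi> = push (comp (M i) g) (\<Sum>f\<in>?H. pm_scale su ?k (orbit_fun i f (?l f)))"
    by (rule arg_cong[OF \<phi>e])
  also have "\<dots> = (\<Sum>f\<in>?H. pm_scale su ?k (orbit_fun i (comp (M i) g f) (?l f)))"
    unfolding push_sum push_pm_scale[OF U.module_axioms]
    by (intro sum.cong refl) (simp only: po)
  also have "\<dots> = (\<Sum>f\<in>?H. \<Sum>b\<in>B. pm_scale su (?k * c b (?l f)) (orbit_fun i (comp (M i) g f) b))"
    by (intro sum.cong refl exp[OF \<phi>H(2), symmetric])
  finally show ?thesis .
qed

text \<open>The redundant expansion \<open>orbit_fun_expansion\<close> writes the action as a sum of
  rank-one maps, so the trace can be read off from it. The coefficient of \<open>cnt (M i) w\<close>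
  becomes the trace of \<open>\<rho> i w\<close> on \<open>U i\<close> divided by the order of
  \<open>W_{m i}\<close>, as in the usual formula for an induced character.\<close>

theorem character_rel_proj:
  assumes fd: "\<And>n. fin_dim s (ob n)" and triv: "\<And>i. i \<in> I \<Longrightarrow> e < m i \<Longrightarrow> U i = {0}"
  shows "\<exists>J q. (\<forall>i\<in>J. m i \<le> e) \<and> (\<forall>n. \<forall>g\<in>Wr n.
    trace_on s (ob n) (mp n n g) = (\<Sum>(i, w)\<in>(SIGMA i:J. Wr (m i)). q (i, w) * of_nat (cnt (M i) w {1..n} g)))"
proof -
  define J where "J = {i \<in> I. U i \<noteq> {0}}"
  have J: "finite J" "J \<subseteq> I" "\<And>i. i \<in> J \<Longrightarrow> m i \<le> e"
    using support_finite[OF fd triv] triv by (auto simp: J_def not_less[symmetric])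
  have "\<forall>i\<in>J. \<exists>B c. frame su (U i) B c (\<lambda>b. b)"
    using frame_ex[OF U_fin_dim[OF fd]] J(2) by blast
  then obtain B c where fr: "\<And>i. i \<in> J \<Longrightarrow> frame su (U i) (B i) (c i) (\<lambda>b. b)" by metis
  have B: "finite (B i)" "\<And>b. b \<in> B i \<Longrightarrow> b \<in> U i" "\<And>b. b \<in> B i \<Longrightarrow> lin_map su (U i) (*) UNIV (c i b)" if "i \<in> J" for i
    using fr[OF that] by (auto simp: frame_def)
  let ?k = "\<lambda>i. inverse (of_nat (card (Wr (m i)))) :: 'k"
  define q where "q p = (case p of (i, w) \<Rightarrow> ?k i * (\<Sum>b\<in>B i. c i b (\<rho> i w b)))" for p
  have "trace_on s (ob n) (mp n n g) = (\<Sum>(i, w)\<in>(SIGMA i:J. Wr (m i)). q (i, w) * of_nat (cnt (M i) w {1..n} g))"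
    if g: "g \<in> Wr n" for n g
  proof -
    let ?N = "{1..n}"
    let ?H = "\<lambda>i. Hom (M i) ?N"
    let ?T = "SIGMA i:J. ?H i \<times> B i"
    have finH: "finite (?H i)" for i by (rule finite_Hom) auto
    \<comment> \<open>Preimages under \<open>\<theta>\<close>: the vectors of the rank-one maps have
      to lie in \<open>X\<close>, not in its model \<open>D\<close>.\<close>
    define bk where "bk y = (SOME x. x \<in> ob n \<and> \<theta> ?N x = y)" for y
    have bk: "bk y \<in> ob n" "\<theta> ?N (bk y) = y" if "y \<in> fobj D ?N" for y
    proof -
      have "y \<in> \<theta> ?N ` ob n" using that unfolding theta_image .
      then have "\<exists>x. x \<in> ob n \<and> \<theta> ?N x = y" by (elim imageE) (rule exI, rule conjI, assumption, rule sym)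
      note * = someI_ex[OF this, folded bk_def]
      show "bk y \<in> ob n" "\<theta> ?N (bk y) = y" by (rule conjunct1[OF *], rule conjunct2[OF *])
    qed
    let ?C = "\<lambda>i f b x. ?k i * c i b (Poly_Mapping.lookup (Poly_Mapping.lookup (\<theta> ?N x) i) f)"
    let ?u = "\<lambda>i f b. Poly_Mapping.single i (orbit_fun i (comp (M i) g f) b)"
    have uD: "?u i f b \<in> fobj D ?N" if "i \<in> J" "f \<in> ?H i" "b \<in> B i" for i f b
      by (rule orbit_fun_in_D[OF _ comp_in_Hom[OF that(2) g] B(2)]) (use that J(2) in auto)
    have lookU: "Poly_Mapping.lookup (Poly_Mapping.lookup (\<theta> ?N x) i) f \<in> U i" if "x \<in> ob n" "i \<in> J" "f \<in> ?H i" for x i f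
      using lin_map_in[OF theta_lin that(1)] that(2,3) J(2) unfolding D_ob Ind_ob by blast
    have Cl: "lin_map s (ob n) (*) UNIV (?C i f b)" if "i \<in> J" "f \<in> ?H i" "b \<in> B i" for i f b
    proof (rule lin_mapI)
      fix x y assume xy: "x \<in> ob n" "y \<in> ob n"
      show "?C i f b (x + y) = ?C i f b x + ?C i f b y"
        unfolding lin_map_add[OF theta_lin xy] lookup_add
          lin_map_add[OF B(3)[OF that(1,3)] lookU[OF xy(1) that(1,2)] lookU[OF xy(2) that(1,2)]]
        by (rule distrib_left)
    next
      fix a x assume x: "x \<in> ob n"
      show "?C i f b (s a x) = a * ?C i f b x"
        unfolding lin_map_scale[OF theta_lin x] lookup_pm_scale[OF UU.module_axioms] lookup_pm_scale[OF U.module_axioms]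
          lin_map_scale[OF B(3)[OF that(1,3)] lookU[OF x that(1,2)]]
        by (rule mult.left_commute)
    qed simp
    have finT: "finite ?T" using J(1) finH B(1) by auto
    have sumT: "(\<Sum>i\<in>J. \<Sum>f\<in>?H i. \<Sum>b\<in>B i. h i f b) = (\<Sum>(i, f, b)\<in>?T. h i f b)"
      for h :: "'i \<Rightarrow> 'g gmap \<Rightarrow> 'u \<Rightarrow> 'z::comm_monoid_add"
      using J(1) finH B(1) by (subst sum.Sigma[symmetric]) (auto simp: sum.cartesian_product)
    have "trace_on s (ob n) (mp n n g) = (\<Sum>(i, f, b)\<in>?T. ?C i f b (bk (?u i f b)))"
    proof -
      have "trace_on s (ob n) (mp n n g) =
          (\<Sum>p\<in>?T. (case p of (i, f, b) \<Rightarrow> ?C i f b) (case p of (i, f, b) \<Rightarrow> bk (?u i f b)))"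
      proof (rule trace_nuclear[OF fd finT])
        fix p assume "p \<in> ?T"
        then obtain i f b where p: "p = (i, f, b)" "i \<in> J" "f \<in> ?H i" "b \<in> B i" by blast
        show "lin_map s (ob n) (*) UNIV (case p of (i, f, b) \<Rightarrow> ?C i f b)"
          unfolding p(1) prod.case by (rule Cl[OF p(2-4)])
        show "(case p of (i, f, b) \<Rightarrow> bk (?u i f b)) \<in> ob n"
          unfolding p(1) prod.case by (rule bk(1)[OF uD[OF p(2-4)]])
      next
        fix x assume x: "x \<in> ob n"
        let ?y = "\<theta> ?N x"
        have yD: "?y \<in> fobj D ?N" by (rule lin_map_in[OF theta_lin x])
        let ?R = "\<Sum>i\<in>J. \<Sum>f\<in>?H i. \<Sum>b\<in>B i. s (?C i f b x) (bk (?u i f b))"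
        have in1: "s (?C i f b x) (bk (?u i f b)) \<in> ob n" if "i \<in> J" "f \<in> ?H i" "b \<in> B i" for i f b
          by (intro V.subspace_scale[OF ob_subspace] bk(1) uD that)
        have Rob: "?R \<in> ob n" by (intro V.subspace_sum[OF ob_subspace] in1)
        note ls = lin_map_sum[OF theta_lin V.module_axioms ob_subspace]
        have "\<theta> ?N ?R = (\<Sum>i\<in>J. \<Sum>f\<in>?H i. \<Sum>b\<in>B i. \<theta> ?N (s (?C i f b x) (bk (?u i f b))))"
          by (subst ls, (intro V.subspace_sum[OF ob_subspace] in1; assumption), rule sum.cong[OF refl],
              subst ls, (intro V.subspace_sum[OF ob_subspace] in1; assumption), rule sum.cong[OF refl],
              subst ls, (intro in1; assumption), rule refl)
        also have "\<dots> = (\<Sum>i\<in>J. \<Sum>f\<in>?H i. \<Sum>b\<in>B i. sD (?C i f b x) (?u i f b))"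
          by (intro sum.cong refl) (simp only: lin_map_scale[OF theta_lin bk(1)[OF uD]] bk(2)[OF uD])
        also have "\<dots> = (\<Sum>i\<in>J. Poly_Mapping.single i (push (comp (M i) g) (Poly_Mapping.lookup ?y i)))"
        proof (rule sum.cong[OF refl])
          fix i assume i: "i \<in> J"
          have yi: "Poly_Mapping.lookup ?y i \<in> fobj (Ind i) ?N" using yD i J(2) unfolding D_ob by blast
          have iI: "i \<in> I" using i J(2) by blast
          show "(\<Sum>f\<in>?H i. \<Sum>b\<in>B i. sD (?C i f b x) (?u i f b)) =
              Poly_Mapping.single i (push (comp (M i) g) (Poly_Mapping.lookup ?y i))"
            unfolding orbit_fun_expansion[OF iI fr[OF i] yi g] single_sum pm_scale_single[OF UU.module_axioms] ..
        qed
        also have "\<dots> = (\<Sum>i\<in>J. Poly_Mapping.single i (Poly_Mapping.lookup (fmap D ?N ?N g ?y) i))"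
          unfolding lookup_D ..
        also have "\<dots> = fmap D ?N ?N g ?y"
        proof (rule poly_mapping_sum_single[OF J(1)])
          \<comment> \<open>A nonzero component at \<open>i\<close> has a nonzero value in
            \<open>U i\<close>, so \<open>i\<close> is one of the finitely many indices in
            \<open>J\<close>.\<close>
          show "Poly_Mapping.keys (fmap D ?N ?N g ?y) \<subseteq> J"
          proof
            fix i assume "i \<in> Poly_Mapping.keys (fmap D ?N ?N g ?y)"
            then have ne: "Poly_Mapping.lookup ?y i \<noteq> 0"
              unfolding in_keys_iff lookup_D using push_zero by metis
            then have iI: "i \<in> I" using yD unfolding D_ob by (auto simp: in_keys_iff)
            obtain f where f: "Poly_Mapping.lookup (Poly_Mapping.lookup ?y i) f \<noteq> 0"
              using ne keys_eq_empty[of "Poly_Mapping.lookup ?y i"] by (auto simp: in_keys_iff simp del: keys_eq_empty)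
            have "Poly_Mapping.lookup ?y i \<in> fobj (Ind i) ?N" using yD iI unfolding D_ob by blast
            then have "Poly_Mapping.lookup (Poly_Mapping.lookup ?y i) f \<in> U i"
              using f unfolding Ind_ob by (meson in_keys_iff subsetD)
            then show "i \<in> J" using f iI by (auto simp: J_def)
          qed
        qed
        also have "\<dots> = \<theta> ?N (mp n n g x)" by (rule theta_nat[OF g x, symmetric])
        finally have "mp n n g x = ?R"
          by (intro theta_inj[OF mp_in[OF g x] Rob]) simp
        also have "?R = (\<Sum>p\<in>?T. s ((case p of (i, f, b) \<Rightarrow> ?C i f b) x) (case p of (i, f, b) \<Rightarrow> bk (?u i f b)))"
          unfolding sumT by (rule sum.cong[OF refl]) (simp split: prod.split)
        finally show "mp n n g x = (\<Sum>p\<in>?T. s ((case p of (i, f, b) \<Rightarrow> ?C i f b) x) (case p of (i, f, b) \<Rightarrow> bk (?u i f b)))" .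
      qed
      also have "\<dots> = (\<Sum>(i, f, b)\<in>?T. ?C i f b (bk (?u i f b)))"
        by (rule sum.cong[OF refl]) (simp split: prod.split)
      finally show ?thesis .
    qed
    also have "\<dots> = (\<Sum>i\<in>J. \<Sum>f\<in>?H i. \<Sum>b\<in>B i. ?C i f b (bk (?u i f b)))"
      by (rule sumT[symmetric])
    also have "\<dots> = (\<Sum>i\<in>J. \<Sum>w\<in>Wr (m i). q (i, w) * of_nat (cnt (M i) w ?N g))"
    proof (rule sum.cong[OF refl])
      fix i assume i: "i \<in> J"
      have iI: "i \<in> I" using i J(2) by blast
      note sub = rep_facts(1)[OF iI]
      have "(\<Sum>f\<in>?H i. \<Sum>b\<in>B i. ?C i f b (bk (?u i f b))) = (\<Sum>f\<in>?H i. \<Sum>b\<in>B i. \<Sum>w\<in>Wr (m i).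
          if comp (M i) (comp (M i) g f) w = f then ?k i * c i b (\<rho> i (ginv (M i) w) b) else 0)"
      proof (intro sum.cong refl)
        fix f b assume f: "f \<in> ?H i" and b: "b \<in> B i"
        have l: "lin_map su (U i) (*) UNIV (c i b)" by (rule B(3)[OF i b])
        have \<rho>b: "\<rho> i (ginv (M i) w) b \<in> U i" if "w \<in> Wr (m i)" for w
          by (rule lin_map_in[OF rep_facts(2)[OF iI ginv_in[OF that]] B(2)[OF i b]])
        have "?C i f b (bk (?u i f b)) = ?k i * c i b (Poly_Mapping.lookup (orbit_fun i (comp (M i) g f) b) f)"
          by (simp only: bk(2)[OF uD[OF i f b]] lookup_single_eq)
        also have "\<dots> = ?k i * (\<Sum>w\<in>Wr (m i). c i b (if comp (M i) (comp (M i) g f) w = f then \<rho> i (ginv (M i) w) b else 0))"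
          unfolding lookup_orbit_fun
          by (subst lin_map_sum[OF l U.module_axioms sub]) (simp_all add: \<rho>b[simplified] U.subspace_0[OF sub])
        also have "\<dots> = (\<Sum>w\<in>Wr (m i). if comp (M i) (comp (M i) g f) w = f then ?k i * c i b (\<rho> i (ginv (M i) w) b) else 0)"
          unfolding sum_distrib_left
          by (intro sum.cong refl) (simp add: lin_map_zero[OF l U.module_axioms sub])
        finally show "?C i f b (bk (?u i f b)) = \<dots>" .
      qed
      also have "\<dots> = (\<Sum>f\<in>?H i. \<Sum>w\<in>Wr (m i). if comp (M i) (comp (M i) g f) w = f then q (i, ginv (M i) w) else 0)"
      proof (rule sum.cong[OF refl])
        fix f
        show "(\<Sum>b\<in>B i. \<Sum>w\<in>Wr (m i). if comp (M i) (comp (M i) g f) w = f then ?k i * c i b (\<rho> i (ginv (M i) w) b) else 0) =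
            (\<Sum>w\<in>Wr (m i). if comp (M i) (comp (M i) g f) w = f then q (i, ginv (M i) w) else 0)"
          by (subst sum.swap) (intro sum.cong refl, simp add: q_def sum_distrib_left)
      qed
      also have "\<dots> = (\<Sum>w\<in>Wr (m i). \<Sum>f\<in>?H i. if comp (M i) (comp (M i) g f) w = f then q (i, ginv (M i) w) else 0)"
        by (rule sum.swap)
      also have "\<dots> = (\<Sum>w\<in>Wr (m i). q (i, ginv (M i) w) * of_nat (cnt (M i) (ginv (M i) w) ?N g))"
      proof (rule sum.cong[OF refl])
        fix w assume w: "w \<in> Wr (m i)"
        \<comment> \<open>Moving \<open>w\<close> to the other side yields the intertwining
          condition for \<open>w\<inverse>\<close>; the sum over \<open>W_{m i}\<close> is
          afterwards reindexed by inversion.\<close>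
        have "comp (M i) (comp (M i) g f) w = f \<longleftrightarrow> comp (M i) g f = comp (M i) f (ginv (M i) w)" if f: "f \<in> ?H i" for f
          using comp_comp_ginv[OF _ w comp_in_Hom[OF f g]] comp_comp_ginv[OF _ w f] by force
        then have "(\<Sum>f\<in>?H i. if comp (M i) (comp (M i) g f) w = f then q (i, ginv (M i) w) else 0) =
            (\<Sum>f\<in>?H i. if comp (M i) g f = comp (M i) f (ginv (M i) w) then q (i, ginv (M i) w) else 0)"
          by (intro sum.cong) auto
        then show "(\<Sum>f\<in>?H i. if comp (M i) (comp (M i) g f) w = f then q (i, ginv (M i) w) else 0) =
            q (i, ginv (M i) w) * of_nat (cnt (M i) (ginv (M i) w) ?N g)"
          unfolding sum_if_card[OF finH] cnt_def by (simp only: mult.commute)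
      qed
      also have "\<dots> = (\<Sum>w\<in>Wr (m i). q (i, w) * of_nat (cnt (M i) w ?N g))"
        by (rule sum.reindex_bij_betw[OF bij_ginv, of _ "\<lambda>w. q (i, w) * of_nat (cnt (M i) w ?N g)"]) simp
      finally show "(\<Sum>f\<in>?H i. \<Sum>b\<in>B i. ?C i f b (bk (?u i f b))) = \<dots>" .
    qed
    also have "\<dots> = (\<Sum>(i, w)\<in>(SIGMA i:J. Wr (m i)). q (i, w) * of_nat (cnt (M i) w ?N g))"
      using J(1) finite_Wr by (subst sum.Sigma) auto
    finally show ?thesis .
  qed
  then show ?thesis using J(3) by blast
qed

end


section \<open>Character polynomials\<close>

context finite_group
begin

text \<open>Lifts of the generators of \<open>V\<close> together with the images of those of
  \<open>K\<close> generate \<open>P\<close>. This feeds \<open>U_trivial\<close>, which bounds the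
  degrees from which \<open>P\<close> is induced.\<close>

lemma extension_spanned:
  assumes K: "fig_mod G u K" and P: "fig_mod G t P" and V: "fig_mod G s V"
    and ex: "fig_short_exact G u K \<iota> t P \<pi> s V"
    and genK: "fig_mod.generated G u K e JK dK vK" and genV: "fig_mod.generated G s V e JV dV vV"
  shows "fobj P {1..n} \<subseteq> module.span t {fmap P {1..j} {1..n} f y | j f y.
    j \<le> e \<and> f \<in> Hom {1..j} {1..n} \<and> y \<in> fobj P {1..j}}"
proof
  interpret K: fig_mod G u K by fact
  interpret P: fig_mod G t P by fact
  interpret V: fig_mod G s V by fact
  have i: "fig_module_hom G u K t P \<iota>" and p: "fig_module_hom G t P s V \<pi>" and surj: "fig_surj P V \<pi>"
    and ker: "\<And>n. \<iota> {1..n} ` K.ob n = {x \<in> P.ob n. \<pi> {1..n} x = 0}"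
    using ex by (auto simp: fig_short_exact_def)
  let ?G = "{P.mp j n f y | j f y. j \<le> e \<and> f \<in> Hom {1..j} {1..n} \<and> y \<in> P.ob j}"
  have base: "P.mp j n f y \<in> P.V.span ?G" if "j \<le> e" "f \<in> Hom {1..j} {1..n}" "y \<in> P.ob j" for j f y
    by (rule P.V.span_base) (use that in blast)
  have il: "lin_map u (K.ob n) t (P.ob n) (\<iota> {1..n})" for n by (rule fig_module_hom_lin[OF i]) simp
  have pl: "lin_map t (P.ob n) s (V.ob n) (\<pi> {1..n})" for n by (rule fig_module_hom_lin[OF p]) simp
  let ?IK = "SIGMA j:JK. Hom {1..dK j} {1..n}" and ?IV = "SIGMA j:JV. Hom {1..dV j} {1..n}"
  have fin: "finite ?IK" "finite ?IV"
    using genK genV unfolding K.generated_def V.generated_def by (auto intro!: finite_Hom)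
  have spK: "K.V.span ((\<lambda>(j, f). K.mp (dK j) n f (vK j)) ` ?IK) = K.ob n"
    and K1: "\<And>j. j \<in> JK \<Longrightarrow> dK j \<le> e \<and> vK j \<in> K.ob (dK j)"
    using genK unfolding K.generated_def by blast+
  have spV: "V.V.span ((\<lambda>(j, f). V.mp (dV j) n f (vV j)) ` ?IV) = V.ob n"
    and V1: "\<And>j. j \<in> JV \<Longrightarrow> dV j \<le> e \<and> vV j \<in> V.ob (dV j)"
    using genV unfolding V.generated_def by blast+
  obtain cK where cK: "frame u (K.ob n) ?IK cK (\<lambda>(j, f). K.mp (dK j) n f (vK j))"
    using frame_of_spanning[OF K.V.vector_space_axioms fin(1) spK] by blast
  obtain cV where cV: "frame s (V.ob n) ?IV cV (\<lambda>(j, f). V.mp (dV j) n f (vV j))"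
    using frame_of_spanning[OF V.V.vector_space_axioms fin(2) spV] by blast
  have "\<exists>y. y \<in> P.ob (dV j) \<and> \<pi> {1..dV j} y = vV j" if "j \<in> JV" for j
    using surj V1[OF that] unfolding fig_surj_def by (metis finite_atLeastAtMost imageE)
  then obtain l where l: "\<And>j. j \<in> JV \<Longrightarrow> l j \<in> P.ob (dV j) \<and> \<pi> {1..dV j} (l j) = vV j" by metis
  have kerspan: "\<iota> {1..n} z \<in> P.V.span ?G" if z: "z \<in> K.ob n" for z
  proof -
    have zs: "z = (\<Sum>q\<in>?IK. u (cK q z) (case q of (j, f) \<Rightarrow> K.mp (dK j) n f (vK j)))"
      using cK z by (simp add: frame_def)
    have fK: "(case q of (j, f) \<Rightarrow> K.mp (dK j) n f (vK j)) \<in> K.ob n" if "q \<in> ?IK" for q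
      using cK that unfolding frame_def by blast
    have "\<iota> {1..n} z = (\<Sum>q\<in>?IK. \<iota> {1..n} (u (cK q z) (case q of (j, f) \<Rightarrow> K.mp (dK j) n f (vK j))))"
      by (subst zs, rule lin_map_sum[OF il K.V.module_axioms K.ob_subspace])
        (rule K.V.subspace_scale[OF K.ob_subspace fK])
    also have "\<dots> \<in> P.V.span ?G"
    proof (rule P.V.span_sum)
      fix q assume q: "q \<in> ?IK"
      then obtain j f where jf: "q = (j, f)" "j \<in> JK" "f \<in> Hom {1..dK j} {1..n}" by (elim SigmaE)
      have "\<iota> {1..n} (K.mp (dK j) n f (vK j)) = P.mp (dK j) n f (\<iota> {1..dK j} (vK j))"
        by (rule fig_module_hom_nat[OF i _ _ jf(3)]) (use K1[OF jf(2)] in auto)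
      also have "\<dots> \<in> P.V.span ?G"
        by (rule base[OF _ jf(3) lin_map_in[OF il]]) (use K1[OF jf(2)] in auto)
      finally show "\<iota> {1..n} (u (cK q z) (case q of (j, f) \<Rightarrow> K.mp (dK j) n f (vK j))) \<in> P.V.span ?G"
        unfolding lin_map_scale[OF il fK[OF q]] unfolding jf(1) prod.case by (rule P.V.span_scale)
    qed
    finally show ?thesis .
  qed
  fix x assume x: "x \<in> P.ob n"
  have px: "\<pi> {1..n} x \<in> V.ob n" by (rule lin_map_in[OF pl x])
  let ?y = "\<lambda>q. case q of (j, f) \<Rightarrow> P.mp (dV j) n f (l j)"
  \<comment> \<open>A lift of the image of \<open>x\<close> built from lifts of the generators of
    \<open>V\<close>; its difference from \<open>x\<close> comes from \<open>K\<close>.\<close>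
  let ?x = "\<Sum>q\<in>?IV. t (cV q (\<pi> {1..n} x)) (?y q)"
  have y: "?y q \<in> P.ob n \<and> ?y q \<in> P.V.span ?G \<and> \<pi> {1..n} (?y q) = (case q of (j, f) \<Rightarrow> V.mp (dV j) n f (vV j))"
    if "q \<in> ?IV" for q
  proof -
    obtain j f where jf: "q = (j, f)" "j \<in> JV" "f \<in> Hom {1..dV j} {1..n}" using \<open>q \<in> ?IV\<close> by (elim SigmaE)
    have lj: "l j \<in> P.ob (dV j)" "\<pi> {1..dV j} (l j) = vV j" using l[OF jf(2)] by auto
    have "\<pi> {1..n} (P.mp (dV j) n f (l j)) = V.mp (dV j) n f (vV j)"
      unfolding lj(2)[symmetric] by (rule fig_module_hom_nat[OF p _ _ jf(3) lj(1)]) auto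
    then show ?thesis
      unfolding jf(1) prod.case using P.mp_in[OF jf(3) lj(1)] base[OF _ jf(3) lj(1)] V1[OF jf(2)] by blast
  qed
  have x': "?x \<in> P.ob n" by (intro P.V.subspace_sum[OF P.ob_subspace] P.V.subspace_scale[OF P.ob_subspace]) (use y in blast)
  have "\<pi> {1..n} ?x = (\<Sum>q\<in>?IV. \<pi> {1..n} (t (cV q (\<pi> {1..n} x)) (?y q)))"
    by (rule lin_map_sum[OF pl P.V.module_axioms P.ob_subspace]) (rule P.V.subspace_scale[OF P.ob_subspace], use y in blast)
  also have "\<dots> = (\<Sum>q\<in>?IV. s (cV q (\<pi> {1..n} x)) (case q of (j, f) \<Rightarrow> V.mp (dV j) n f (vV j)))"
  proof (rule sum.cong[OF refl])
    fix q assume "q \<in> ?IV"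
    then have q: "?y q \<in> P.ob n" "\<pi> {1..n} (?y q) = (case q of (j, f) \<Rightarrow> V.mp (dV j) n f (vV j))" using y by blast+
    show "\<pi> {1..n} (t (cV q (\<pi> {1..n} x)) (?y q)) = s (cV q (\<pi> {1..n} x)) (case q of (j, f) \<Rightarrow> V.mp (dV j) n f (vV j))"
      unfolding lin_map_scale[OF pl q(1)] q(2) ..
  qed
  also have "\<dots> = \<pi> {1..n} x" using cV px by (simp add: frame_def)
  finally have "\<pi> {1..n} (x - ?x) = 0"
    using lin_map_minus[OF pl P.V.module_axioms P.ob_subspace x x'] by simp
  then have "x - ?x \<in> \<iota> {1..n} ` K.ob n" unfolding ker using P.V.subspace_diff[OF P.ob_subspace x x'] by blast
  then have "x - ?x \<in> P.V.span ?G" using kerspan by (elim imageE) simp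
  moreover have "?x \<in> P.V.span ?G"
    by (intro P.V.span_sum P.V.span_scale) (use y in blast)
  ultimately have "(x - ?x) + ?x \<in> P.V.span ?G" by (rule P.V.span_add)
  then show "x \<in> P.V.span ?G" by simp
qed

end

theorem theorem2p2:
  fixes G :: "('g, 'b) monoid_scheme"
    and s :: "'k::field_char_0 \<Rightarrow> 'v::ab_group_add \<Rightarrow> 'v"
    and V :: "('g, 'v) fig_functor"
    and m r :: nat
  assumes "group G" and "finite (carrier G)"
    and "splitting_field G TYPE('k)"
    and "fig_module G s V"
    and "finitely_generated G s V"
    and "generated_in_degree_le G s V m"
    and "related_in_degree_le TYPE('i) TYPE('u::ab_group_add) G s V r"
  shows "\<exists>P :: (nat \<times> 'g set, 'k) mpolynomial.
           mpoly_over ({1..} \<times> conjugacy_classes G) P \<and>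
           mpoly_degree_le fst P m \<and>
           (\<forall>n \<ge> r + min m r. \<forall>g \<in> carrier (wreath G n).
              fig_character s V n g = char_poly_eval G n g P)"
proof -
  interpret finite_group G
    using assms(1,2) by (simp add: finite_group_def finite_group_axioms_def)
  have fm: "fig_mod G s' X" if "fig_module G s' X" for s' :: "'k \<Rightarrow> 'w::ab_group_add \<Rightarrow> 'w" and X
    using that finite_group_axioms by (simp add: fig_mod_def fig_mod_axioms_def)
  obtain t and P :: "('g, 'i \<Rightarrow>\<^sub>0 'g gmap \<Rightarrow>\<^sub>0 'u) fig_functor"
    and u and K :: "('g, 'i \<Rightarrow>\<^sub>0 'g gmap \<Rightarrow>\<^sub>0 'u) fig_functor" and \<iota> \<pi>
    where PK: "fig_module G t P" "fig_module G u K"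
      "relatively_projective TYPE('i) TYPE('u) G t P" "generated_in_degree_le G u K r"
      "fig_short_exact G u K \<iota> t P \<pi> s V"
    using assms(7) unfolding related_in_degree_le_def by blast
  interpret V: fig_mod G s V by (rule fm[OF assms(4)])
  interpret P: fig_mod G t P by (rule fm[OF PK(1)])
  interpret K: fig_mod G u K by (rule fm[OF PK(2)])
  obtain su :: "'k \<Rightarrow> 'u \<Rightarrow> 'u" and I :: "'i set" and d :: "'i \<Rightarrow> nat" and U :: "'i \<Rightarrow> 'u set" and \<rho>
    where su: "vector_space su" "\<And>i. i \<in> I \<Longrightarrow> group_rep (wreath G (d i)) su (U i) (\<rho> i)"
      "fig_isomorphic G t P (pm_scale (pm_scale su)) (fig_dsum I (\<lambda>i. fig_Ind G (d i) (U i) (\<rho> i)))"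
    using PK(3) unfolding relatively_projective_def by blast
  obtain \<theta> where \<theta>: "fig_module_hom G t P (pm_scale (pm_scale su)) (fig_dsum I (\<lambda>i. fig_Ind G (d i) (U i) (\<rho> i))) \<theta>"
    "fig_inj P \<theta>" "fig_surj P (fig_dsum I (\<lambda>i. fig_Ind G (d i) (U i) (\<rho> i))) \<theta>"
    using su(3) unfolding fig_isomorphic_def by blast
  interpret R: rel_proj G t P su I d U \<rho> \<theta>
    by (intro rel_proj.intro rel_proj_axioms.intro P.fig_mod_axioms su(1,2) \<theta>)
  obtain JV :: "nat set" and dV vV where genV: "V.generated m JV dV vV"
    using V.fin_gen_generated assms(6) unfolding generated_in_degree_le_def by blast
  obtain JK :: "nat set" and dK vK where genK: "K.generated r JK dK vK"
    using K.fin_gen_generated PK(4) unfolding generated_in_degree_le_def by blast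
  note fdV = V.generated_fin_dim[OF genV] and fdK = K.generated_fin_dim[OF genK]
  have i: "fig_module_hom G u K t P \<iota>" and p: "fig_module_hom G t P s V \<pi>" and surj: "fig_surj P V \<pi>"
    and inj: "fig_inj K \<iota>"
    and ker: "\<And>n. \<iota> {1..n} ` K.ob n = {x \<in> P.ob n. \<pi> {1..n} x = 0}"
    using PK(5) by (auto simp: fig_short_exact_def)
  have il: "lin_map u (K.ob n) t (P.ob n) (\<iota> {1..n})" for n by (rule fig_module_hom_lin[OF i]) simp
  have pl: "lin_map t (P.ob n) s (V.ob n) (\<pi> {1..n})" for n by (rule fig_module_hom_lin[OF p]) simp
  have ps: "\<pi> {1..n} ` P.ob n = V.ob n" for n using surj by (simp add: fig_surj_def)
  \<comment> \<open>Finite dimension of \<open>P\<close> is inherited from the finitely generated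
    modules \<open>K\<close> and \<open>V\<close>.\<close>
  have fdP: "fin_dim t (P.ob n)" for n
    by (rule fin_dim_extension[OF fdK fdV P.V.vector_space_axioms P.ob_subspace il pl ps ker])
  let ?v = "\<lambda>n g. (\<lambda>(i, C). of_nat (labeled_cycles G n i C g)) :: nat \<times> 'g set \<Rightarrow> 'k"
  let ?X = "{1..} \<times> conjugacy_classes G"
  have "\<exists>F. polyfun ?X fst m F \<and> (\<forall>n \<ge> r + min m r. \<forall>g\<in>Wr n. trace_on s (V.ob n) (V.mp n n g) = F (?v n g))"
  proof (cases "r \<le> m")
    case False
    \<comment> \<open>\<open>V\<close> has generators of degree at most \<open>m\<close> and delay
      \<open>r\<close>, so its character is stable from \<open>m + max r m = m + r\<close>
      on.\<close>
    have "up_injective s V r"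
      by (rule up_injective_quotient[OF K.fig_mod_axioms P.fig_mod_axioms V.fig_mod_axioms PK(5) R.up_injective_X genK])
    then obtain q where q: "\<forall>n\<ge>m + max r m. \<forall>g\<in>Wr n.
        trace_on s (V.ob n) (V.mp n n g) = (\<Sum>(a, h)\<in>idx m. q (a, h) * of_nat (cnt {1..a} h {1..n} g))"
      using V.character_stable[OF genV, of r] unfolding up_injective_def by blast
    have "\<exists>F. polyfun ?X fst m F \<and> (\<forall>n. \<forall>g\<in>Wr n. (\<Sum>p\<in>idx m. q p * of_nat (cnt {1..fst p} (snd p) {1..n} g)) = F (?v n g))"
      by (rule cnt_combination_polyfun) (auto simp: idx_def)
    moreover have "m + max r m = r + min m r" using False by simp
    ultimately show ?thesis using q by (auto simp: case_prod_beta)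
  next
    case True
    \<comment> \<open>\<open>K\<close> inherits injectivity from \<open>P\<close> without delay, so
      its character is stable from \<open>r + r\<close> on, the claimed bound for
      \<open>r \<le> m\<close>.\<close>
    have "up_injective u K 0"
      by (rule up_injective_sub[OF K.fig_mod_axioms P.fig_mod_axioms i inj R.up_injective_X])
    then obtain qK where qK: "\<forall>n\<ge>r + max 0 r. \<forall>g\<in>Wr n.
        trace_on u (K.ob n) (K.mp n n g) = (\<Sum>(a, h)\<in>idx r. qK (a, h) * of_nat (cnt {1..a} h {1..n} g))"
      using K.character_stable[OF genK, of 0] unfolding up_injective_def by blast
    \<comment> \<open>The case assumption \<open>r \<le> m\<close> bounds the generators of
      \<open>K\<close> by \<open>m\<close>, which confines the inducing degrees of \<open>P\<close>
      to at most \<open>m\<close>.\<close>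
    have genK': "K.generated m JK dK vK" using genK True unfolding K.generated_def by (meson order_trans)
    have triv: "U i = {0}" if "i \<in> I" "m < d i" for i
      by (rule R.U_trivial[OF extension_spanned[OF K.fig_mod_axioms P.fig_mod_axioms V.fig_mod_axioms PK(5) genK' genV] that])
    have "\<exists>J qP. (\<forall>i\<in>J. d i \<le> m) \<and> (\<forall>n. \<forall>g\<in>Wr n. trace_on t (P.ob n) (P.mp n n g) =
        (\<Sum>(i, w)\<in>(SIGMA i:J. Wr (d i)). qP (i, w) * of_nat (cnt {1..d i} w {1..n} g)))"
      by (rule R.character_rel_proj[OF fdP triv])
    then obtain J qP where qP: "\<forall>i\<in>J. d i \<le> m" "\<forall>n. \<forall>g\<in>Wr n.
        trace_on t (P.ob n) (P.mp n n g) = (\<Sum>(i, w)\<in>(SIGMA i:J. Wr (d i)). qP (i, w) * of_nat (cnt {1..d i} w {1..n} g))"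
      by (elim exE conjE)
    obtain FK where FK: "polyfun ?X fst r FK"
      "\<forall>n. \<forall>g\<in>Wr n. (\<Sum>p\<in>idx r. qK p * of_nat (cnt {1..fst p} (snd p) {1..n} g)) = FK (?v n g)"
    proof -
      have "\<forall>p\<in>idx r. fst p \<le> r \<and> snd p \<in> Wr (fst p)" by (auto simp: idx_def)
      from cnt_combination_polyfun[of "idx r" fst r snd qK, OF this] that show ?thesis by (elim exE conjE)
    qed
    obtain FP where FP: "polyfun ?X fst m FP"
      "\<forall>n. \<forall>g\<in>Wr n. (\<Sum>p\<in>(SIGMA i:J. Wr (d i)). qP p * of_nat (cnt {1..d (fst p)} (snd p) {1..n} g)) = FP (?v n g)"
    proof -
      have "\<forall>p\<in>(SIGMA i:J. Wr (d i)). d (fst p) \<le> m \<and> snd p \<in> Wr (d (fst p))" using qP(1) by auto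
      from cnt_combination_polyfun[of "SIGMA i:J. Wr (d i)" "\<lambda>p. d (fst p)" m snd qP, OF this] that show ?thesis
        by (elim exE conjE)
    qed
    show ?thesis
    proof (intro exI[of _ "\<lambda>v. FP v + (- 1) * FK v"] conjI allI impI ballI)
      show "polyfun ?X fst m (\<lambda>v. FP v + (- 1) * FK v)"
        by (intro polyfun_add polyfun_scale FP(1) polyfun_mono[OF FK(1) True])
      fix n g assume n: "r + min m r \<le> n" and g: "g \<in> Wr n"
      have "trace_on t (P.ob n) (P.mp n n g) = trace_on u (K.ob n) (K.mp n n g) + trace_on s (V.ob n) (V.mp n n g)"
      proof (rule trace_exact[OF fdK fdP fdV il _ pl ps ker K.mp_lin[OF g] P.mp_lin[OF g] V.mp_lin[OF g]])
        show "inj_on (\<iota> {1..n}) (K.ob n)" using inj by (simp add: fig_inj_def)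
        show "\<iota> {1..n} (K.mp n n g x) = P.mp n n g (\<iota> {1..n} x)" if "x \<in> K.ob n" for x
          by (rule fig_module_hom_nat[OF i _ _ g that]) auto
        show "\<pi> {1..n} (P.mp n n g x) = V.mp n n g (\<pi> {1..n} x)" if "x \<in> P.ob n" for x
          by (rule fig_module_hom_nat[OF p _ _ g that]) auto
      qed
      moreover have "trace_on u (K.ob n) (K.mp n n g) = FK (?v n g)"
        using qK n g True FK(2)[rule_format, OF g] by (simp add: case_prod_beta)
      moreover have "trace_on t (P.ob n) (P.mp n n g) = FP (?v n g)"
        using qP(2)[rule_format, OF g] FP(2)[rule_format, OF g] by (simp add: case_prod_beta)
      ultimately show "trace_on s (V.ob n) (V.mp n n g) = FP (?v n g) + (- 1) * FK (?v n g)"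
        by (simp add: algebra_simps)
    qed
  qed
  then show ?thesis
    unfolding polyfun_def fig_character_def char_poly_eval_def wreath_def by auto
qed

end
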